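(* For a tangent-cone graph-like polygon $\Omega$, knowing $g(s,r)$, $g_r(s,r)=\frac{\partial g}{\partial r}(s,r)$ and $g_s(s,r)=\frac{\partial g}{\partial s}(s,r)$ for all $s\in[0,L)$ and a particular $r$ for which $\partial\Omega$ is tangent-cone graph-like is sufficient to completely determine $\Omega$ (its side lengths and angles) up to translation and rotation. That is: if $\Omega_1,\Omega_2$ are polygons with boundary length $L$, both tangent-cone graph-like with the same radius $r>0$, whose functions $g_{\Omega_i}(\cdot,r)$, $\frac{\partial g_{\Omega_i}}{\partial r}(\cdot,r)$ and $\frac{\partial g_{\Omega_i}}{\partial s}(\cdot,r)$ (each where it exists) coincide on $[0,L)$, then $\Omega_2$ is the image of $\Omega_1$ under a composition of a rotation and a translation of $\mathbb R^2$.
   Context: A polygon $\Omega\subset\mathbb R^2$ here is a compact region whose boundary $\partial\Omega$ is a simple closed polygonal curve, of length $L$. $\gamma:[0,L]\to\partial\Omega$ is a continuous arclength parameterization traversing $\partial\Omega$ counterclockwise, with $\gamma(0)=\gamma(L)$. $D(p,r)$ is the closed disk of radius $r$ about $p$. The integral area invariant is $g(s,r)=\operatorname{Area}(\Omega\cap D(\gamma(s),r))$. The tangent cone of $\gamma$ at $s$ is $T_\gamma(s)=\{\alpha\Gamma^-+\beta\Gamma^+:\alpha,\beta\ge0,\alpha+\beta>0\}$, where $\Gamma^-=\lim_{t\uparrow s}\gamma'(t)$ and $\Gamma^+=\lim_{t\downarrow s}\gamma'(t)$ (with $\gamma$ extended periodically). $\partial\Omega$ is tangent-cone graph-like (TCGL)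 with radius $r$ at $p=\gamma(s)$ if for every $w\in T_\gamma(s)$ and every pair of distinct points $u,v\in\partial\Omega\cap D(p,r)$, $\langle w,u-v\rangle\ne0$; it is TCGL with radius $r$ if this holds at every $p\in\partial\Omega$. *)

theory Defs
  imports "HOL-Complex_Analysis.Complex_Analysis"
begin

text \<open>
  The Euclidean plane is the type \<^typ>\<open>complex\<close>: its inner product, norm and Lebesgue measure are
  those of the plane, and rotations about the origin are multiplications by \<^term>\<open>cis \<theta>\<close>.
\<close>

text \<open>
  Unit-speed parameterization of a polygonal curve on \<open>[0, L]\<close>: affine with unit velocity on each
  piece of a finite subdivision. Velocities on neighbouring pieces may agree, so a subdivision
  point (in particular the starting point \<open>0\<close>) need not be a corner.
\<close>

definition polygonal_arclength :: "real \<Rightarrow> (real \<Rightarrow> complex) \<Rightarrow> bool" where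
  "polygonal_arclength L \<gamma> \<longleftrightarrow>
     (\<exists>ts. ts \<noteq> [] \<and> sorted_wrt (<) ts \<and> hd ts = 0 \<and> last ts = L \<and>
        (\<forall>i. Suc i < length ts \<longrightarrow>
           (\<exists>v. norm v = 1 \<and>
              (\<forall>t\<in>{ts ! i..ts ! Suc i}. \<gamma> t = \<gamma> (ts ! i) + (t - ts ! i) *\<^sub>R v))))"

text \<open>
  A region is the closure of a connected open set; without this, the boundary curve itself would
  be a compact set having that curve as its frontier. Since \<open>\<gamma>\<close> has unit speed and is injective on
  \<open>[0, L)\<close>, the boundary has length \<open>L\<close>. Counterclockwise means winding number \<open>1\<close> about
  every interior point; the library's paths live on \<open>[0, 1]\<close>, hence the rescaling.
\<close>

definition polygon_param :: "complex set \<Rightarrow> real \<Rightarrow> (real \<Rightarrow> complex) \<Rightarrow> bool" where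
  "polygon_param \<Omega> L \<gamma> \<longleftrightarrow>
     compact \<Omega> \<and> connected (interior \<Omega>) \<and> \<Omega> = closure (interior \<Omega>) \<and>
     L > 0 \<and> continuous_on {0..L} \<gamma> \<and> polygonal_arclength L \<gamma> \<and>
     \<gamma> 0 = \<gamma> L \<and> inj_on \<gamma> {0..<L} \<and> frontier \<Omega> = \<gamma> ` {0..L} \<and>
     (\<forall>z\<in>interior \<Omega>. winding_number (\<lambda>t. \<gamma> (L * t)) z = 1)"

definition periodic_ext :: "real \<Rightarrow> (real \<Rightarrow> complex) \<Rightarrow> real \<Rightarrow> complex" where
  "periodic_ext L \<gamma> t = \<gamma> (t - L * of_int \<lfloor>t / L\<rfloor>)"

text \<open>The functions below that take only a curve \<open>\<gamma>\<close> are meant for the periodic extension.\<close>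

definition area_invariant :: "complex set \<Rightarrow> (real \<Rightarrow> complex) \<Rightarrow> real \<Rightarrow> real \<Rightarrow> real" where
  "area_invariant \<Omega> \<gamma> s r = measure lebesgue (\<Omega> \<inter> cball (\<gamma> s) r)"

text \<open>
  For a polygonal curve the derivative is locally constant on a punctured neighbourhood of \<open>s\<close>,
  so both one-sided limits exist; the value of \<^const>\<open>vector_derivative\<close> at a corner
  itself is irrelevant.
\<close>

definition left_tangent :: "(real \<Rightarrow> complex) \<Rightarrow> real \<Rightarrow> complex" where
  "left_tangent \<gamma> s = Lim (at_left s) (\<lambda>t. vector_derivative \<gamma> (at t))"

definition right_tangent :: "(real \<Rightarrow> complex) \<Rightarrow> real \<Rightarrow> complex" where
  "right_tangent \<gamma> s = Lim (at_right s) (\<lambda>t. vector_derivative \<gamma> (at t))"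

definition tangent_cone :: "(real \<Rightarrow> complex) \<Rightarrow> real \<Rightarrow> complex set" where
  "tangent_cone \<gamma> s =
     {\<alpha> *\<^sub>R left_tangent \<gamma> s + \<beta> *\<^sub>R right_tangent \<gamma> s |\<alpha> \<beta>. \<alpha> \<ge> 0 \<and> \<beta> \<ge> 0 \<and> \<alpha> + \<beta> > 0}"

definition tcgl_at :: "complex set \<Rightarrow> (real \<Rightarrow> complex) \<Rightarrow> real \<Rightarrow> real \<Rightarrow> bool" where
  "tcgl_at \<Omega> \<gamma> r s \<longleftrightarrow>
     (\<forall>w\<in>tangent_cone \<gamma> s.
        \<forall>u\<in>frontier \<Omega> \<inter> cball (\<gamma> s) r. \<forall>v\<in>frontier \<Omega> \<inter> cball (\<gamma> s) r.
          u \<noteq> v \<longrightarrow> w \<bullet> (u - v) \<noteq> 0)"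

text \<open>Every boundary point of a polygon is \<open>\<gamma> s\<close> for exactly one \<open>s \<in> [0, L)\<close>.\<close>

definition tcgl :: "complex set \<Rightarrow> real \<Rightarrow> (real \<Rightarrow> complex) \<Rightarrow> real \<Rightarrow> bool" where
  "tcgl \<Omega> L \<gamma> r \<longleftrightarrow> (\<forall>s\<in>{0..<L}. tcgl_at \<Omega> (periodic_ext L \<gamma>) r s)"

text \<open>Two partially defined derivatives coincide at \<open>x\<close>, where they exist.\<close>

definition derivs_agree_at :: "(real \<Rightarrow> real) \<Rightarrow> (real \<Rightarrow> real) \<Rightarrow> real \<Rightarrow> bool" where
  "derivs_agree_at f h x \<longleftrightarrow>
     (f differentiable at x \<and> h differentiable at x \<longrightarrow> deriv f x = deriv h x)"

end

theory Submission
  imports Defs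
begin

text \<open>
  By the tangent-cone condition, \<open>s \<mapsto> \<bar>\<gamma> s - \<gamma> t\<bar>\<close> has no local minimum with value in \<open>(0, r]\<close>. It follows
  that the boundary inside the disk about \<open>\<gamma> s\<close> is a single arc, which meets the bounding circle in one
  entry and one exit point. At a parameter \<open>s\<close> that is not a corner, place \<open>\<gamma> s\<close> at the origin with tangent
  direction \<open>1\<close>, and let \<open>a\<close> and \<open>b\<close> be the heights of the entry and exit points. The part of the circle
  inside \<open>\<Omega>\<close> consists of the points above \<open>a\<close> on its left half and above \<open>b\<close> on its right half. Moving the
  disk shows \<open>g\<^sub>s = a - b\<close>, and \<open>g\<^sub>r\<close> is strictly decreasing in both \<open>a\<close> and \<open>b\<close>, so the two
  derivatives determine \<open>a\<close> and \<open>b\<close>: the direction from \<open>\<gamma> s\<close> to the exit point, relative to the tangent,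
  is the same for both polygons. The vector from \<open>\<gamma> s\<close> to the exit point depends continuously on \<open>s\<close>, also
  at corners. Hence the ratio of the unit tangents of the two curves is continuous; being locally
  constant away from the corners, it is constant.
\<close>

subsection \<open>Lebesgue measure of plane sets\<close>

text \<open>Local minima are excluded for this reason: if \<open>\<Gamma> y\<close> is within
  distance \<open>r\<close> of \<open>\<Gamma> t\<close>, both one-sided tangents at
  \<open>y\<close> have nonzero inner products of the same sign with
  \<open>\<Gamma> t - \<Gamma> y\<close>, so a small step forward or backward along an edge comes
  closer to \<open>\<Gamma> t\<close>. The two derivatives complement each other. Fixing a - b
  leaves the freedom to shift both heights together, and along that shift the radial derivative is
  strictly monotone. It equals the length of the circle inside \<Omega>, written as 2 r times the
  area of a cone in the unit disk; monotonicity then comes from inclusions of sets and not from a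
  formula with arcsines. That the part above the heights is the inside uses the counterclockwise
  orientation: the winding number is 1 inside and 0 outside, and crossing a straight edge reveals
  which side is which. The obstacle is that both derivatives are computed only at straight points.
  The edges meeting at a corner are linked because the vector to the exit point is continuous and
  nonzero there.\<close>

lemma complex_lborel_eq_distr_prod:
  "(lborel :: complex measure) = distr (lborel \<Otimes>\<^sub>M lborel) borel (\<lambda>(y, x). Complex x y)"
proof (rule lborel_eqI)
  have meas: "(\<lambda>(y, x). Complex x y) \<in> borel_measurable (lborel \<Otimes>\<^sub>M lborel)"
    unfolding lborel_prod by (auto simp: split_def Complex_eq intro!: borel_measurable_continuous_onI continuous_intros)
  fix l u :: complex
  assume le: "\<And>b. b \<in> Basis \<Longrightarrow> l \<bullet> b \<le> u \<bullet> b"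
  have "emeasure (distr (lborel \<Otimes>\<^sub>M lborel) borel (\<lambda>(y, x). Complex x y)) (box l u)
     = emeasure (lborel \<Otimes>\<^sub>M lborel) ({Im l<..<Im u} \<times> {Re l<..<Re u})"
    by (subst emeasure_distr[OF meas])
       (auto intro!: arg_cong2[where f=emeasure] simp: box_def Basis_complex_def space_pair_measure inner_complex_def)
  also have "\<dots> = ennreal ((Im u - Im l) * (Re u - Re l))"
    using le[of 1] le[of \<i>]
    by (simp add: lborel.emeasure_pair_measure_Times Basis_complex_def ennreal_mult inner_complex_def)
  also have "(Im u - Im l) * (Re u - Re l) = (\<Prod>b\<in>Basis. (u - l) \<bullet> b)"
    by (simp add: Basis_complex_def)
  finally show "emeasure (distr (lborel \<Otimes>\<^sub>M lborel) borel (\<lambda>(y, x). Complex x y)) (box l u)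
      = ennreal (\<Prod>b\<in>Basis. (u - l) \<bullet> b)" .
qed simp

text \<open>Horizontal slices suit a disk that moves in direction 1: each slice then only sees an
  interval of fixed length being shifted. This is why the pairs above are ordered
  \<open>(y, x)\<close>.\<close>

lemma measure_complex_slices:
  assumes S: "S \<in> sets borel" and fin: "emeasure lborel S < \<infinity>"
  shows "integrable lborel (\<lambda>y. measure lborel {x. Complex x y \<in> S})"
    and "measure lebesgue S = (\<integral>y. measure lborel {x. Complex x y \<in> S} \<partial>lborel)"
proof -
  define f where "f = (\<lambda>(y, x). Complex x y)"
  have f: "f \<in> borel_measurable (lborel \<Otimes>\<^sub>M lborel)"
    unfolding lborel_prod f_def by (auto simp: split_def Complex_eq intro!: borel_measurable_continuous_onI continuous_intros)
  define T where "T = f -` S"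
  have T: "T \<in> sets (lborel \<Otimes>\<^sub>M lborel)"
    using measurable_sets[OF f S] by (simp add: T_def space_pair_measure)
  have eqT: "emeasure lborel S = emeasure (lborel \<Otimes>\<^sub>M lborel) T"
    unfolding complex_lborel_eq_distr_prod f_def[symmetric] T_def
    using S f by (subst emeasure_distr) (auto simp: space_pair_measure)
  have int: "integrable (lborel \<Otimes>\<^sub>M lborel) (indicat_real T)"
    using T fin by (simp add: eqT)
  have slice: "(\<integral>x. indicat_real T (y, x) \<partial>lborel) = measure lborel {x. Complex x y \<in> S}" for y
  proof -
    have "(\<lambda>x. indicat_real T (y, x)) = indicat_real {x. Complex x y \<in> S}"
      by (auto simp: T_def f_def indicator_def)
    then show ?thesis by simp
  qed
  show "integrable lborel (\<lambda>y. measure lborel {x. Complex x y \<in> S})"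
    using lborel_pair.integrable_fst'[OF int] by (simp add: slice)
  have "measure lebesgue S = measure (lborel \<Otimes>\<^sub>M lborel) T"
    using S eqT by (simp add: measure_def)
  also have "\<dots> = (\<integral>y. measure lborel {x. Complex x y \<in> S} \<partial>lborel)"
    using lborel_pair.integral_fst'[OF int] T by (simp add: slice)
  finally show "measure lebesgue S = (\<integral>y. measure lborel {x. Complex x y \<in> S} \<partial>lborel)" .
qed

section \<open>Rotation invariance of area, by way of \<open>real^2\<close>\<close>

lemma complex_lborel_eq_distr_vec:
  "(lborel :: complex measure) = distr (lborel :: (real^2) measure) borel (\<lambda>x. Complex (x $ 1) (x $ 2))"
proof (rule lborel_eqI)
  have meas: "(\<lambda>x::real^2. Complex (x $ 1) (x $ 2)) \<in> borel_measurable lborel"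
    by (auto simp: Complex_eq intro!: borel_measurable_continuous_onI continuous_intros)
  fix l u :: complex
  assume le: "\<And>b. b \<in> Basis \<Longrightarrow> l \<bullet> b \<le> u \<bullet> b"
  define l' u' :: "real^2" where "l' = vector [Re l, Im l]" and "u' = vector [Re u, Im u]"
  have "emeasure (distr (lborel :: (real^2) measure) borel (\<lambda>x. Complex (x $ 1) (x $ 2))) (box l u)
     = emeasure lborel (box l' u')"
    by (subst emeasure_distr[OF meas])
       (auto intro!: arg_cong2[where f=emeasure] simp: mem_box Basis_complex_def Basis_vec_def
           inner_complex_def cart_eq_inner_axis[symmetric] l'_def u'_def UNIV_2 inner_axis)
  also have "\<dots> = ennreal ((Im u - Im l) * (Re u - Re l))"
  proof -
    have "\<forall>b\<in>Basis. l' \<bullet> b \<le> u' \<bullet> b"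
      using le[of 1] le[of \<i>]
      by (auto simp: Basis_vec_def UNIV_2 inner_axis l'_def u'_def Basis_complex_def inner_complex_def)
    then have "emeasure lborel (box l' u') = (\<Prod>b\<in>Basis. (u' - l') \<bullet> b)"
      by (simp add: emeasure_lborel_box_eq)
    also have "(\<Prod>b\<in>Basis. (u' - l') \<bullet> b) = (Im u - Im l) * (Re u - Re l)"
      by (simp add: Basis_vec_def UNIV_2 axis_eq_axis inner_axis l'_def u'_def)
    finally show ?thesis .
  qed
  also have "(Im u - Im l) * (Re u - Re l) = (\<Prod>b\<in>Basis. (u - l) \<bullet> b)"
    by (simp add: Basis_complex_def)
  finally show "emeasure (distr (lborel :: (real^2) measure) borel (\<lambda>x. Complex (x $ 1) (x $ 2))) (box l u)
      = ennreal (\<Prod>b\<in>Basis. (u - l) \<bullet> b)" .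
qed simp

lemma measure_complex_vec:
  assumes S: "S \<in> sets borel"
  shows "measure lebesgue S = measure lebesgue {x :: real^2. Complex (x $ 1) (x $ 2) \<in> S}"
    and "{x :: real^2. Complex (x $ 1) (x $ 2) \<in> S} \<in> sets borel"
proof -
  have meas: "(\<lambda>x::real^2. Complex (x $ 1) (x $ 2)) \<in> borel_measurable lborel"
    by (auto simp: Complex_eq intro!: borel_measurable_continuous_onI continuous_intros)
  show *: "{x :: real^2. Complex (x $ 1) (x $ 2) \<in> S} \<in> sets borel"
    using measurable_sets[OF meas S] by (simp add: vimage_def)
  show "measure lebesgue S = measure lebesgue {x :: real^2. Complex (x $ 1) (x $ 2) \<in> S}"
    using S * meas by (subst measure_completion, simp, subst complex_lborel_eq_distr_vec,
        subst measure_distr) (auto simp: vimage_def)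
qed

lemma measure_complex_rotate:
  fixes v :: complex
  assumes S: "compact S" and v: "norm v = 1"
  shows "measure lebesgue ((*) v ` S) = measure lebesgue S"
proof -
  define \<phi> :: "real^2 \<Rightarrow> complex" where "\<phi> x = Complex (x $ 1) (x $ 2)" for x
  \<comment> \<open>Multiplication by \<open>v\<close> in coordinates; being orthogonal, it falls
    under \<open>measure_orthogonal_image\<close>.\<close>
  define R :: "real^2 \<Rightarrow> real^2" where
    "R x = vector [Re v * x $ 1 - Im v * x $ 2, Im v * x $ 1 + Re v * x $ 2]" for x
  have v2: "Re v * Re v + Im v * Im v = 1"
    using v by (simp add: cmod_def power2_eq_square)
  have lin: "linear R"
    by (rule linearI) (simp_all add: R_def vec_eq_iff forall_2 algebra_simps)
  have "norm (R x) = norm x" for x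
  proof -
    have "(norm (R x))\<^sup>2 = (Re v * Re v + Im v * Im v) * (norm x)\<^sup>2"
      by (simp add: power2_norm_eq_inner inner_vec_def sum_2 R_def algebra_simps)
    then show ?thesis using v2 by simp
  qed
  then have orth: "orthogonal_transformation R"
    using lin by (simp add: orthogonal_transformation)
  have comm: "\<phi> (R x) = v * \<phi> x" for x
    by (simp add: \<phi>_def R_def complex_eq_iff)
  have inj: "\<phi> x = \<phi> y \<longleftrightarrow> x = y" for x y
    by (auto simp: \<phi>_def vec_eq_iff forall_2)
  have surj: "\<exists>x. \<phi> x = z" for z
    by (rule exI[of _ "vector [Re z, Im z]"]) (simp add: \<phi>_def)
  have img: "{x. \<phi> x \<in> (*) v ` S} = R ` {x. \<phi> x \<in> S}"
  proof (intro equalityI subsetI)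
    fix x assume "x \<in> {x. \<phi> x \<in> (*) v ` S}"
    then obtain z where z: "z \<in> S" "\<phi> x = v * z" by auto
    obtain y where "\<phi> y = z" using surj by auto
    then have "\<phi> x = \<phi> (R y)" using z comm by simp
    then show "x \<in> R ` {x. \<phi> x \<in> S}" using z \<open>\<phi> y = z\<close> inj by auto
  qed (auto simp: comm)
  have comp: "compact ((*) v ` S)"
    using S by (intro compact_continuous_image continuous_intros)
  have eqS: "{x. \<phi> x \<in> S} = (\<lambda>z. vector [Re z, Im z]) ` S"
  proof (intro equalityI subsetI)
    fix x assume x: "x \<in> {x. \<phi> x \<in> S}"
    have "x = vector [Re (\<phi> x), Im (\<phi> x)]" by (simp add: \<phi>_def vec_eq_iff forall_2)
    then show "x \<in> (\<lambda>z. vector [Re z, Im z]) ` S" using x by blast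
  qed (auto simp: \<phi>_def)
  have "compact {x. \<phi> x \<in> S}" unfolding eqS
  proof (rule compact_continuous_image[OF _ S])
    have eq: "(\<lambda>z. vector [Re z, Im z] :: real^2) = (\<lambda>z. (\<chi> i. if i = 1 then Re z else Im z))"
      by (auto simp: vec_eq_iff forall_2)
    have "continuous_on S (\<lambda>x. if i = 1 then Re x else Im x)" for i :: 2
      by (cases "i = 1") (auto intro!: continuous_intros)
    then show "continuous_on S (\<lambda>z. vector [Re z, Im z] :: real^2)"
      unfolding eq by (rule continuous_on_vec_lambda)
  qed
  then have lm: "{x. \<phi> x \<in> S} \<in> lmeasurable" by (rule lmeasurable_compact)
  have "measure lebesgue ((*) v ` S) = measure lebesgue {x. \<phi> x \<in> (*) v ` S}"
    using measure_complex_vec(1)[of "(*) v ` S"] comp by (simp add: \<phi>_def borel_compact)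
  also have "\<dots> = measure lebesgue {x. \<phi> x \<in> S}"
    unfolding img by (rule measure_orthogonal_image[OF orth lm])
  also have "\<dots> = measure lebesgue S"
    using measure_complex_vec(1)[of S] S by (simp add: \<phi>_def borel_compact)
  finally show ?thesis .
qed

subsection \<open>Moving and growing a disk\<close>

text \<open>Shifting the window exposes at most an interval as long as the shift. This gives the
  constant bound 1 on the difference quotients of slices that dominated convergence asks
  for.\<close>

lemma measure_window_lipschitz:
  fixes T :: "real set"
  assumes T: "T \<in> sets borel"
  shows "\<bar>measure lborel (T \<inter> {h - c..h + c}) - measure lborel (T \<inter> {h' - c..h' + c})\<bar> \<le> \<bar>h - h'\<bar>"
proof -
  have *: "measure lborel (T \<inter> {h - c..h + c}) \<le> measure lborel (T \<inter> {h' - c..h' + c}) + \<bar>h - h'\<bar>" for h h'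
  proof -
    \<comment> \<open>Contains whatever the window at \<open>h\<close> covers beyond the window at
      \<open>h'\<close>; its length is exactly the shift.\<close>
    define J where "J = (if h' \<le> h then {h' + c..h + c} else {h - c..h' - c})"
    have J: "J \<in> fmeasurable lborel" and mJ: "measure lborel J = \<bar>h - h'\<bar>"
      by (auto simp: J_def fmeasurable_def)
    have fT: "T \<inter> {a..b} \<in> fmeasurable lborel" for a b
      by (rule fmeasurableI2[of "{a..b}"]) (use T in \<open>auto simp: fmeasurable_def emeasure_lborel_Icc_eq\<close>)
    have "measure lborel (T \<inter> {h - c..h + c}) \<le> measure lborel ((T \<inter> {h' - c..h' + c}) \<union> J)"
      using fT J by (intro measure_mono_fmeasurable fmeasurable.Un) (auto simp: J_def T fmeasurableD)
    also have "\<dots> \<le> measure lborel (T \<inter> {h' - c..h' + c}) + measure lborel J"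
      using fT[THEN fmeasurableD] J[THEN fmeasurableD] by (intro measure_Un_le)
    finally show ?thesis using mJ by simp
  qed
  show ?thesis using *[of h h'] *[of h' h] by (simp add: abs_le_iff abs_minus_commute)
qed

lemma not_frontier_locally_constant:
  fixes S :: "'a::metric_space set"
  assumes "x \<notin> frontier S"
  obtains \<delta> where "\<delta> > 0" "\<And>y. dist y x < \<delta> \<Longrightarrow> y \<in> S \<longleftrightarrow> x \<in> S"
proof -
  have "open (interior S \<union> interior (- S))" and x: "x \<in> interior S \<union> interior (- S)"
    using assms by (auto simp: frontier_def interior_complement)
  then consider "x \<in> interior S" | "x \<in> interior (- S)" by blast
  then show thesis
  proof cases
    case 1
    then obtain e where "e > 0" "ball x e \<subseteq> S" by (auto simp: mem_interior)
    then show thesis using that[of e] centre_in_ball[of x e] by (auto simp: mem_ball dist_commute subset_eq)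
  next
    case 2
    then obtain e where "e > 0" "ball x e \<subseteq> - S" by (auto simp: mem_interior)
    then show thesis using that[of e] centre_in_ball[of x e] by (auto simp: mem_ball dist_commute subset_eq)
  qed
qed

text \<open>Near each end of the window \<open>T\<close> is everything or nothing, so the measure is
  affine in \<open>h\<close>: the right end gains at rate 1 if \<open>c\<close> lies in
  \<open>T\<close>, and the left end loses at rate 1 if \<open>- c\<close> does.\<close>

lemma measure_window_deriv:
  fixes T :: "real set"
  assumes T: "T \<in> sets borel" and c: "c > 0" and fr: "c \<notin> frontier T" "- c \<notin> frontier T"
  shows "((\<lambda>h. measure lborel (T \<inter> {h - c..h + c})) has_real_derivative
            indicat_real T c - indicat_real T (- c)) (at 0)"
proof -
  obtain d1 where d1: "d1 > 0" "\<And>y. dist y c < d1 \<Longrightarrow> y \<in> T \<longleftrightarrow> c \<in> T"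
    using not_frontier_locally_constant[OF fr(1)] by metis
  obtain d2 where d2: "d2 > 0" "\<And>y. dist y (- c) < d2 \<Longrightarrow> y \<in> T \<longleftrightarrow> - c \<in> T"
    using not_frontier_locally_constant[OF fr(2)] by metis
  \<comment> \<open>\<delta> < c keeps the core from \<delta> - c to c - \<delta> nonempty, and for
    |h| < \<delta> the window changes only where \<open>T\<close> is locally constant.\<close>
  define \<delta> where "\<delta> = min (min d1 d2 / 2) (c / 2)"
  have \<delta>: "\<delta> > 0" "\<delta> < d1" "\<delta> < d2" "\<delta> < c" using d1 d2 c by (auto simp: \<delta>_def min_def)
  define K where "K = measure lborel (T \<inter> {\<delta> - c..c - \<delta>})"
  have fT: "T \<inter> X \<in> fmeasurable lborel" if "X \<in> sets borel" "X \<subseteq> {a..b}" for X and a b :: real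
    by (rule fmeasurableI2[of "{a..b}"]) (use T that in \<open>auto simp: fmeasurable_def emeasure_lborel_Icc_eq\<close>)
  have eq: "measure lborel (T \<inter> {h - c..h + c}) =
        K + indicat_real T (- c) * (\<delta> - h) + indicat_real T c * (h + \<delta>)" if h: "\<bar>h\<bar> < \<delta>" for h
  proof -
    have const: "T \<inter> X = (if P then X else {})" if "\<And>y. y \<in> X \<Longrightarrow> y \<in> T \<longleftrightarrow> P" for X P
      using that by auto
    have l: "T \<inter> {h - c..<\<delta> - c} = (if - c \<in> T then {h - c..<\<delta> - c} else {})"
      using \<delta> h by (intro const d2(2)) (auto simp: dist_real_def)
    have rr: "T \<inter> {c - \<delta><..h + c} = (if c \<in> T then {c - \<delta><..h + c} else {})"
      using \<delta> h by (intro const d1(2)) (auto simp: dist_real_def)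
    have "T \<inter> {h - c..h + c} = (T \<inter> {h - c..<\<delta> - c}) \<union> ((T \<inter> {\<delta> - c..c - \<delta>}) \<union> (T \<inter> {c - \<delta><..h + c}))"
      using \<delta> h by auto
    also have "measure lborel \<dots> = measure lborel (T \<inter> {h - c..<\<delta> - c}) + (K + measure lborel (T \<inter> {c - \<delta><..h + c}))"
    proof -
      have add: "measure lborel (A \<union> B) = measure lborel A + measure lborel B"
        if "A \<in> fmeasurable lborel" "B \<in> fmeasurable lborel" "A \<inter> B = {}" for A B :: "real set"
        using that by (intro measure_Union) (auto simp: fmeasurable_def)
      have f: "T \<inter> {h - c..<\<delta> - c} \<in> fmeasurable lborel" "T \<inter> {\<delta> - c..c - \<delta>} \<in> fmeasurable lborel"
        "T \<inter> {c - \<delta><..h + c} \<in> fmeasurable lborel"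
        using \<delta> h by (auto intro!: fT[of _ "-2*c" "2*c"])
      show ?thesis unfolding K_def using \<delta> h f
        by (subst add, simp, simp add: fmeasurable.Un, force, subst add) auto
    qed
    also have "\<dots> = K + indicat_real T (- c) * (\<delta> - h) + indicat_real T c * (h + \<delta>)"
      unfolding l rr using h by (simp add: indicator_def)
    finally show ?thesis .
  qed
  have "((\<lambda>h. K + indicat_real T (- c) * (\<delta> - h) + indicat_real T c * (h + \<delta>)) has_real_derivative
            indicat_real T c - indicat_real T (- c)) (at 0)"
    by (auto intro!: derivative_eq_intros)
  then show ?thesis
    by (rule has_field_derivative_transform_within[OF _ \<open>\<delta> > 0\<close>]) (auto simp: eq)
qed

text \<open>A horizontal chord of the moving disk is a window shifted by \<open>h\<close>, so its
  slice changes by the two indicators at its ends, which lie on the circle. Integrating over the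
  heights gives the right and left half circles inside \<open>S\<close>, projected to the vertical
  axis.\<close>

lemma area_translation_deriv:
  fixes S :: "complex set"
  assumes S: "compact S" and r: "r > 0" and fin: "finite (frontier S \<inter> sphere 0 r)"
  defines "c \<equiv> \<lambda>y. sqrt (r\<^sup>2 - y\<^sup>2)"
  shows "((\<lambda>h. measure lebesgue (S \<inter> cball (of_real h) r)) has_real_derivative
            measure lborel {y\<in>{-r<..<r}. Complex (c y) y \<in> S}
          - measure lborel {y\<in>{-r<..<r}. Complex (- c y) y \<in> S}) (at 0)"
proof -
  define T where "T y = {x. Complex x y \<in> S}" for y
  define \<phi> where "\<phi> h y = measure lborel {x. Complex x y \<in> S \<inter> cball (of_real h) r}" for h y
  define A where "A = {y\<in>{-r<..<r}. Complex (c y) y \<in> S}"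
  define B where "B = {y\<in>{-r<..<r}. Complex (- c y) y \<in> S}"
  have clS: "closed S" using S by (rule compact_imp_closed)
  have Tb: "T y \<in> sets borel" for y
    unfolding T_def vimage_def[symmetric, of "\<lambda>x. Complex x y"]
    by (intro borel_closed closed_vimage clS) (auto simp: Complex_eq intro!: continuous_intros)
  have mem: "Complex x y \<in> cball (of_real h) r \<longleftrightarrow> \<bar>y\<bar> \<le> r \<and> \<bar>x - h\<bar> \<le> c y" for x y h
  proof -
    have "Complex x y \<in> cball (of_real h) r \<longleftrightarrow> (x - h)\<^sup>2 + y\<^sup>2 \<le> r\<^sup>2"
    proof -
      have "Complex x y \<in> cball (of_real h) r \<longleftrightarrow> sqrt ((x - h)\<^sup>2 + y\<^sup>2) \<le> r"
        by (simp add: dist_norm cmod_def power2_commute[of h])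
      then show ?thesis using r real_sqrt_le_iff[of _ "r\<^sup>2"] by simp
    qed
    also have "\<dots> \<longleftrightarrow> \<bar>y\<bar> \<le> r \<and> \<bar>x - h\<bar> \<le> c y"
    proof
      assume a: "(x - h)\<^sup>2 + y\<^sup>2 \<le> r\<^sup>2"
      have "y\<^sup>2 \<le> r\<^sup>2" using a zero_le_power2[of "x - h"] by linarith
      then have "\<bar>y\<bar> \<le> r" using r abs_le_square_iff[of y r] by simp
      moreover have "\<bar>x - h\<bar> \<le> c y" unfolding c_def
        using a by (intro real_le_rsqrt) simp
      ultimately show "\<bar>y\<bar> \<le> r \<and> \<bar>x - h\<bar> \<le> c y" by simp
    next
      assume a: "\<bar>y\<bar> \<le> r \<and> \<bar>x - h\<bar> \<le> c y"
      then have "y\<^sup>2 \<le> r\<^sup>2" using r abs_le_square_iff[of y r] by simp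
      then have "(c y)\<^sup>2 = r\<^sup>2 - y\<^sup>2" by (simp add: c_def)
      moreover have "\<bar>x - h\<bar>\<^sup>2 \<le> (c y)\<^sup>2" using a by (intro power_mono) auto
      ultimately show "(x - h)\<^sup>2 + y\<^sup>2 \<le> r\<^sup>2" by simp
    qed
    finally show ?thesis .
  qed
  have \<phi>_in: "\<phi> h y = measure lborel (T y \<inter> {h - c y..h + c y})" if "\<bar>y\<bar> \<le> r" for h y
    unfolding \<phi>_def using that by (intro arg_cong[where f="measure lborel"]) (auto simp: T_def mem abs_le_iff simp del: mem_cball)
  have \<phi>_out: "\<phi> h y = 0" if "\<not> \<bar>y\<bar> \<le> r" for h y
    unfolding \<phi>_def using that by (simp add: mem del: mem_cball)
  have comp: "compact (S \<inter> cball (of_real h) r)" for h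
    using S by (intro compact_Int) auto
  have bor: "S \<inter> cball (of_real h) r \<in> sets borel" and emf: "emeasure lborel (S \<inter> cball (of_real h) r) < \<infinity>" for h
    by (rule borel_compact[OF comp], rule emeasure_compact_finite[OF comp])
  have area: "measure lebesgue (S \<inter> cball (of_real h) r) = (\<integral>y. \<phi> h y \<partial>lborel)"
    and int: "integrable lborel (\<phi> h)" for h
    unfolding \<phi>_def[abs_def] using measure_complex_slices[OF bor emf, of h] by blast+
  define \<psi> where "\<psi> y = indicat_real A y - indicat_real B y" for y
  \<comment> \<open>Heights of frontier points on the circle, and the two poles, where the chord
    degenerates to a point. They are finitely many, hence negligible.\<close>
  define bad where "bad = Im ` (frontier S \<inter> sphere 0 r) \<union> {r, - r}"
  have finb: "finite bad" using fin by (simp add: bad_def)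
  have deriv: "((\<lambda>h. \<phi> h y) has_real_derivative \<psi> y) (at 0)" if y: "y \<notin> bad" for y
  proof (cases "\<bar>y\<bar> \<le> r")
    case False
    then have "\<psi> y = 0" by (auto simp: \<psi>_def A_def B_def indicator_def)
    then show ?thesis using False by (simp add: \<phi>_out)
  next
    case True
    then have yr: "\<bar>y\<bar> < r" using y by (auto simp: bad_def abs_if split: if_splits)
    then have y2: "y\<^sup>2 < r\<^sup>2" using power_strict_mono[of "\<bar>y\<bar>" r 2] by simp
    have cpos: "c y > 0" using y2 by (simp add: c_def)
    have sph: "Complex (c y) y \<in> sphere 0 r" "Complex (- c y) y \<in> sphere 0 r"
      using y2 r by (auto simp: c_def cmod_def)
    \<comment> \<open>A frontier point of a slice is a frontier point of \<open>S\<close>, so away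
      from \<open>bad\<close> a chord does not end on the frontier of its slice.\<close>
    have notfr: "x \<notin> frontier (T y)" if "Complex x y \<in> sphere 0 r" for x
    proof -
      have "Complex x y \<notin> frontier S"
        using y that by (force simp: bad_def)
      then obtain e where e: "e > 0" "\<And>z. dist z (Complex x y) < e \<Longrightarrow> z \<in> S \<longleftrightarrow> Complex x y \<in> S"
        using not_frontier_locally_constant by metis
      have "x' \<in> T y \<longleftrightarrow> x \<in> T y" if "dist x' x < e" for x'
      proof -
        have "dist (Complex x' y) (Complex x y) = dist x' x"
          by (simp add: dist_norm cmod_def)
        then show ?thesis using e(2)[of "Complex x' y"] that by (simp add: T_def)
      qed
      then have "ball x e \<subseteq> T y \<or> ball x e \<subseteq> - T y"
        by (auto simp: subset_eq dist_commute)
      then have "x \<in> interior (T y) \<or> x \<in> interior (- T y)"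
        using e(1) by (auto simp: mem_interior)
      then show ?thesis by (auto simp: frontier_def interior_complement)
    qed
    have "((\<lambda>h. measure lborel (T y \<inter> {h - c y..h + c y})) has_real_derivative
            indicat_real (T y) (c y) - indicat_real (T y) (- c y)) (at 0)"
      using cpos sph notfr by (intro measure_window_deriv Tb) auto
    also have "indicat_real (T y) (c y) - indicat_real (T y) (- c y) = \<psi> y"
      using yr by (auto simp: \<psi>_def A_def B_def T_def indicator_def)
    finally show ?thesis using True by (simp add: \<phi>_in)
  qed
  have AB: "A \<in> sets borel" "B \<in> sets borel"
  proof -
    have "(\<lambda>y. Complex (c y) y) \<in> borel_measurable borel" "(\<lambda>y. Complex (- c y) y) \<in> borel_measurable borel"
      by (auto simp: c_def Complex_eq intro!: borel_measurable_continuous_onI continuous_intros)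
    from this[THEN measurable_sets, OF borel_closed[OF clS]]
    have "(\<lambda>y. Complex (c y) y) -` S \<in> sets borel" "(\<lambda>y. Complex (- c y) y) -` S \<in> sets borel"
      by simp_all
    moreover have "A = {-r<..<r} \<inter> (\<lambda>y. Complex (c y) y) -` S" "B = {-r<..<r} \<inter> (\<lambda>y. Complex (- c y) y) -` S"
      by (auto simp: A_def B_def)
    ultimately show "A \<in> sets borel" "B \<in> sets borel" by auto
  qed
  have "X \<in> fmeasurable lborel" if "X \<in> sets borel" "X \<subseteq> {-r..r}" for X
    by (rule fmeasurableI2[of "{-r..r}"]) (use that in \<open>auto simp: fmeasurable_def emeasure_lborel_Icc_eq\<close>)
  moreover have "A \<subseteq> {-r..r}" "B \<subseteq> {-r..r}" by (auto simp: A_def B_def)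
  ultimately have ABf: "A \<in> fmeasurable lborel" "B \<in> fmeasurable lborel" using AB by blast+
  have "(\<integral>y. \<psi> y \<partial>lborel) = measure lborel A - measure lborel B"
    unfolding \<psi>_def using ABf by (subst Bochner_Integration.integral_diff) (auto simp: fmeasurable_def)
  moreover have "((\<lambda>h. ((\<integral>y. \<phi> h y \<partial>lborel) - (\<integral>y. \<phi> 0 y \<partial>lborel)) / (h - 0)) \<longlongrightarrow> (\<integral>y. \<psi> y \<partial>lborel)) (at 0)"
    unfolding tendsto_at_iff_sequentially
  proof (intro allI impI)
    fix X :: "nat \<Rightarrow> real" assume X: "\<forall>i. X i \<in> UNIV - {0}" "X \<longlonglongrightarrow> 0"
    have "(\<lambda>n. \<integral>y. (\<phi> (X n) y - \<phi> 0 y) / X n \<partial>lborel) \<longlonglongrightarrow> (\<integral>y. \<psi> y \<partial>lborel)"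
    proof (rule integral_dominated_convergence[where w="indicat_real {-r..r}"])
      show "\<psi> \<in> borel_measurable lborel" unfolding \<psi>_def using AB by auto
      show "(\<lambda>y. (\<phi> (X n) y - \<phi> 0 y) / X n) \<in> borel_measurable lborel" for n
        using int by (intro borel_measurable_divide borel_measurable_diff) auto
      show "integrable lborel (indicat_real {-r..r})" by (simp add: emeasure_lborel_Icc_eq)
      have "AE y in lborel. y \<notin> bad"
        using finb by (intro AE_not_in) (simp add: finite_imp_null_set_lborel)
      then show "AE y in lborel. (\<lambda>n. (\<phi> (X n) y - \<phi> 0 y) / X n) \<longlonglongrightarrow> \<psi> y"
      proof eventually_elim
        case (elim y)
        have "((\<lambda>h. (\<phi> h y - \<phi> 0 y) / (h - 0)) \<longlongrightarrow> \<psi> y) (at 0)"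
          using deriv[OF elim] by (simp only: has_field_derivative_iff)
        then show ?case using X unfolding tendsto_at_iff_sequentially by (auto simp: o_def)
      qed
      show "AE y in lborel. norm ((\<phi> (X n) y - \<phi> 0 y) / X n) \<le> indicat_real {-r..r} y" for n
      proof (rule AE_I2)
        fix y :: real
        show "norm ((\<phi> (X n) y - \<phi> 0 y) / X n) \<le> indicat_real {-r..r} y"
        proof (cases "\<bar>y\<bar> \<le> r")
          case True
          have "\<bar>\<phi> (X n) y - \<phi> 0 y\<bar> \<le> \<bar>X n\<bar>"
            using measure_window_lipschitz[OF Tb[of y], of "X n" "c y" 0] True by (simp add: \<phi>_in)
          then show ?thesis using X True by (auto simp: indicator_def divide_le_eq)
        next
          case False
          then show ?thesis by (simp add: \<phi>_out)
        qed
      qed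
    qed
    then show "((\<lambda>h. ((\<integral>y. \<phi> h y \<partial>lborel) - (\<integral>y. \<phi> 0 y \<partial>lborel)) / (h - 0)) \<circ> X) \<longlonglongrightarrow> (\<integral>y. \<psi> y \<partial>lborel)"
      using int by (simp add: o_def)
  qed
  ultimately show ?thesis
    by (simp add: has_field_derivative_iff area A_def B_def)
qed

section \<open>The radial derivative: cones in place of polar coordinates\<close>

lemma measure_cone_cball:
  fixes X :: "complex set"
  assumes cone: "\<And>t z. t > 0 \<Longrightarrow> z \<in> X \<Longrightarrow> of_real t * z \<in> X" and \<rho>: "\<rho> > 0"
  shows "measure lebesgue (X \<inter> cball 0 \<rho>) = \<rho>\<^sup>2 * measure lebesgue (X \<inter> cball 0 1)"
proof -
  have "X \<inter> cball 0 \<rho> = (\<lambda>z. \<rho> *\<^sub>R z + 0) ` (X \<inter> cball 0 1)"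
  proof (intro equalityI subsetI)
    fix z assume z: "z \<in> X \<inter> cball 0 \<rho>"
    have "z = \<rho> *\<^sub>R (of_real (1 / \<rho>) * z) + 0" using \<rho> by (simp add: scaleR_conv_of_real)
    moreover have "of_real (1 / \<rho>) * z \<in> X \<inter> cball 0 1"
      using z \<rho> cone[of "1 / \<rho>" z] by (simp add: norm_divide)
    ultimately show "z \<in> (\<lambda>z. \<rho> *\<^sub>R z + 0) ` (X \<inter> cball 0 1)" by blast
  qed (use \<rho> cone in \<open>auto simp: scaleR_conv_of_real norm_mult\<close>)
  also have "measure lebesgue \<dots> = \<rho>\<^sup>2 * measure lebesgue (X \<inter> cball 0 1)"
    using measure_lebesgue_affine[of \<rho> "0::complex" "X \<inter> cball 0 1"] by (simp only: DIM_complex) simp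
  finally show ?thesis .
qed

text \<open>For r > 0 this is the cone over the part of \<open>S\<close> on the circle of radius
  \<open>r\<close>. Its area in the unit disk is half the angle subtended by that part, so
  \<open>2 * r\<close> times this area is the length of the circle inside \<open>S\<close>. The apex
  is left out because \<open>sgn 0 = 0\<close> is no direction.\<close>

definition radial_cone :: "complex set \<Rightarrow> real \<Rightarrow> complex set" where
  "radial_cone S r = {z. z \<noteq> 0 \<and> of_real r * sgn z \<in> S}"

lemma sgn_of_real_mult_pos: "t > 0 \<Longrightarrow> sgn (of_real t * z) = sgn (z :: complex)"
  by (simp add: sgn_mult sgn_of_real)

lemma radial_cone_scale: "t > 0 \<Longrightarrow> z \<in> radial_cone S r \<Longrightarrow> of_real t * z \<in> radial_cone S r"
  by (simp add: radial_cone_def sgn_of_real_mult_pos)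

lemma borel_sgn_cone:
  fixes K :: "complex set"
  assumes "closed K"
  shows "{z. z \<noteq> 0 \<and> of_real r * sgn z \<in> K} \<in> sets borel"
proof -
  have "(\<lambda>z::complex. of_real r * sgn z) \<in> borel_measurable borel"
    unfolding sgn_div_norm by measurable
  from measurable_sets[OF this borel_closed[OF assms]]
  have "(\<lambda>z::complex. of_real r * sgn z) -` K \<in> sets borel" by simp
  moreover have "{z. z \<noteq> 0 \<and> of_real r * sgn z \<in> K} = (\<lambda>z::complex. of_real r * sgn z) -` K - {0}"
    by auto
  ultimately show ?thesis by simp
qed

text \<open>Only rays near the finitely many directions of \<open>F\<close> on the circle can meet
  \<open>F\<close> at a radius close to \<open>r\<close>. The cones over ever thinner annuli
  decrease, and by compactness a direction common to all of them leads to a point of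
  \<open>F\<close> on the circle. Finitely many lines are null, so the areas tend to 0.\<close>

lemma thin_frontier_cone:
  fixes F :: "complex set"
  assumes F: "compact F" and r: "r > 0" and fin: "finite (F \<inter> sphere 0 r)" and e: "e > 0"
  obtains \<delta> N where "0 < \<delta>" "\<delta> < r" "N \<in> sets borel"
    "\<And>z \<tau>. z \<noteq> 0 \<Longrightarrow> \<bar>\<tau> - r\<bar> \<le> \<delta> \<Longrightarrow> of_real \<tau> * sgn z \<in> F \<Longrightarrow> z \<in> N"
    "\<And>t z. t > 0 \<Longrightarrow> z \<in> N \<Longrightarrow> of_real t * z \<in> N"
    "measure lebesgue (N \<inter> cball 0 1) < e"
proof -
  \<comment> \<open>The offset 2 makes \<open>\<delta> n < r\<close>, so the annulus avoids the
    origin, where \<open>sgn\<close> is discontinuous.\<close>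
  define \<delta> where "\<delta> n = r / real (n + 2)" for n :: nat
  have \<delta>: "0 < \<delta> n" "\<delta> n < r" for n
    using r mult_pos_pos[OF r, of "real (Suc n)"] by (auto simp: \<delta>_def field_simps)
  have \<delta>0: "\<delta> \<longlonglongrightarrow> 0" unfolding \<delta>_def
    using tendsto_mult_right_zero[OF LIMSEQ_ignore_initial_segment[OF lim_inverse_n', of 2], of r] by simp
  define K where "K n = sgn ` (F \<inter> {z. r - \<delta> n \<le> norm z \<and> norm z \<le> r + \<delta> n})" for n
  have "compact (K n)" for n
  proof -
    have "compact (F \<inter> {z. r - \<delta> n \<le> norm z \<and> norm z \<le> r + \<delta> n})"
      using F by (intro compact_Int_closed closed_Collect_conj closed_Collect_le continuous_intros)
    moreover have "continuous_on (F \<inter> {z. r - \<delta> n \<le> norm z \<and> norm z \<le> r + \<delta> n}) sgn"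
      using \<delta>[of n] by (auto simp: sgn_div_norm intro!: continuous_intros)
    ultimately show ?thesis unfolding K_def by (rule compact_continuous_image[rotated])
  qed
  then have clK: "closed (K n)" for n by (simp add: compact_imp_closed)
  define N where "N n = {z. z \<noteq> 0 \<and> of_real 1 * sgn z \<in> K n}" for n
  have NB: "N n \<in> sets borel" for n unfolding N_def using clK by (rule borel_sgn_cone)
  have N_cone: "of_real t * z \<in> N n" if "t > 0" "z \<in> N n" for t z n
    using that by (auto simp: N_def sgn_of_real_mult_pos)
  have N_in: "z \<in> N n" if "z \<noteq> 0" "\<bar>\<tau> - r\<bar> \<le> \<delta> n" "of_real \<tau> * sgn z \<in> F" for z \<tau> n
  proof -
    have \<tau>: "\<tau> > 0" using that(2) \<delta>[of n] by linarith
    have "sgn (of_real \<tau> * sgn z) \<in> K n"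
      unfolding K_def using that \<tau> by (intro imageI) (auto simp: norm_mult norm_sgn)
    then show ?thesis using that \<tau> by (simp add: N_def sgn_of_real_mult_pos)
  qed
  have N_D: "\<exists>\<tau>. \<bar>\<tau> - r\<bar> \<le> \<delta> n \<and> of_real \<tau> * sgn z \<in> F" if "z \<in> N n" for z n
  proof -
    have "sgn z \<in> K n" using that by (simp add: N_def)
    then obtain q where "sgn z = sgn q" "q \<in> F \<inter> {z. r - \<delta> n \<le> norm z \<and> norm z \<le> r + \<delta> n}"
      unfolding K_def by (rule imageE)
    then have q: "q \<in> F" "r - \<delta> n \<le> norm q" "norm q \<le> r + \<delta> n" "sgn z = sgn q" by auto
    have "of_real (norm q) * sgn q = q" by (cases "q = 0") (simp_all add: sgn_div_norm scaleR_conv_of_real)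
    then show ?thesis using q by (intro exI[of _ "norm q"]) auto
  qed
  have dec: "decseq (\<lambda>n. N n \<inter> cball 0 1)"
  proof (rule decseq_SucI)
    fix n
    have "\<delta> (Suc n) \<le> \<delta> n" using r by (simp add: \<delta>_def field_simps)
    then have "K (Suc n) \<subseteq> K n" unfolding K_def by (intro image_mono) auto
    then show "N (Suc n) \<inter> cball 0 1 \<subseteq> N n \<inter> cball 0 1" by (auto simp: N_def)
  qed
  have fm: "N n \<inter> cball 0 1 \<in> lmeasurable" for n
    by (rule fmeasurableI2[of "cball 0 1"]) (use NB[of n] in auto)
  have sub: "(\<Inter>n. N n \<inter> cball 0 1) \<subseteq> (\<Union>q\<in>F \<inter> sphere 0 r. span {q})"
  proof
    fix z assume z: "z \<in> (\<Inter>n. N n \<inter> cball 0 1)"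
    then have z0: "z \<noteq> 0" by (auto simp: N_def)
    have "\<forall>n. \<exists>\<tau>. \<bar>\<tau> - r\<bar> \<le> \<delta> n \<and> of_real \<tau> * sgn z \<in> F" using z N_D by blast
    then obtain \<tau> where \<tau>: "\<And>n. \<bar>\<tau> n - r\<bar> \<le> \<delta> n" "\<And>n. of_real (\<tau> n) * sgn z \<in> F" by metis
    have "(\<lambda>n. \<tau> n - r) \<longlonglongrightarrow> 0"
      by (rule Lim_null_comparison[OF _ \<delta>0]) (use \<tau>(1) in auto)
    then have "\<tau> \<longlonglongrightarrow> r" by (simp add: LIM_zero_iff)
    then have "(\<lambda>n. of_real (\<tau> n) * sgn z) \<longlonglongrightarrow> of_real r * sgn z" by (intro tendsto_intros)
    then have "of_real r * sgn z \<in> F"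
      using \<tau>(2) compact_imp_closed[OF F] by (metis closed_sequentially)
    moreover have "of_real r * sgn z \<in> sphere 0 r" using z0 r by (simp add: norm_mult norm_sgn)
    moreover have "z \<in> span {of_real r * sgn z}"
    proof -
      have "z = (norm z / r) *\<^sub>R (of_real r * sgn z)"
        using z0 r by (simp add: scaleR_conv_of_real sgn_div_norm)
      then show ?thesis by (metis span_base span_scale singletonI)
    qed
    ultimately show "z \<in> (\<Union>q\<in>F \<inter> sphere 0 r. span {q})" by blast
  qed
  have "negligible (span {q})" for q :: complex
  proof (rule negligible_lowdim)
    have "dim (span {q}) \<le> card {q}" by (simp only: dim_span) (rule dim_le_card', simp)
    then show "dim (span {q}) < DIM(complex)" by simp
  qed
  then have "negligible (\<Union>q\<in>F \<inter> sphere 0 r. span {q})" using fin by auto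
  then have "measure lebesgue (\<Inter>n. N n \<inter> cball 0 1) = 0"
    using sub by (metis negligible_imp_measure0 negligible_subset)
  moreover have "(\<lambda>n. measure lebesgue (N n \<inter> cball 0 1)) \<longlonglongrightarrow> measure lebesgue (\<Inter>n. N n \<inter> cball 0 1)"
    by (rule Lim_measure_decseq[OF _ dec]) (use fm[THEN fmeasurableD] fm[THEN fmeasurableD2] in auto)
  ultimately have "eventually (\<lambda>n. measure lebesgue (N n \<inter> cball 0 1) < e) sequentially"
    using e by (intro order_tendstoD) auto
  then obtain n where "measure lebesgue (N n \<inter> cball 0 1) < e"
    using eventually_happens'[OF sequentially_bot] by blast
  then show thesis using that[of "\<delta> n" "N n"] \<delta>[of n] NB[of n] N_in[of _ _ n] N_cone[of _ _ n] by blast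
qed

text \<open>Between two radii near \<open>r\<close>, the set \<open>S\<close> and its radial cone
  differ only inside a thin cone \<open>N\<close>. Hence the difference \<open>D\<close> of their
  areas has derivative 0 at \<open>r\<close>, and what remains is the derivative of
  \<open>\<rho>\<^sup>2 * \<kappa>\<close>.\<close>

lemma area_radial_deriv:
  fixes S :: "complex set"
  assumes S: "compact S" and r: "r > 0" and fin: "finite (frontier S \<inter> sphere 0 r)"
  shows "((\<lambda>\<rho>. measure lebesgue (S \<inter> cball 0 \<rho>)) has_real_derivative
            2 * r * measure lebesgue (radial_cone S r \<inter> cball 0 1)) (at r)"
proof -
  define C where "C = radial_cone S r"
  define \<kappa> where "\<kappa> = measure lebesgue (C \<inter> cball 0 1)"
  define D where "D \<rho> = measure lebesgue (S \<inter> cball 0 \<rho>) - \<rho>\<^sup>2 * \<kappa>" for \<rho>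
  have Cb: "C \<in> sets borel"
    unfolding C_def radial_cone_def using borel_sgn_cone[OF compact_imp_closed[OF S]] .
  have C_cball: "measure lebesgue (C \<inter> cball 0 \<rho>) = \<rho>\<^sup>2 * \<kappa>" if "\<rho> > 0" for \<rho>
    unfolding \<kappa>_def C_def by (rule measure_cone_cball) (use radial_cone_scale that in auto)
  have fm: "X \<inter> cball 0 \<rho> \<in> lmeasurable" if "X \<in> sets borel" for X :: "complex set" and \<rho>
    by (rule fmeasurableI2[of "cball 0 \<rho>"]) (use that in auto)
  have Sb: "S \<in> sets borel" using S by (rule borel_compact)
  have est: "\<exists>\<delta>>0. \<forall>\<rho>. \<rho> \<noteq> r \<and> \<bar>\<rho> - r\<bar> < \<delta> \<longrightarrow> \<bar>(D \<rho> - D r) / (\<rho> - r)\<bar> < e" if e: "e > 0" for e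
  proof -
    have cf: "compact (frontier S)" using S by (rule compact_frontier)
    \<comment> \<open>Since \<delta> < r, the factor \<open>\<rho> + r\<close> of the difference of
      squares will be at most \<open>3 * r\<close>.\<close>
    have e3: "e / (3 * r) > 0" using e r by simp
    obtain \<delta> N where \<delta>: "0 < \<delta>" "\<delta> < r" and Nb: "N \<in> sets borel"
      and N1: "\<And>z \<tau>. z \<noteq> 0 \<Longrightarrow> \<bar>\<tau> - r\<bar> \<le> \<delta> \<Longrightarrow> of_real \<tau> * sgn z \<in> frontier S \<Longrightarrow> z \<in> N"
      and N2: "\<And>t z. t > 0 \<Longrightarrow> z \<in> N \<Longrightarrow> of_real t * z \<in> N"
      and N3: "measure lebesgue (N \<inter> cball 0 1) < e / (3 * r)"
      by (rule thin_frontier_cone[OF cf r fin e3]) blast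
    define \<nu> where "\<nu> = measure lebesgue (N \<inter> cball 0 1)"
    have N_cball: "measure lebesgue (N \<inter> cball 0 \<rho>) = \<rho>\<^sup>2 * \<nu>" if "\<rho> > 0" for \<rho>
      unfolding \<nu>_def by (rule measure_cone_cball) (use N2 that in auto)
    have SC: "z \<in> S \<longleftrightarrow> z \<in> C" if z: "z \<notin> N" "\<bar>norm z - r\<bar> \<le> \<delta>" for z
    proof -
      have z0: "z \<noteq> 0" using z \<delta> by auto
      \<comment> \<open>The radial segment from \<open>z\<close> to the circle. For \<open>z\<close>
        outside \<open>N\<close> it misses the frontier, so it lies wholly inside or wholly outside
        \<open>S\<close>.\<close>
      define I where "I = (\<lambda>\<tau>. of_real \<tau> * sgn z) ` {min (norm z) r..max (norm z) r}"
      have "connected I" unfolding I_def by (intro connected_continuous_image continuous_intros) auto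
      moreover have "I \<inter> frontier S = {}"
      proof -
        have "\<bar>\<tau> - r\<bar> \<le> \<delta>" if "\<tau> \<in> {min (norm z) r..max (norm z) r}" for \<tau>
          using that z(2) by (auto simp: min_def max_def split: if_splits)
        then show ?thesis using N1[OF z0] z(1) unfolding I_def by blast
      qed
      ultimately have "I \<subseteq> S \<or> I \<inter> S = {}"
        using connected_Int_frontier[of I S] by blast
      moreover have "z \<in> I"
      proof -
        have "of_real (norm z) * sgn z = z" using z0 by (simp add: sgn_div_norm scaleR_conv_of_real)
        then show ?thesis unfolding I_def by (intro image_eqI[of _ _ "norm z"]) auto
      qed
      moreover have "of_real r * sgn z \<in> I" unfolding I_def by (intro image_eqI[of _ _ r]) auto
      ultimately show ?thesis using z0 by (auto simp: C_def radial_cone_def)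
    qed
    have key: "\<bar>D b - D a\<bar> \<le> (b\<^sup>2 - a\<^sup>2) * \<nu>" if ab: "a \<le> b" "\<bar>a - r\<bar> < \<delta>" "\<bar>b - r\<bar> < \<delta>" for a b
    proof -
      define W where "W = cball (0::complex) b - cball 0 a"
      have pos: "a > 0" "b > 0" using ab \<delta> by auto
      have diff: "measure lebesgue (X \<inter> cball 0 b) - measure lebesgue (X \<inter> cball 0 a) = measure lebesgue (X \<inter> W)"
        if X: "X \<in> sets borel" for X
      proof -
        have "X \<inter> W = (X \<inter> cball 0 b) - (X \<inter> cball 0 a)" by (auto simp: W_def)
        moreover have "X \<inter> cball 0 a \<subseteq> X \<inter> cball 0 b" using ab by auto
        ultimately show ?thesis
          using measurable_measure_Diff[OF fm[OF X] fmeasurableD[OF fm[OF X]]] by simp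
      qed
      have fW: "X \<inter> W \<in> lmeasurable" if "X \<in> sets borel" for X
        by (rule fmeasurableI2[of "cball 0 b"]) (use that in \<open>auto simp: W_def\<close>)
      have W: "\<bar>norm z - r\<bar> \<le> \<delta>" if "z \<in> W" for z using that ab by (auto simp: W_def)
      have "measure lebesgue (S \<inter> W) \<le> measure lebesgue ((C \<inter> W) \<union> (N \<inter> W))"
        using SC W fW Sb Cb Nb by (intro measure_mono_fmeasurable fmeasurable.Un) (auto simp: fmeasurableD)
      also have "\<dots> \<le> measure lebesgue (C \<inter> W) + measure lebesgue (N \<inter> W)"
        using fW Cb Nb by (intro measure_Un_le) (auto simp: fmeasurableD)
      finally have 1: "measure lebesgue (S \<inter> W) \<le> measure lebesgue (C \<inter> W) + measure lebesgue (N \<inter> W)" .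
      have "measure lebesgue (C \<inter> W) \<le> measure lebesgue ((S \<inter> W) \<union> (N \<inter> W))"
        using SC W fW Sb Cb Nb by (intro measure_mono_fmeasurable fmeasurable.Un) (auto simp: fmeasurableD)
      also have "\<dots> \<le> measure lebesgue (S \<inter> W) + measure lebesgue (N \<inter> W)"
        using fW Sb Nb by (intro measure_Un_le) (auto simp: fmeasurableD)
      finally have 2: "measure lebesgue (C \<inter> W) \<le> measure lebesgue (S \<inter> W) + measure lebesgue (N \<inter> W)" .
      have "D b - D a = measure lebesgue (S \<inter> W) - measure lebesgue (C \<inter> W)"
        unfolding D_def diff[OF Sb, symmetric] diff[OF Cb, symmetric] using pos by (simp add: C_cball)
      moreover have "measure lebesgue (N \<inter> W) = (b\<^sup>2 - a\<^sup>2) * \<nu>"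
        unfolding diff[OF Nb, symmetric] using pos by (simp add: N_cball algebra_simps)
      ultimately show ?thesis using 1 2 by linarith
    qed
    have "\<bar>(D \<rho> - D r) / (\<rho> - r)\<bar> < e" if \<rho>: "\<rho> \<noteq> r" "\<bar>\<rho> - r\<bar> < \<delta>" for \<rho>
    proof -
      have "\<bar>D \<rho> - D r\<bar> \<le> \<bar>\<rho>\<^sup>2 - r\<^sup>2\<bar> * \<nu>"
      proof (cases "\<rho> \<le> r")
        case True
        then have "\<rho>\<^sup>2 \<le> r\<^sup>2" using \<rho> \<delta> by (intro power_mono) auto
        then show ?thesis using key[of \<rho> r] True \<rho> \<delta> by (simp add: abs_minus_commute)
      next
        case False
        then have "r\<^sup>2 \<le> \<rho>\<^sup>2" using r by (intro power_mono) auto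
        then show ?thesis using key[of r \<rho>] False \<rho> \<delta> by simp
      qed
      also have "\<bar>\<rho>\<^sup>2 - r\<^sup>2\<bar> = \<bar>\<rho> - r\<bar> * (\<rho> + r)"
        using \<rho> \<delta> by (simp add: power2_eq_square square_diff_square_factored abs_mult)
      finally have "\<bar>(D \<rho> - D r) / (\<rho> - r)\<bar> \<le> (\<rho> + r) * \<nu>"
        using \<rho> by (simp add: abs_divide divide_le_eq mult_ac)
      also have "\<dots> \<le> (3 * r) * \<nu>"
        using \<rho> \<delta> by (intro mult_right_mono) (auto simp: \<nu>_def)
      also have "\<dots> < e" using N3 r by (simp add: \<nu>_def field_simps)
      finally show ?thesis .
    qed
    then show ?thesis using \<delta> by blast
  qed
  have "(D has_real_derivative 0) (at r)"
    unfolding has_field_derivative_iff LIM_eq using est by (simp add: real_norm_def)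
  then have "((\<lambda>\<rho>. D \<rho> + \<rho>\<^sup>2 * \<kappa>) has_real_derivative 2 * r * \<kappa>) (at r)"
    by (auto intro!: derivative_eq_intros)
  then show ?thesis by (simp add: D_def \<kappa>_def C_def)
qed

subsection \<open>The boundary arc inside a disk\<close>

text \<open>If \<open>f\<close> failed to drop from \<open>u\<close> to \<open>v\<close>, its
  minimum over \<open>{a..v}\<close> would be attained strictly inside: not at \<open>a\<close> by
  \<open>start\<close>, and if at \<open>v\<close> then at \<open>u\<close> as well. Local minima
  are excluded only at values up to \<open>f a\<close>, because the tangent-cone condition reaches
  only points within distance \<open>r\<close>.\<close>

lemma strictly_decreasing_if_no_local_min:
  fixes f :: "real \<Rightarrow> real"
  assumes cont: "continuous_on {a..b} f"
    and start: "\<And>e. e > 0 \<Longrightarrow> \<exists>x. a < x \<and> x < a + e \<and> f x < f a"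
    and nomin: "\<And>y e. a < y \<Longrightarrow> y < b \<Longrightarrow> f y \<le> f a \<Longrightarrow> e > 0 \<Longrightarrow> \<exists>x. \<bar>x - y\<bar> < e \<and> f x < f y"
    and xy: "a \<le> x" "x < y" "y \<le> b"
  shows "f y < f x"
proof -
  have main: "f v < f u" if uv: "a \<le> u" "u < v" "v \<le> b" and fu: "f u \<le> f a" for u v
  proof (rule ccontr)
    assume "\<not> f v < f u"
    then have le: "f u \<le> f v" by simp
    have "continuous_on {a..v} f" using cont by (rule continuous_on_subset) (use uv in auto)
    then obtain z where z: "z \<in> {a..v}" "\<And>x. x \<in> {a..v} \<Longrightarrow> f z \<le> f x"
      using continuous_attains_inf[of "{a..v}" f] uv by auto
    obtain x0 where x0: "a < x0" "x0 < a + (v - a)" "f x0 < f a" using start[of "v - a"] uv by auto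
    have na: "f z < f a" using z(2)[of x0] x0 by auto
    have "\<exists>z'. a < z' \<and> z' < v \<and> f z' = f z"
    proof (cases "z = v")
      case True
      then have "f u = f z" using le z(2)[of u] uv by auto
      then show ?thesis using na uv by (intro exI[of _ u]) (auto simp: less_le)
    next
      case False
      then show ?thesis using z(1) na by (intro exI[of _ z]) (auto simp: less_le)
    qed
    then obtain z' where z': "a < z'" "z' < v" "f z' = f z" by blast
    obtain x where "\<bar>x - z'\<bar> < min (z' - a) (v - z')" "f x < f z'"
      using nomin[of z' "min (z' - a) (v - z')"] z' na uv by auto
    then show False using z(2)[of x] z' by (auto simp: abs_less_iff)
  qed
  have "f x \<le> f a" using main[of a x] xy by (cases "x = a") auto
  then show ?thesis using main xy by blast
qed

lemma norm_decreases_along: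
  fixes d w :: "'a::real_inner"
  assumes "d \<bullet> w > 0" "norm w = 1" "0 < h" "h < d \<bullet> w"
  shows "norm (d - h *\<^sub>R w) < norm d"
proof -
  have w: "w \<bullet> w = 1" using assms(2) by (simp add: norm_eq_1)
  have "(norm (d - h *\<^sub>R w))\<^sup>2 = (norm d)\<^sup>2 - h * (2 * (d \<bullet> w) - h)"
    by (simp add: power2_norm_eq_inner inner_diff_left inner_diff_right inner_commute w algebra_simps)
  also have "\<dots> < (norm d)\<^sup>2" using assms by simp
  finally show ?thesis by (simp add: power_less_imp_less_base)
qed

text \<open>One-sided straight germs with directions \<open>dl\<close> and \<open>dr\<close> replace
  the finite subdivision, so corners, straight points and the seam at multiples of \<open>L\<close>
  are treated alike. \<open>graph\<close> is the tangent-cone condition for pairs of points one of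
  which is the centre. Everything is symmetric under reversal of time; region and orientation enter
  only later.\<close>

locale tcgl_curve =
  fixes \<Gamma> :: "real \<Rightarrow> complex" and L r :: real and dl dr :: "real \<Rightarrow> complex"
  assumes L: "L > 0" and r: "r > 0"
    and periodic: "\<Gamma> (s + L) = \<Gamma> s"
    and simple: "s < t \<Longrightarrow> t < s + L \<Longrightarrow> \<Gamma> s \<noteq> \<Gamma> t"
    and right: "\<exists>e>0. \<forall>h\<in>{0..e}. \<Gamma> (s + h) = \<Gamma> s + h *\<^sub>R dr s"
    and left: "\<exists>e>0. \<forall>h\<in>{0..e}. \<Gamma> (s - h) = \<Gamma> s - h *\<^sub>R dl s"
    and norm_dl [simp]: "norm (dl s) = 1" and norm_dr [simp]: "norm (dr s) = 1"
    and graph: "\<Gamma> t \<noteq> \<Gamma> s \<Longrightarrow> norm (\<Gamma> t - \<Gamma> s) \<le> r \<Longrightarrow> a \<ge> 0 \<Longrightarrow> b \<ge> 0 \<Longrightarrow> a + b > 0 \<Longrightarrow>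
                (a *\<^sub>R dl s + b *\<^sub>R dr s) \<bullet> (\<Gamma> t - \<Gamma> s) \<noteq> 0"
begin

text \<open>Reversal exchanges and negates the one-sided tangents, so every statement about moving
  forward yields one about moving backward, and exit points become entry points.\<close>

lemma reversed: "tcgl_curve (\<lambda>s. \<Gamma> (- s)) L r (\<lambda>s. - dr (- s)) (\<lambda>s. - dl (- s))"
proof
  fix s t a b :: real
  show "L > 0" "r > 0" by (fact L r)+
  show "\<Gamma> (- (s + L)) = \<Gamma> (- s)" using periodic[of "- s - L"] by simp
  show "\<Gamma> (- s) \<noteq> \<Gamma> (- t)" if "s < t" "t < s + L"
    using simple[of "- t" "- s"] that by auto
  show "\<exists>e>0. \<forall>h\<in>{0..e}. \<Gamma> (- (s + h)) = \<Gamma> (- s) + h *\<^sub>R - dl (- s)"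
    using left[of "- s"] by simp
  show "\<exists>e>0. \<forall>h\<in>{0..e}. \<Gamma> (- (s - h)) = \<Gamma> (- s) - h *\<^sub>R - dr (- s)"
    using right[of "- s"] by (simp add: add.commute)
  show "norm (- dr (- s)) = 1" "norm (- dl (- s)) = 1" by simp_all
  show "(a *\<^sub>R - dr (- s) + b *\<^sub>R - dl (- s)) \<bullet> (\<Gamma> (- t) - \<Gamma> (- s)) \<noteq> 0"
    if "\<Gamma> (- t) \<noteq> \<Gamma> (- s)" "norm (\<Gamma> (- t) - \<Gamma> (- s)) \<le> r" "a \<ge> 0" "b \<ge> 0" "a + b > 0"
    using graph[of "- t" "- s" b a] that by (simp add: inner_add_left algebra_simps)
qed

lemma isCont_curve: "isCont \<Gamma> s"
proof -
  obtain e where e: "e > 0" "\<And>h. h \<in> {0..e} \<Longrightarrow> \<Gamma> (s + h) = \<Gamma> s + h *\<^sub>R dr s" using right by blast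
  obtain e' where e': "e' > 0" "\<And>h. h \<in> {0..e'} \<Longrightarrow> \<Gamma> (s - h) = \<Gamma> s - h *\<^sub>R dl s" using left by blast
  have "dist (\<Gamma> x) (\<Gamma> s) \<le> \<bar>x - s\<bar>" if x: "\<bar>x - s\<bar> < min e e'" for x
  proof (cases "x \<ge> s")
    case True
    then show ?thesis using e(2)[of "x - s"] x by (simp add: dist_norm)
  next
    case False
    then show ?thesis using e'(2)[of "s - x"] x by (simp add: dist_norm)
  qed
  then have "\<forall>\<epsilon>>0. \<exists>d>0. \<forall>x. dist x s < d \<longrightarrow> dist (\<Gamma> x) (\<Gamma> s) < \<epsilon>"
  proof (intro allI impI)
    fix \<epsilon> :: real assume *: "\<And>x. \<bar>x - s\<bar> < min e e' \<Longrightarrow> dist (\<Gamma> x) (\<Gamma> s) \<le> \<bar>x - s\<bar>" and "\<epsilon> > 0"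
    then show "\<exists>d>0. \<forall>x. dist x s < d \<longrightarrow> dist (\<Gamma> x) (\<Gamma> s) < \<epsilon>"
      using e(1) e'(1) by (intro exI[of _ "min \<epsilon> (min e e')"]) (force simp: dist_real_def)
  qed
  then show ?thesis by (simp add: continuous_at_eps_delta)
qed

lemma cont: "continuous_on X \<Gamma>"
  using isCont_curve by (simp add: continuous_at_imp_continuous_on)

lemma periodic_int: "\<Gamma> (s + of_int k * L) = \<Gamma> s"
proof -
  have nat: "\<Gamma> (s + real n * L) = \<Gamma> s" for s n
  proof (induction n)
    case (Suc n)
    then show ?case using periodic[of "s + real n * L"] by (simp add: algebra_simps)
  qed simp
  show ?thesis
  proof (cases "k \<ge> 0")
    case True
    then show ?thesis using nat[of s "nat k"] by simp
  next
    case False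
    then show ?thesis using nat[of "s + of_int k * L" "nat (- k)"] by simp
  qed
qed

lemma range_period: "q \<in> range \<Gamma> \<Longrightarrow> \<exists>t. s \<le> t \<and> t < s + L \<and> q = \<Gamma> t"
proof -
  assume "q \<in> range \<Gamma>"
  then obtain x where x: "q = \<Gamma> x" by auto
  define k where "k = \<lfloor>(x - s) / L\<rfloor>"
  have "of_int k \<le> (x - s) / L" "(x - s) / L < of_int k + 1" unfolding k_def by linarith+
  then have "of_int k * L \<le> x - s" "x - s < (of_int k + 1) * L" using L by (simp_all add: field_simps)
  then show ?thesis using periodic_int[of x "- k"] x
    by (intro exI[of _ "x - of_int k * L"]) (simp add: algebra_simps)
qed

lemma compact_range: "compact (range \<Gamma>)"
proof -
  have "range \<Gamma> = \<Gamma> ` {0..L}" using range_period[of _ 0] by force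
  then show ?thesis using compact_continuous_image[OF cont compact_Icc] by simp
qed

lemma cone_nonzero:
  assumes "\<Gamma> t \<noteq> \<Gamma> s" "norm (\<Gamma> t - \<Gamma> s) \<le> r"
  shows "dr s \<bullet> (\<Gamma> t - \<Gamma> s) \<noteq> 0" "dl s \<bullet> (\<Gamma> t - \<Gamma> s) \<noteq> 0"
  using graph[OF assms, of 0 1] graph[OF assms, of 1 0] by simp_all

text \<open>If the signs were opposite, some vector of the cone would be orthogonal to
  \<open>\<Gamma> t - \<Gamma> s\<close>. Thus being ahead or behind makes sense at corners
  too.\<close>

lemma cone_sign:
  assumes "\<Gamma> t \<noteq> \<Gamma> s" "norm (\<Gamma> t - \<Gamma> s) \<le> r"
  shows "dl s \<bullet> (\<Gamma> t - \<Gamma> s) > 0 \<longleftrightarrow> dr s \<bullet> (\<Gamma> t - \<Gamma> s) > 0"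
proof -
  define x y where "x = dl s \<bullet> (\<Gamma> t - \<Gamma> s)" and "y = dr s \<bullet> (\<Gamma> t - \<Gamma> s)"
  have nz: "a * x + b * y \<noteq> 0" if "a \<ge> 0" "b \<ge> 0" "a + b > 0" for a b
    using graph[OF assms that] by (simp add: x_def y_def inner_add_left)
  have "x \<noteq> 0" "y \<noteq> 0" using nz[of 1 0] nz[of 0 1] by auto
  \<comment> \<open>The weights \<open>- y\<close> and \<open>x\<close> give the orthogonal
    combination \<open>(- y) * x + x * y = 0\<close>.\<close>
  moreover have "\<not> (x > 0 \<and> y < 0)" using nz[of "- y" x] by auto
  moreover have "\<not> (x < 0 \<and> y > 0)" using nz[of y "- x"] by auto
  ultimately show ?thesis unfolding x_def[symmetric] y_def[symmetric] by linarith
qed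

lemma approach_right:
  assumes "dr y \<bullet> (\<Gamma> t - \<Gamma> y) > 0" "e > 0"
  shows "\<exists>x. y < x \<and> x < y + e \<and> norm (\<Gamma> t - \<Gamma> x) < norm (\<Gamma> t - \<Gamma> y)"
proof -
  obtain e' where e': "e' > 0" "\<And>h. h \<in> {0..e'} \<Longrightarrow> \<Gamma> (y + h) = \<Gamma> y + h *\<^sub>R dr y" using right by blast
  define h where "h = min (min e e') (dr y \<bullet> (\<Gamma> t - \<Gamma> y)) / 2"
  have h: "0 < h" "h < e" "h < e'" "h < dr y \<bullet> (\<Gamma> t - \<Gamma> y)" using assms e' by (auto simp: h_def min_def)
  have "norm (\<Gamma> t - \<Gamma> y - h *\<^sub>R dr y) < norm (\<Gamma> t - \<Gamma> y)"
    using assms h by (intro norm_decreases_along) (auto simp: inner_commute)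
  then show ?thesis using h e'(2)[of h] by (intro exI[of _ "y + h"]) (auto simp: diff_diff_eq)
qed

lemma approach_left:
  assumes "dl y \<bullet> (\<Gamma> t - \<Gamma> y) < 0" "e > 0"
  shows "\<exists>x. y - e < x \<and> x < y \<and> norm (\<Gamma> t - \<Gamma> x) < norm (\<Gamma> t - \<Gamma> y)"
proof -
  interpret rev: tcgl_curve "\<lambda>s. \<Gamma> (- s)" L r "\<lambda>s. - dr (- s)" "\<lambda>s. - dl (- s)" by (rule reversed)
  obtain x where "- y < x" "x < - y + e" "norm (\<Gamma> t - \<Gamma> (- x)) < norm (\<Gamma> t - \<Gamma> y)"
    using rev.approach_right[of "- y" "- t" e] assms by auto
  then show ?thesis by (intro exI[of _ "- x"]) auto
qed

text \<open>While the distance to \<open>\<Gamma> t\<close> is at most \<open>r\<close>, one of the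
  two directions along the curve reduces it, by \<open>cone_sign\<close>. So there is no local
  minimum before \<open>t\<close>, and \<open>fwd\<close> makes the descent start at
  \<open>s\<close>.\<close>

lemma forward_decreasing:
  assumes st: "s < t" "t < s + L" and nr: "norm (\<Gamma> t - \<Gamma> s) \<le> r" and fwd: "dr s \<bullet> (\<Gamma> t - \<Gamma> s) > 0"
    and xy: "s \<le> x" "x < y" "y \<le> t"
  shows "norm (\<Gamma> t - \<Gamma> y) < norm (\<Gamma> t - \<Gamma> x)"
proof (rule strictly_decreasing_if_no_local_min[OF _ _ _ xy, of "\<lambda>x. norm (\<Gamma> t - \<Gamma> x)"])
  show "continuous_on {s..t} (\<lambda>x. norm (\<Gamma> t - \<Gamma> x))" by (intro continuous_intros cont)
  show "\<exists>x. s < x \<and> x < s + e \<and> norm (\<Gamma> t - \<Gamma> x) < norm (\<Gamma> t - \<Gamma> s)" if "e > 0" for e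
    using approach_right[OF fwd that] .
  show "\<exists>x. \<bar>x - y\<bar> < e \<and> norm (\<Gamma> t - \<Gamma> x) < norm (\<Gamma> t - \<Gamma> y)"
    if y: "s < y" "y < t" "norm (\<Gamma> t - \<Gamma> y) \<le> norm (\<Gamma> t - \<Gamma> s)" and e: "e > 0" for y e
  proof -
    have ne: "\<Gamma> t \<noteq> \<Gamma> y" using simple[of y t] y st by auto
    have le: "norm (\<Gamma> t - \<Gamma> y) \<le> r" using y nr by linarith
    show ?thesis
    proof (cases "dr y \<bullet> (\<Gamma> t - \<Gamma> y) > 0")
      case True
      from approach_right[OF True e] show ?thesis by (force simp: abs_less_iff)
    next
      case False
      then have "dl y \<bullet> (\<Gamma> t - \<Gamma> y) < 0"
        using cone_sign[OF ne le] cone_nonzero[OF ne le] by linarith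
      from approach_left[OF this e] show ?thesis by (force simp: abs_less_iff)
    qed
  qed
qed

text \<open>By \<open>forward_decreasing\<close> the arc stays within distance \<open>r\<close> of
  \<open>\<Gamma> t\<close>, so \<open>dl t \<bullet> (\<Gamma> t - \<Gamma> x)\<close> cannot
  vanish for \<open>x\<close> before \<open>t\<close>. It is positive just before \<open>t\<close>,
  hence also at \<open>s\<close>.\<close>

lemma forward_at_end:
  assumes st: "s < t" "t < s + L" and nr: "norm (\<Gamma> t - \<Gamma> s) \<le> r" and fwd: "dr s \<bullet> (\<Gamma> t - \<Gamma> s) > 0"
  shows "dl t \<bullet> (\<Gamma> t - \<Gamma> s) > 0"
proof (rule ccontr)
  assume neg: "\<not> dl t \<bullet> (\<Gamma> t - \<Gamma> s) > 0"
  obtain e where e: "e > 0" "\<And>h. h \<in> {0..e} \<Longrightarrow> \<Gamma> (t - h) = \<Gamma> t - h *\<^sub>R dl t" using left by blast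
  define h where "h = min e (t - s)"
  have h: "0 < h" "h \<le> e" "h \<le> t - s" using e st by (auto simp: h_def)
  have "dl t \<bullet> (\<Gamma> t - \<Gamma> (t - h)) = h * (dl t \<bullet> dl t)" using e(2)[of h] h by simp
  then have pos: "dl t \<bullet> (\<Gamma> t - \<Gamma> (t - h)) > 0" using h by (simp add: dot_square_norm)
  have "\<exists>x. s \<le> x \<and> x \<le> t - h \<and> dl t \<bullet> (\<Gamma> t - \<Gamma> x) = 0"
    using neg pos h by (intro IVT') (auto intro!: continuous_intros cont)
  then obtain x where x: "s \<le> x" "x \<le> t - h" "dl t \<bullet> (\<Gamma> t - \<Gamma> x) = 0" by blast
  have "norm (\<Gamma> t - \<Gamma> x) \<le> norm (\<Gamma> t - \<Gamma> s)"
    using forward_decreasing[OF st nr fwd, of s x] x h by (cases "x = s") auto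
  then have "norm (\<Gamma> x - \<Gamma> t) \<le> r" using nr by (simp add: norm_minus_commute)
  moreover have "\<Gamma> x \<noteq> \<Gamma> t" using simple[of x t] x h st by auto
  ultimately have "dl t \<bullet> (\<Gamma> x - \<Gamma> t) \<noteq> 0" by (intro cone_nonzero)
  then show False using x(3) by (simp add: inner_diff_right)
qed

lemma backward_decreasing:
  assumes st: "t < s" "s < t + L" and nr: "norm (\<Gamma> t - \<Gamma> s) \<le> r" and bwd: "dl s \<bullet> (\<Gamma> t - \<Gamma> s) < 0"
    and xy: "t \<le> y" "y < x" "x \<le> s"
  shows "norm (\<Gamma> t - \<Gamma> y) < norm (\<Gamma> t - \<Gamma> x)"
proof -
  interpret rev: tcgl_curve "\<lambda>s. \<Gamma> (- s)" L r "\<lambda>s. - dr (- s)" "\<lambda>s. - dl (- s)" by (rule reversed)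
  show ?thesis using rev.forward_decreasing[of "- s" "- t" "- x" "- y"] assms by simp
qed

text \<open>Seen from the later parameter, \<open>\<Gamma> s\<close> lies behind. Going back along
  the curve therefore strictly reduces the distance to \<open>\<Gamma> s\<close>, and the earlier
  parameter cannot have the same distance \<open>r\<close>.\<close>

lemma exit_unique_param:
  assumes t: "s < t" "t < s + L" "norm (\<Gamma> t - \<Gamma> s) = r" "dr s \<bullet> (\<Gamma> t - \<Gamma> s) > 0"
    and u: "s < u" "u < s + L" "norm (\<Gamma> u - \<Gamma> s) = r" "dr s \<bullet> (\<Gamma> u - \<Gamma> s) > 0"
  shows "t = u"
proof -
  have False if "s < t" "t < u" "u < s + L" "norm (\<Gamma> t - \<Gamma> s) = r"
    "norm (\<Gamma> u - \<Gamma> s) = r" "dr s \<bullet> (\<Gamma> u - \<Gamma> s) > 0" for t u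
  proof -
    have "dl u \<bullet> (\<Gamma> u - \<Gamma> s) > 0" using that by (intro forward_at_end) auto
    then have "dl u \<bullet> (\<Gamma> s - \<Gamma> u) < 0" by (simp add: inner_diff_right)
    then have "norm (\<Gamma> s - \<Gamma> t) < norm (\<Gamma> s - \<Gamma> u)"
      using that by (intro backward_decreasing[of s u]) (auto simp: norm_minus_commute)
    then show False using that by (simp add: norm_minus_commute)
  qed
  from this[of t u] this[of u t] show ?thesis using t u by (cases t u rule: linorder_cases) auto
qed

text \<open>While the curve stays in the disk,
  \<open>dr s \<bullet> (\<Gamma> x - \<Gamma> s)\<close> cannot change sign. It starts positive,
  but on the return along \<open>dl s\<close> the curve is behind \<open>\<Gamma> s\<close>; so it
  must leave the disk, and its first point on the circle still has the positive sign.\<close>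

lemma exit_exists_param:
  obtains t where "s < t" "t < s + L" "norm (\<Gamma> t - \<Gamma> s) = r" "dr s \<bullet> (\<Gamma> t - \<Gamma> s) > 0"
proof -
  obtain e where e: "e > 0" "\<And>h. h \<in> {0..e} \<Longrightarrow> \<Gamma> (s + h) = \<Gamma> s + h *\<^sub>R dr s" using right by blast
  obtain e' where e': "e' > 0" "\<And>h. h \<in> {0..e'} \<Longrightarrow> \<Gamma> (s - h) = \<Gamma> s - h *\<^sub>R dl s" using left by blast
  \<comment> \<open>Small enough for both germs, below \<open>r\<close> so that the start lies
    inside the disk, and at most \<open>L / 4\<close> so that \<open>s + h\<close> precedes
    \<open>s + L - h\<close>.\<close>
  define h where "h = min (min e e') (min r L / 2) / 2"
  have h: "0 < h" "h \<le> e" "h \<le> e'" "h < r" "s + h < s + L - h"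
    using e(1) e'(1) r L by (auto simp: h_def min_def)
  have dd: "dr s \<bullet> dr s = 1" "dl s \<bullet> dl s = 1" by (simp_all add: dot_square_norm)
  have start: "\<Gamma> (s + h) - \<Gamma> s = h *\<^sub>R dr s" using e(2)[of h] h by simp
  have "\<Gamma> (s + L - h) = \<Gamma> (s - h)" using periodic[of "s - h"] by (simp add: algebra_simps)
  then have fin: "\<Gamma> (s + L - h) - \<Gamma> s = - h *\<^sub>R dl s" using e'(2)[of h] h by simp
  have nz: "\<Gamma> x \<noteq> \<Gamma> s" if "s < x" "x < s + L" for x using simple[of s x] that by auto
  have pos: "dr s \<bullet> (\<Gamma> x - \<Gamma> s) > 0"
    if x: "s + h \<le> x" "x < s + L" and le: "\<And>y. s + h \<le> y \<Longrightarrow> y \<le> x \<Longrightarrow> norm (\<Gamma> y - \<Gamma> s) \<le> r" for x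
  proof (rule ccontr)
    assume "\<not> ?thesis"
    then have "\<exists>y. s + h \<le> y \<and> y \<le> x \<and> dr s \<bullet> (\<Gamma> y - \<Gamma> s) = 0"
      using x h start dd by (intro IVT2') (auto intro!: continuous_intros cont)
    then obtain y where "s + h \<le> y" "y \<le> x" "dr s \<bullet> (\<Gamma> y - \<Gamma> s) = 0" by blast
    then show False using cone_nonzero(1)[of y s] nz[of y] le[of y] x h by auto
  qed
  have "\<exists>x. s + h \<le> x \<and> x \<le> s + L - h \<and> norm (\<Gamma> x - \<Gamma> s) > r"
  proof (rule ccontr)
    assume "\<not> ?thesis"
    then have le: "norm (\<Gamma> y - \<Gamma> s) \<le> r" if "s + h \<le> y" "y \<le> s + L - h" for y using that by force
    have "dr s \<bullet> (\<Gamma> (s + L - h) - \<Gamma> s) > 0"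
      using h le by (intro pos) auto
    then have "dl s \<bullet> (\<Gamma> (s + L - h) - \<Gamma> s) > 0"
      using cone_sign[of "s + L - h" s] nz[of "s + L - h"] le[of "s + L - h"] h by auto
    then show False using fin dd h by simp
  qed
  then obtain x1 where x1: "s + h \<le> x1" "x1 \<le> s + L - h" "norm (\<Gamma> x1 - \<Gamma> s) > r" by blast
  \<comment> \<open>Its least element is the first parameter from \<open>s + h\<close> on at which
    the curve reaches the circle.\<close>
  define Z where "Z = {x \<in> {s + h..x1}. norm (\<Gamma> x - \<Gamma> s) = r}"
  have "closed {x. norm (\<Gamma> x - \<Gamma> s) = r}" by (intro closed_Collect_eq continuous_intros cont)
  then have "compact ({s + h..x1} \<inter> {x. norm (\<Gamma> x - \<Gamma> s) = r})" by (rule compact_Int_closed[OF compact_Icc])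
  then have "compact Z" by (simp add: Z_def Int_def)
  moreover have "Z \<noteq> {}"
  proof -
    have "\<exists>x. s + h \<le> x \<and> x \<le> x1 \<and> norm (\<Gamma> x - \<Gamma> s) = r"
      using x1 h start by (intro IVT') (auto intro!: continuous_intros cont)
    then show ?thesis by (auto simp: Z_def)
  qed
  ultimately obtain t where t: "t \<in> Z" "\<And>x. x \<in> Z \<Longrightarrow> t \<le> x"
    using continuous_attains_inf[of Z "\<lambda>x. x"] by auto
  then have t': "s + h \<le> t" "t \<le> x1" "norm (\<Gamma> t - \<Gamma> s) = r" by (auto simp: Z_def)
  have "norm (\<Gamma> y - \<Gamma> s) \<le> r" if y: "s + h \<le> y" "y \<le> t" for y
  proof (rule ccontr)
    assume "\<not> ?thesis"
    then have "\<exists>x. s + h \<le> x \<and> x \<le> y \<and> norm (\<Gamma> x - \<Gamma> s) = r"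
      using y h start by (intro IVT') (auto intro!: continuous_intros cont)
    then obtain x where "s + h \<le> x" "x \<le> y" "norm (\<Gamma> x - \<Gamma> s) = r" by blast
    then have "t \<le> x" using y t' by (intro t) (auto simp: Z_def)
    then show False using \<open>x \<le> y\<close> y \<open>\<not> norm (\<Gamma> y - \<Gamma> s) \<le> r\<close> t' by (metis order.antisym order.trans order_refl)
  qed
  then have "dr s \<bullet> (\<Gamma> t - \<Gamma> s) > 0" using t' x1 h by (intro pos) auto
  then show thesis using that[of t] t' x1 h by auto
qed

text \<open>Restating uniqueness for points instead of parameters allows limits of exit points to be
  taken in the compact set \<open>range \<Gamma>\<close>, without following parameters modulo
  \<open>L\<close>.\<close>

lemma exit_ex1: "\<exists>!q. q \<in> range \<Gamma> \<and> norm (q - \<Gamma> s) = r \<and> dr s \<bullet> (q - \<Gamma> s) > 0"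
proof -
  have par: "\<exists>t. s < t \<and> t < s + L \<and> q = \<Gamma> t" if q: "q \<in> range \<Gamma>" "norm (q - \<Gamma> s) = r" for q
  proof -
    obtain t where t: "s \<le> t" "t < s + L" "q = \<Gamma> t" using range_period[OF q(1)] by blast
    then have "t \<noteq> s" using q(2) r by auto
    then show ?thesis using t by (intro exI[of _ t]) auto
  qed
  obtain t where t: "s < t" "t < s + L" "norm (\<Gamma> t - \<Gamma> s) = r" "dr s \<bullet> (\<Gamma> t - \<Gamma> s) > 0"
    by (rule exit_exists_param)
  show ?thesis
  proof (rule ex1I[of _ "\<Gamma> t"])
    show "\<Gamma> t \<in> range \<Gamma> \<and> norm (\<Gamma> t - \<Gamma> s) = r \<and> dr s \<bullet> (\<Gamma> t - \<Gamma> s) > 0" using t by simp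
    fix q assume q: "q \<in> range \<Gamma> \<and> norm (q - \<Gamma> s) = r \<and> dr s \<bullet> (q - \<Gamma> s) > 0"
    then obtain u where "s < u" "u < s + L" "q = \<Gamma> u" using par by blast
    then show "q = \<Gamma> t" using exit_unique_param[of s u t] q t by auto
  qed
qed

definition exit :: "real \<Rightarrow> complex" where
  "exit s = (THE q. q \<in> range \<Gamma> \<and> norm (q - \<Gamma> s) = r \<and> dr s \<bullet> (q - \<Gamma> s) > 0)"

lemma exit: "exit s \<in> range \<Gamma>" "norm (exit s - \<Gamma> s) = r" "dr s \<bullet> (exit s - \<Gamma> s) > 0"
  using theI'[OF exit_ex1[of s]] by (auto simp: exit_def)

lemma exit_eqI: "q \<in> range \<Gamma> \<Longrightarrow> norm (q - \<Gamma> s) = r \<Longrightarrow> dr s \<bullet> (q - \<Gamma> s) > 0 \<Longrightarrow> q = exit s"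
  using exit_ex1[of s] exit[of s] by blast

text \<open>The entry point is the exit point of the reversed curve, whose forward tangent is
  \<open>- dl s\<close>; \<open>cone_sign\<close> translates the sign condition to
  \<open>dr s\<close>.\<close>

lemma entry_ex1: "\<exists>!q. q \<in> range \<Gamma> \<and> norm (q - \<Gamma> s) = r \<and> dr s \<bullet> (q - \<Gamma> s) < 0"
proof -
  interpret rev: tcgl_curve "\<lambda>s. \<Gamma> (- s)" L r "\<lambda>s. - dr (- s)" "\<lambda>s. - dl (- s)" by (rule reversed)
  have "\<Gamma> t \<in> range (\<lambda>s. \<Gamma> (- s))" for t by (rule image_eqI[of _ _ "- t"]) auto
  then have "range (\<lambda>s. \<Gamma> (- s)) = range \<Gamma>" by auto
  moreover have "- dl s \<bullet> (q - \<Gamma> s) > 0 \<longleftrightarrow> dr s \<bullet> (q - \<Gamma> s) < 0"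
    if q: "q \<in> range \<Gamma>" "norm (q - \<Gamma> s) = r" for q
  proof -
    obtain t where "q = \<Gamma> t" using q by auto
    moreover have "q \<noteq> \<Gamma> s" using q r by auto
    ultimately show ?thesis using cone_sign[of t s] cone_nonzero[of t s] q by auto
  qed
  ultimately show ?thesis using rev.exit_ex1[of "- s"] by (simp cong: conj_cong)
qed

definition entry :: "real \<Rightarrow> complex" where
  "entry s = (THE q. q \<in> range \<Gamma> \<and> norm (q - \<Gamma> s) = r \<and> dr s \<bullet> (q - \<Gamma> s) < 0)"

lemma entry: "entry s \<in> range \<Gamma>" "norm (entry s - \<Gamma> s) = r" "dr s \<bullet> (entry s - \<Gamma> s) < 0"
  using theI'[OF entry_ex1[of s]] by (auto simp: entry_def)

lemma entry_eqI: "q \<in> range \<Gamma> \<Longrightarrow> norm (q - \<Gamma> s) = r \<Longrightarrow> dr s \<bullet> (q - \<Gamma> s) < 0 \<Longrightarrow> q = entry s"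
  using entry_ex1[of s] entry[of s] by blast

lemma circle_points: "q \<in> range \<Gamma> \<Longrightarrow> norm (q - \<Gamma> s) = r \<Longrightarrow> q = exit s \<or> q = entry s"
proof -
  assume q: "q \<in> range \<Gamma>" "norm (q - \<Gamma> s) = r"
  then obtain t where "q = \<Gamma> t" by auto
  moreover have "q \<noteq> \<Gamma> s" using q r by auto
  ultimately have "dr s \<bullet> (q - \<Gamma> s) \<noteq> 0" using cone_nonzero[of t s] q by auto
  then show ?thesis using exit_eqI[OF q] entry_eqI[OF q] by linarith
qed

section \<open>Continuity of the exit point, also at corners\<close>

lemma directions_right: "\<exists>e>0. \<forall>x\<in>{s<..<s + e}. dr x = dr s \<and> dl x = dr s"
proof -
  obtain e where e: "e > 0" "\<And>h. h \<in> {0..e} \<Longrightarrow> \<Gamma> (s + h) = \<Gamma> s + h *\<^sub>R dr s" using right by blast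
  have "dr x = dr s \<and> dl x = dr s" if x: "x \<in> {s<..<s + e}" for x
  proof
    obtain a where a: "a > 0" "\<And>h. h \<in> {0..a} \<Longrightarrow> \<Gamma> (x + h) = \<Gamma> x + h *\<^sub>R dr x" using right by blast
    define h where "h = min a (s + e - x)"
    have h: "0 < h" "h \<le> a" "h \<le> s + e - x" using a x by (auto simp: h_def)
    have "h *\<^sub>R dr x = \<Gamma> (x + h) - \<Gamma> x" using a(2)[of h] h by simp
    also have "\<dots> = h *\<^sub>R dr s" using e(2)[of "x + h - s"] e(2)[of "x - s"] h x by (simp add: scaleR_left_diff_distrib[symmetric])
    finally show "dr x = dr s" using h by simp
    obtain b where b: "b > 0" "\<And>h. h \<in> {0..b} \<Longrightarrow> \<Gamma> (x - h) = \<Gamma> x - h *\<^sub>R dl x" using left by blast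
    define k where "k = min b (x - s)"
    have k: "0 < k" "k \<le> b" "k \<le> x - s" using b x by (auto simp: k_def)
    have "k *\<^sub>R dl x = \<Gamma> x - \<Gamma> (x - k)" using b(2)[of k] k by simp
    also have "\<dots> = k *\<^sub>R dr s" using e(2)[of "x - k - s"] e(2)[of "x - s"] k x by (simp add: scaleR_left_diff_distrib[symmetric])
    finally show "dl x = dr s" using k by simp
  qed
  then show ?thesis using e(1) by blast
qed

lemma directions_left: "\<exists>e>0. \<forall>x\<in>{s - e<..<s}. dr x = dl s \<and> dl x = dl s"
proof -
  interpret rev: tcgl_curve "\<lambda>s. \<Gamma> (- s)" L r "\<lambda>s. - dr (- s)" "\<lambda>s. - dl (- s)" by (rule reversed)
  obtain e where e: "e > 0" "\<And>x. x \<in> {- s<..<- s + e} \<Longrightarrow> dl (- x) = dl s \<and> dr (- x) = dl s"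
    using rev.directions_right[of "- s"] by auto
  have "dr x = dl s \<and> dl x = dl s" if "x \<in> {s - e<..<s}" for x
    using e(2)[of "- x"] that by auto
  then show ?thesis using e(1) by blast
qed

text \<open>By compactness, exit points for parameters tending to \<open>s\<close> accumulate at a
  point \<open>q\<close> of the curve on the circle about \<open>\<Gamma> s\<close>. The sign
  condition survives the limit as a weak inequality, the tangent-cone condition makes it strict, and
  uniqueness gives \<open>q = exit s\<close>.\<close>

lemma isCont_exit: "isCont exit s"
proof (rule ccontr)
  assume "\<not> isCont exit s"
  then obtain e where e: "e > 0" "\<And>d. d > 0 \<Longrightarrow> \<exists>x. dist x s < d \<and> dist (exit x) (exit s) \<ge> e"
    unfolding continuous_at_eps_delta by (meson not_less)
  have "\<forall>n. \<exists>x. dist x s < inverse (real (Suc n)) \<and> dist (exit x) (exit s) \<ge> e"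
    using e(2) by simp
  then obtain X where X: "\<And>n. dist (X n) s < inverse (real (Suc n))" "\<And>n. dist (exit (X n)) (exit s) \<ge> e"
    by metis
  have "(\<lambda>n. dist (X n) s) \<longlonglongrightarrow> 0"
    by (rule tendsto_sandwich[OF _ _ tendsto_const LIMSEQ_inverse_real_of_nat])
       (intro always_eventually allI zero_le_dist less_imp_le X(1))+
  then have Xlim: "X \<longlonglongrightarrow> s" by (rule iffD2[OF tendsto_dist_iff])
  obtain q \<rho> where q: "q \<in> range \<Gamma>" "strict_mono \<rho>" "((\<lambda>n. exit (X n)) \<circ> \<rho>) \<longlonglongrightarrow> q"
    using compact_range exit(1) unfolding compact_def by (metis (no_types, lifting))
  have lim1: "(\<lambda>n. exit (X (\<rho> n))) \<longlonglongrightarrow> q" using q(3) by (simp add: o_def)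
  have X\<rho>: "(\<lambda>n. X (\<rho> n)) \<longlonglongrightarrow> s" using LIMSEQ_subseq_LIMSEQ[OF Xlim q(2)] by (simp add: o_def)
  have lim: "(\<lambda>n. exit (X (\<rho> n)) - \<Gamma> (X (\<rho> n))) \<longlonglongrightarrow> q - \<Gamma> s"
    by (intro tendsto_diff lim1 isCont_tendsto_compose[OF isCont_curve X\<rho>])
  obtain a where a: "a > 0" "\<And>x. x \<in> {s<..<s + a} \<Longrightarrow> dr x = dr s" using directions_right[of s] by blast
  obtain b where b: "b > 0" "\<And>x. x \<in> {s - b<..<s} \<Longrightarrow> dr x = dl s" using directions_left[of s] by blast
  have "norm (q - \<Gamma> s) = r"
    using tendsto_norm[OF lim] by (simp add: exit(2) LIMSEQ_const_iff)
  \<comment> \<open>The sequence may approach \<open>s\<close> from either side, where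
    \<open>dr\<close> equals \<open>dl s\<close> or \<open>dr s\<close>; the maximum covers both
    cases at once.\<close>
  moreover have "max (dl s \<bullet> (q - \<Gamma> s)) (dr s \<bullet> (q - \<Gamma> s)) \<ge> 0"
  proof (rule tendsto_lowerbound)
    show "(\<lambda>n. max (dl s \<bullet> (exit (X (\<rho> n)) - \<Gamma> (X (\<rho> n)))) (dr s \<bullet> (exit (X (\<rho> n)) - \<Gamma> (X (\<rho> n)))))
        \<longlonglongrightarrow> max (dl s \<bullet> (q - \<Gamma> s)) (dr s \<bullet> (q - \<Gamma> s))"
      by (intro tendsto_max tendsto_inner lim tendsto_const)
    have "eventually (\<lambda>n. X (\<rho> n) \<in> {s - b<..<s + a}) sequentially"
      using a b by (intro topological_tendstoD[OF X\<rho>]) auto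
    then show "eventually (\<lambda>n. 0 \<le> max (dl s \<bullet> (exit (X (\<rho> n)) - \<Gamma> (X (\<rho> n)))) (dr s \<bullet> (exit (X (\<rho> n)) - \<Gamma> (X (\<rho> n))))) sequentially"
    proof eventually_elim
      case (elim n)
      have "dr (X (\<rho> n)) = dr s \<or> dr (X (\<rho> n)) = dl s"
        using elim a(2)[of "X (\<rho> n)"] b(2)[of "X (\<rho> n)"] by (cases "X (\<rho> n)" s rule: linorder_cases) auto
      then show ?case using exit(3)[of "X (\<rho> n)"] by (auto simp: le_max_iff_disj)
    qed
  qed simp
  moreover obtain t where "q = \<Gamma> t" using q(1) by blast
  moreover have "q \<noteq> \<Gamma> s" using calculation r by auto
  ultimately have "dr s \<bullet> (q - \<Gamma> s) > 0"
    using cone_sign[of t s] cone_nonzero[of t s] by (auto simp: le_max_iff_disj)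
  then have "q = exit s" using q(1) \<open>norm (q - \<Gamma> s) = r\<close> by (intro exit_eqI)
  then have "(\<lambda>n. dist (exit (X (\<rho> n))) (exit s)) \<longlonglongrightarrow> 0"
    using tendsto_dist[OF lim1 tendsto_const[of "exit s"]] by simp
  then have "e \<le> 0" using X(2) by (intro LIMSEQ_le_const) auto
  then show False using e(1) by simp
qed

end

subsection \<open>Interior, winding number and the bounding circle\<close>

text \<open>The two Jordan components avoid the frontier, so each is contained in
  \<open>interior \<Omega>\<close> or disjoint from it. The outside is unbounded and cannot be
  contained.\<close>

lemma interior_eq_inside:
  fixes \<Omega> :: "complex set"
  assumes c: "simple_path c" "pathfinish c = pathstart c" and fr: "frontier \<Omega> = path_image c"
    and cpt: "compact \<Omega>" and conn: "connected (interior \<Omega>)" and ne: "interior \<Omega> \<noteq> {}"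
  shows "interior \<Omega> = inside (path_image c)"
proof -
  let ?I = "inside (path_image c)" and ?O = "outside (path_image c)"
  have J: "open ?I" "connected ?I" "open ?O" "connected ?O" "\<not> bounded ?O" "?I \<inter> ?O = {}"
    "?I \<union> ?O = - path_image c"
    using Jordan_inside_outside[OF c] by auto
  have disj: "interior \<Omega> \<inter> path_image c = {}"
    unfolding fr[symmetric] by (auto simp: frontier_def)
  then have sub: "interior \<Omega> \<subseteq> ?I \<union> ?O" using J by auto
  have fi: "frontier (interior \<Omega>) \<subseteq> path_image c"
    unfolding fr[symmetric] using frontier_interior_subset by blast
  have absorb: "U \<subseteq> interior \<Omega>" if "connected U" "U \<inter> path_image c = {}" "U \<inter> interior \<Omega> \<noteq> {}" for U
    using connected_Int_frontier[of U "interior \<Omega>"] that fi by blast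
  have "\<not> interior \<Omega> \<inter> ?O \<noteq> {}"
  proof
    assume "interior \<Omega> \<inter> ?O \<noteq> {}"
    then have "?O \<subseteq> interior \<Omega>" using J by (intro absorb) auto
    then have "?O \<subseteq> \<Omega>" using interior_subset by blast
    then show False using J(5) cpt compact_imp_bounded bounded_subset by blast
  qed
  then have "interior \<Omega> \<subseteq> ?I" using sub by blast
  moreover have "?I \<subseteq> interior \<Omega>" using calculation ne J by (intro absorb) auto
  ultimately show ?thesis by blast
qed

text \<open>This finally turns congruence of the boundary curves into congruence of the
  regions.\<close>

lemma boundary_determines_region:
  fixes A B :: "complex set"
  assumes c: "simple_path c" "pathfinish c = pathstart c"
    and A: "compact A" "connected (interior A)" "A = closure (interior A)" "frontier A = path_image c"
    and B: "compact B" "connected (interior B)" "B = closure (interior B)" "frontier B = path_image c"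
  shows "A = B"
proof -
  have ne: "interior X \<noteq> {}" if "compact X" "X = closure (interior X)" "frontier X = path_image c" for X :: "complex set"
    using that path_image_nonempty[of c] by (metis closure_empty frontier_empty)
  have "interior A = interior B"
    using interior_eq_inside[OF c A(4,1,2) ne[OF A(1,3,4)]] interior_eq_inside[OF c B(4,1,2) ne[OF B(1,3,4)]] by simp
  then show ?thesis using A(3) B(3) by metis
qed

lemma winding_number_linepath_side:
  fixes p v :: complex
  assumes v: "norm v = 1" and e: "e > 0" and t: "t > 0"
  shows "Re (winding_number (linepath (p - of_real e * v) (p + of_real e * v)) (p + of_real t * \<i> * v)) > 0"
    and "Re (winding_number (linepath (p - of_real e * v) (p + of_real e * v)) (p - of_real t * \<i> * v)) < 0"
proof -
  have vv: "v * cnj v = 1" using v by (simp add: complex_norm_square[symmetric])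
  define a b where "a = p - of_real e * v" and "b = p + of_real e * v"
  have "(b - a) * cnj (b - (p + of_real t * \<i> * v)) = 2 * e * (e + \<i> * t) * (v * cnj v)"
    by (simp add: a_def b_def algebra_simps)
  then have "0 < Im ((b - a) * cnj (b - (p + of_real t * \<i> * v)))" using e t by (simp add: vv)
  then show "Re (winding_number (linepath (p - of_real e * v) (p + of_real e * v)) (p + of_real t * \<i> * v)) > 0"
    unfolding a_def b_def by (rule winding_number_linepath_pos_lt)
  \<comment> \<open>For the point on the right the segment is reversed, so that the same criterion
    applies; reversing back changes the sign.\<close>
  have "(a - b) * cnj (a - (p - of_real t * \<i> * v)) = 2 * e * (e + \<i> * t) * (v * cnj v)"
    by (simp add: a_def b_def algebra_simps)
  then have im: "0 < Im ((a - b) * cnj (a - (p - of_real t * \<i> * v)))" using e t by (simp add: vv)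
  then have pos: "0 < Re (winding_number (linepath b a) (p - of_real t * \<i> * v))"
    by (rule winding_number_linepath_pos_lt)
  have "p - of_real t * \<i> * v \<notin> path_image (linepath a b)"
  proof
    assume "p - of_real t * \<i> * v \<in> path_image (linepath a b)"
    then obtain u where u: "p - of_real t * \<i> * v = (1 - u) *\<^sub>R a + u *\<^sub>R b"
      by (auto simp: closed_segment_def)
    have "(1 - u) *\<^sub>R a + u *\<^sub>R b = p + of_real ((2 * u - 1) * e) * v"
      by (simp add: a_def b_def scaleR_conv_of_real algebra_simps)
    then have "p - of_real t * \<i> * v = p + of_real ((2 * u - 1) * e) * v" using u by (rule trans[rotated])
    moreover have "(of_real ((2 * u - 1) * e) + of_real t * \<i>) * v =
        (p + of_real ((2 * u - 1) * e) * v) - (p - of_real t * \<i> * v)"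
      by (simp add: algebra_simps)
    ultimately have "(of_real ((2 * u - 1) * e) + of_real t * \<i>) * v = 0" by (simp only: diff_self)
    moreover have "v \<noteq> 0" using v by auto
    ultimately have "of_real ((2 * u - 1) * e) + of_real t * \<i> = (0::complex)" by simp
    then have "Im (of_real ((2 * u - 1) * e) + of_real t * \<i>) = 0" by simp
    then show False using t by simp
  qed
  then have "winding_number (linepath b a) (p - of_real t * \<i> * v) = - winding_number (linepath a b) (p - of_real t * \<i> * v)"
    using winding_number_reversepath[of "linepath a b" "p - of_real t * \<i> * v"] by simp
  then show "Re (winding_number (linepath (p - of_real e * v) (p + of_real e * v)) (p - of_real t * \<i> * v)) < 0"
    using pos unfolding a_def b_def by simp
qed

text \<open>
  The straight piece contributes a positive amount to the difference of the two winding numbers, and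
  the rest of the curve contributes a function that is continuous at \<open>p\<close>.
\<close>

lemma winding_number_jump:
  fixes c :: "real \<Rightarrow> complex" and p v :: complex
  assumes c: "path c" and ab: "0 < a" "a < b" "b < 1"
    and seg: "\<And>t. t \<in> {0..1} \<Longrightarrow> c (a + (b - a) * t) = linepath (p - of_real e * v) (p + of_real e * v) t"
    and away: "\<And>x. x \<in> {0..1} \<Longrightarrow> x \<notin> {a<..<b} \<Longrightarrow> c x \<noteq> p"
    and v: "norm v = 1" and e: "e > 0"
  shows "\<exists>d>0. \<forall>t. 0 < t \<and> t < d \<and> p + of_real t * \<i> * v \<notin> path_image c \<and> p - of_real t * \<i> * v \<notin> path_image c \<longrightarrow>
     Re (winding_number c (p + of_real t * \<i> * v)) > Re (winding_number c (p - of_real t * \<i> * v)) - 1"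
proof -
  have pa: "path (subpath 0 a c)" "path (subpath b 1 c)"
    using c ab by (auto intro!: path_subpath)
  have nin: "p \<notin> path_image (subpath 0 a c)" "p \<notin> path_image (subpath b 1 c)"
  proof -
    have "c x \<noteq> p" if "x \<in> {0..a} \<union> {b..1}" for x
      using that ab by (intro away) auto
    then have "p \<notin> c ` {0..a}" "p \<notin> c ` {b..1}" by blast+
    then show "p \<notin> path_image (subpath 0 a c)" "p \<notin> path_image (subpath b 1 c)"
      using ab by (simp_all add: path_image_subpath)
  qed
  \<comment> \<open>Two remaining arcs, each evaluated at two points: four errors below 1/4 add up
    to less than the 1 in the claim.\<close>
  have close: "\<exists>d>0. \<forall>z. dist z p < d \<longrightarrow> \<bar>Re (winding_number g z) - Re (winding_number g p)\<bar> < 1/4"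
    if g: "path g" "p \<notin> path_image g" for g
  proof -
    have "\<exists>d>0. \<forall>z. dist z p < d \<longrightarrow> dist (winding_number g z) (winding_number g p) < 1/4"
      using continuous_at_winding_number[OF g] unfolding continuous_at_eps_delta
      by (rule allE[of _ "1/4"]) simp
    then obtain d where "d > 0" "\<And>z. dist z p < d \<Longrightarrow> dist (winding_number g z) (winding_number g p) < 1/4"
      by blast
    moreover have "\<bar>Re (winding_number g z) - Re (winding_number g p)\<bar> \<le> dist (winding_number g z) (winding_number g p)" for z
      using abs_Re_le_cmod[of "winding_number g z - winding_number g p"] by (simp add: dist_norm)
    ultimately show ?thesis by (meson le_less_trans)
  qed
  obtain d1 where d1: "d1 > 0" "\<And>z. dist z p < d1 \<Longrightarrow> \<bar>Re (winding_number (subpath 0 a c) z) - Re (winding_number (subpath 0 a c) p)\<bar> < 1/4"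
    using close[OF pa(1) nin(1)] by blast
  obtain d2 where d2: "d2 > 0" "\<And>z. dist z p < d2 \<Longrightarrow> \<bar>Re (winding_number (subpath b 1 c) z) - Re (winding_number (subpath b 1 c) p)\<bar> < 1/4"
    using close[OF pa(2) nin(2)] by blast
  let ?l = "linepath (p - of_real e * v) (p + of_real e * v)"
  have split: "winding_number c z = winding_number (subpath 0 a c) z + winding_number ?l z + winding_number (subpath b 1 c) z"
    if z: "z \<notin> path_image c" for z
  proof -
    have "winding_number (subpath a b c) z = winding_number ?l z"
      using seg by (intro winding_number_cong) (simp add: subpath_def add.commute mult.commute)
    moreover have "winding_number (subpath 0 a c) z + winding_number (subpath a b c) z = winding_number (subpath 0 b c) z"
      using c z ab by (intro winding_number_subpath_combine) auto
    moreover have "winding_number (subpath 0 b c) z + winding_number (subpath b 1 c) z = winding_number (subpath 0 1 c) z"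
      using c z ab by (intro winding_number_subpath_combine) auto
    ultimately show ?thesis by simp
  qed
  show ?thesis
  proof (intro exI[of _ "min d1 d2"] conjI allI impI)
    show "min d1 d2 > 0" using d1 d2 by simp
    fix t assume t: "0 < t \<and> t < min d1 d2 \<and> p + of_real t * \<i> * v \<notin> path_image c \<and> p - of_real t * \<i> * v \<notin> path_image c"
    have dist: "dist (p + of_real t * \<i> * v) p = t" "dist (p - of_real t * \<i> * v) p = t"
      using t v by (auto simp: dist_norm norm_mult)
    show "Re (winding_number c (p + of_real t * \<i> * v)) > Re (winding_number c (p - of_real t * \<i> * v)) - 1"
    proof -
      let ?P = "p + of_real t * \<i> * v" and ?M = "p - of_real t * \<i> * v"
      let ?w1 = "\<lambda>z. Re (winding_number (subpath 0 a c) z)" and ?w2 = "\<lambda>z. Re (winding_number (subpath b 1 c) z)"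
      have "Re (winding_number c ?P) = ?w1 ?P + Re (winding_number ?l ?P) + ?w2 ?P"
        "Re (winding_number c ?M) = ?w1 ?M + Re (winding_number ?l ?M) + ?w2 ?M"
        using split t by simp_all
      moreover have "Re (winding_number ?l ?P) > 0" "Re (winding_number ?l ?M) < 0"
        using winding_number_linepath_side[OF v e] t by blast+
      moreover have "\<bar>?w1 ?P - ?w1 p\<bar> < 1/4" "\<bar>?w1 ?M - ?w1 p\<bar> < 1/4"
        using t by (intro d1(2); simp only: dist; simp)+
      moreover have "\<bar>?w2 ?P - ?w2 p\<bar> < 1/4" "\<bar>?w2 ?M - ?w2 p\<bar> < 1/4"
        using t by (intro d2(2); simp only: dist; simp)+
      ultimately show ?thesis unfolding abs_less_iff by linarith
    qed
  qed
qed

text \<open>The half circle is parameterized by height, \<sigma> = 1 being the right half and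
  \<sigma> = -1 the left. Membership can change only at \<open>Q\<close>, the one frontier point on
  it; the poles decide which part is inside, and \<open>Q\<close> belongs because \<open>W\<close>
  is closed.\<close>

lemma half_circle_membership:
  fixes W :: "complex set" and \<sigma> :: real
  assumes W: "closed W" and r: "r > 0" and \<sigma>: "\<bar>\<sigma>\<bar> = 1"
    and Q: "Q \<in> frontier W" "norm Q = r" "\<sigma> * Re Q > 0"
    and only: "\<And>q. q \<in> frontier W \<Longrightarrow> norm q = r \<Longrightarrow> \<sigma> * Re q \<ge> 0 \<Longrightarrow> q = Q"
    and top: "Complex 0 r \<in> W" and bot: "Complex 0 (- r) \<notin> W"
    and y: "y \<in> {-r..r}"
  shows "Complex (\<sigma> * sqrt (r\<^sup>2 - y\<^sup>2)) y \<in> W \<longleftrightarrow> Im Q \<le> y"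
proof -
  define k where "k y = Complex (\<sigma> * sqrt (r\<^sup>2 - y\<^sup>2)) y" for y
  have \<sigma>2: "\<sigma> * \<sigma> = 1" using \<sigma> by (auto simp: abs_if split: if_splits)
  have k: "norm (k y) = r" "\<sigma> * Re (k y) \<ge> 0" if "y \<in> {-r..r}" for y
  proof -
    have "y\<^sup>2 \<le> r\<^sup>2" using that r by (intro abs_le_square_iff[THEN iffD1]) auto
    moreover have "\<sigma>\<^sup>2 = 1" using \<sigma>2 by (simp add: power2_eq_square)
    ultimately show "norm (k y) = r" using r by (simp add: k_def cmod_def power_mult_distrib)
    have "\<sigma> * Re (k y) = (\<sigma> * \<sigma>) * sqrt (r\<^sup>2 - y\<^sup>2)" by (simp add: k_def)
    then show "\<sigma> * Re (k y) \<ge> 0" using \<open>y\<^sup>2 \<le> r\<^sup>2\<close> \<sigma>2 by simp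
  qed
  have cont: "continuous_on X k" for X
    unfolding k_def Complex_eq by (intro continuous_intros)
  have ImQ: "\<bar>Im Q\<bar> < r"
  proof -
    have "(Im Q)\<^sup>2 < r\<^sup>2" using Q(2,3) by (auto simp: cmod_def)
    then show ?thesis using r power_less_imp_less_base[of "\<bar>Im Q\<bar>" 2 r] by simp
  qed
  have notfr: "k y \<notin> frontier W" if "y \<in> {-r..r}" "y \<noteq> Im Q" for y
    using only[of "k y"] k[OF that(1)] that(2) by (auto simp: k_def)
  have arc: "k ` I \<subseteq> W \<or> k ` I \<inter> W = {}" if "connected I" "I \<subseteq> {-r..r} - {Im Q}" for I
    using connected_Int_frontier[OF connected_continuous_image[OF cont that(1)], of W] notfr that(2) by blast
  have kr: "k r = Complex 0 r" "k (- r) = Complex 0 (- r)" by (simp_all add: k_def)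
  consider "y < Im Q" | "y = Im Q" | "y > Im Q" by linarith
  then have "k y \<in> W \<longleftrightarrow> Im Q \<le> y"
  proof cases
    case 1
    have "k ` {-r..y} \<subseteq> W \<or> k ` {-r..y} \<inter> W = {}" using 1 y by (intro arc) auto
    moreover have "k (- r) \<notin> W" using bot kr by simp
    ultimately have "k y \<notin> W" using y by fastforce
    then show ?thesis using 1 by simp
  next
    case 2
    have "Q = k y"
    proof (rule complex_eqI)
      have "(\<sigma> * Re Q)\<^sup>2 = r\<^sup>2 - y\<^sup>2"
        using Q(2) \<sigma>2 2 by (auto simp: cmod_def power_mult_distrib power2_eq_square)
      then have "\<sigma> * Re Q = sqrt (r\<^sup>2 - y\<^sup>2)" using Q(3) by (metis less_imp_le real_sqrt_unique)
      then have "\<sigma> * (\<sigma> * Re Q) = \<sigma> * sqrt (r\<^sup>2 - y\<^sup>2)" by simp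
      then show "Re Q = Re (k y)" using \<sigma>2 by (simp add: k_def flip: mult.assoc)
    qed (use 2 in \<open>simp add: k_def\<close>)
    then show ?thesis using Q(1) W frontier_subset_closed 2 by auto
  next
    case 3
    have "k ` {y..r} \<subseteq> W \<or> k ` {y..r} \<inter> W = {}" using 3 y by (intro arc) auto
    moreover have "k r \<in> W" using top kr by simp
    ultimately have "k y \<in> W" using y by fastforce
    then show ?thesis using 3 by simp
  qed
  then show ?thesis by (simp add: k_def)
qed

text \<open>The cone over the points of the circle of radius \<open>r\<close> at height at least
  \<open>b\<close> on the right half and at least \<open>a\<close> on the left half. This is the
  form that \<open>radial_cone\<close> takes for a region whose boundary meets the circle in one
  entry and one exit point.\<close>

definition sector :: "real \<Rightarrow> real \<Rightarrow> real \<Rightarrow> complex set" where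
  "sector r a b = {z. z \<noteq> 0 \<and> (if Re z \<ge> 0 then b else a) \<le> r * Im (sgn z)}"

text \<open>The larger sector contains a nonempty open set that the smaller one misses, and nonempty
  open sets are not negligible.\<close>

lemma sector_measure_strict:
  assumes r: "r > 0" and le: "a \<le> a'" "b \<le> b'" and ne: "a < a' \<or> b < b'"
    and bnd: "- r < a" "a' < r" "- r < b" "b' < r"
    and meas: "sector r a b \<in> sets borel" "sector r a' b' \<in> sets borel"
  shows "measure lebesgue (sector r a' b' \<inter> cball 0 1) < measure lebesgue (sector r a b \<inter> cball 0 1)"
proof -
  let ?X = "sector r a b \<inter> cball 0 1" and ?Y = "sector r a' b' \<inter> cball 0 1"
  have fm: "?X \<in> lmeasurable" "?Y \<in> lmeasurable"
    by (rule fmeasurableI2[of "cball 0 1"]; use meas in auto)+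
  have sub: "?Y \<subseteq> ?X" using le by (auto simp: sector_def split: if_splits)
  have open_part: "\<exists>U. open U \<and> U \<noteq> {} \<and> U \<subseteq> {z. z \<noteq> 0 \<and> norm z \<le> 1 \<and> \<sigma> * Re z > 0 \<and> x \<le> r * Im (sgn z) \<and> r * Im (sgn z) < x'}"
    if x: "x < x'" "- r < x" "x' < r" and \<sigma>: "\<bar>\<sigma>\<bar> = 1" for x x' \<sigma> :: real
  proof -
    \<comment> \<open>The bounds on \<open>r * Im (sgn z)\<close>, made strict and multiplied by
      \<open>norm z\<close>, compare continuous functions, so this set is open.\<close>
    define U where "U = {z :: complex. norm z < 1 \<and> \<sigma> * Re z > 0 \<and> x * norm z < r * Im z \<and> r * Im z < x' * norm z}"
    have "open U" unfolding U_def
      by (intro open_Collect_conj open_Collect_less continuous_intros)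
    moreover have "U \<subseteq> {z. z \<noteq> 0 \<and> norm z \<le> 1 \<and> \<sigma> * Re z > 0 \<and> x \<le> r * Im (sgn z) \<and> r * Im (sgn z) < x'}"
    proof
      fix z assume z: "z \<in> U"
      then have "z \<noteq> 0" by (auto simp: U_def)
      then show "z \<in> {z. z \<noteq> 0 \<and> norm z \<le> 1 \<and> \<sigma> * Re z > 0 \<and> x \<le> r * Im (sgn z) \<and> r * Im (sgn z) < x'}"
        using z by (auto simp: U_def sgn_div_norm field_simps)
    qed
    moreover have "U \<noteq> {}"
    proof -
      \<comment> \<open>\<open>r * t\<close> is halfway between \<open>x\<close> and
        \<open>x'\<close>; the witness \<open>z\<close> below has norm 1/2 and this height after
        projection to the circle.\<close>
      define t where "t = (x + x') / (2 * r)"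
      have t: "x < r * t" "r * t < x'" using x r by (auto simp: t_def field_simps)
      have "t < 1" "- 1 < t" using x r by (auto simp: t_def divide_less_eq less_divide_eq)
      then have "\<bar>t\<bar> < 1" by auto
      then have t2: "t\<^sup>2 < 1" by (simp add: abs_square_less_1)
      define z where "z = Complex (\<sigma> * sqrt (1 - t\<^sup>2) / 2) (t / 2)"
      have \<sigma>2: "\<sigma>\<^sup>2 = 1" using \<sigma> by (metis power2_abs one_power2)
      have "norm z = sqrt ((1/2)\<^sup>2)"
        unfolding z_def cmod_def using t2 \<sigma>2
        by (intro arg_cong[where f=sqrt]) (simp add: power_divide power_mult_distrib field_simps)
      then have nz: "norm z = 1/2" by simp
      have "\<sigma> * Re z = sqrt (1 - t\<^sup>2) / 2" using \<sigma>2 by (simp add: z_def power2_eq_square flip: mult.assoc)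
      moreover have "sqrt (1 - t\<^sup>2) > 0" using t2 by simp
      ultimately have "\<sigma> * Re z > 0" by linarith
      moreover have "r * Im z = r * t / 2" by (simp add: z_def)
      ultimately have "z \<in> U" using t nz unfolding U_def mem_Collect_eq nz by (intro conjI) linarith+
      then show ?thesis by blast
    qed
    ultimately show ?thesis by blast
  qed
  have "\<exists>U. open U \<and> U \<noteq> {} \<and> U \<subseteq> ?X - ?Y"
  proof (cases "b < b'")
    case True
    then obtain U where "open U" "U \<noteq> {}" "U \<subseteq> {z. z \<noteq> 0 \<and> norm z \<le> 1 \<and> 1 * Re z > 0 \<and> b \<le> r * Im (sgn z) \<and> r * Im (sgn z) < b'}"
      using open_part[of b b' 1] bnd by auto
    then show ?thesis by (intro exI[of _ U]) (auto simp: sector_def)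
  next
    case False
    then obtain U where "open U" "U \<noteq> {}" "U \<subseteq> {z. z \<noteq> 0 \<and> norm z \<le> 1 \<and> (- 1) * Re z > 0 \<and> a \<le> r * Im (sgn z) \<and> r * Im (sgn z) < a'}"
      using open_part[of a a' "- 1"] bnd ne by auto
    then show ?thesis by (intro exI[of _ U]) (auto simp: sector_def)
  qed
  then obtain U where U: "open U" "U \<noteq> {}" "U \<subseteq> ?X - ?Y" by blast
  have "\<not> negligible (?X - ?Y)" using U open_not_negligible negligible_subset by blast
  then have "measure lebesgue (?X - ?Y) \<noteq> 0"
    using fm negligible_iff_measure[of "?X - ?Y"] by (auto intro: fmeasurable.Diff)
  moreover have "measure lebesgue (?X - ?Y) = measure lebesgue ?X - measure lebesgue ?Y"
    using fm sub by (intro measurable_measure_Diff) (auto intro: fmeasurableD)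
  ultimately show ?thesis using measure_nonneg[of lebesgue "?X - ?Y"] by linarith
qed

text \<open>With \<open>a - b\<close> fixed the two heights can only rise together or fall together,
  and either changes the area strictly.\<close>

lemma sector_determined:
  assumes r: "r > 0" and diff: "a - b = a' - b'"
    and bnd: "\<bar>a\<bar> < r" "\<bar>b\<bar> < r" "\<bar>a'\<bar> < r" "\<bar>b'\<bar> < r"
    and meas: "sector r a b \<in> sets borel" "sector r a' b' \<in> sets borel"
    and eq: "measure lebesgue (sector r a b \<inter> cball 0 1) = measure lebesgue (sector r a' b' \<inter> cball 0 1)"
  shows "a = a' \<and> b = b'"
proof (rule ccontr)
  assume ne: "\<not> (a = a' \<and> b = b')"
  consider "a < a'" "b < b'" | "a' < a" "b' < b" using ne diff by linarith
  then show False
  proof cases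
    case 1
    then show False using sector_measure_strict[of r a a' b b'] r bnd meas eq by (auto simp: abs_less_iff)
  next
    case 2
    then show False using sector_measure_strict[of r a' a b' b] r bnd meas eq by (auto simp: abs_less_iff)
  qed
qed

section \<open>Local coordinates with origin \<open>p\<close> in which the direction
  \<open>v\<close> becomes 1\<close>

definition placed :: "complex \<Rightarrow> complex \<Rightarrow> complex \<Rightarrow> complex" where
  "placed p v z = p + v * z"

lemma unit_mult_cnj: "norm v = 1 \<Longrightarrow> v * cnj v = 1"
  by (simp add: complex_norm_square[symmetric])

lemma placed_inverse: "norm v = 1 \<Longrightarrow> placed p v (cnj v * (z - p)) = z"
  using unit_mult_cnj[of v] by (simp add: placed_def flip: mult.assoc)

lemma dist_placed: "norm v = 1 \<Longrightarrow> dist (placed p v x) (placed p v y) = dist x y"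
  by (simp add: placed_def dist_norm norm_mult flip: right_diff_distrib)

lemma frontier_vimage_placed:
  assumes v: "norm v = 1"
  shows "z \<in> frontier (placed p v -` \<Omega>) \<longleftrightarrow> placed p v z \<in> frontier \<Omega>"
proof -
  have ex: "(\<exists>x. P x) \<longleftrightarrow> (\<exists>x. P (placed p v x))" for P
    using placed_inverse[OF v, of p] by metis
  have "(\<exists>x\<in>\<Omega>. dist (placed p v z) x < e) \<longleftrightarrow> (\<exists>x\<in>placed p v -` \<Omega>. dist z x < e)" for e
    unfolding Bex_def by (subst ex) (simp add: dist_placed[OF v])
  moreover have "(\<exists>x. x \<notin> \<Omega> \<and> dist (placed p v z) x < e) \<longleftrightarrow> (\<exists>x. x \<notin> placed p v -` \<Omega> \<and> dist z x < e)" for e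
    by (subst ex) (simp add: dist_placed[OF v])
  ultimately show ?thesis unfolding frontier_straddle by simp
qed

lemma compact_vimage_placed:
  assumes v: "norm v = 1" and "compact \<Omega>"
  shows "compact (placed p v -` \<Omega>)"
proof -
  have "placed p v -` \<Omega> = (\<lambda>z. cnj v * (z - p)) ` \<Omega>"
  proof (intro equalityI subsetI)
    fix z assume z: "z \<in> placed p v -` \<Omega>"
    have "z = cnj v * (placed p v z - p)" using unit_mult_cnj[OF v] by (simp add: placed_def mult.commute flip: mult.assoc)
    then show "z \<in> (\<lambda>z. cnj v * (z - p)) ` \<Omega>" using z by blast
  qed (auto simp: placed_inverse[OF v])
  then show ?thesis using assms(2) by (auto intro!: compact_continuous_image continuous_intros)
qed

lemma measure_placed:
  assumes v: "norm v = 1" and \<Omega>: "compact \<Omega>"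
  shows "measure lebesgue (\<Omega> \<inter> cball (placed p v z) \<rho>) = measure lebesgue (placed p v -` \<Omega> \<inter> cball z \<rho>)"
proof -
  have "\<Omega> \<inter> cball (placed p v z) \<rho> = placed p v ` (placed p v -` \<Omega> \<inter> cball z \<rho>)"
  proof (intro equalityI subsetI)
    fix w assume w: "w \<in> \<Omega> \<inter> cball (placed p v z) \<rho>"
    have "w = placed p v (cnj v * (w - p))" using placed_inverse[OF v] by simp
    moreover from this have "cnj v * (w - p) \<in> placed p v -` \<Omega> \<inter> cball z \<rho>"
      using w dist_placed[OF v, of p z "cnj v * (w - p)"] by simp
    ultimately show "w \<in> placed p v ` (placed p v -` \<Omega> \<inter> cball z \<rho>)" by blast
  qed (auto simp: dist_placed[OF v])
  also have "\<dots> = (+) p ` ((*) v ` (placed p v -` \<Omega> \<inter> cball z \<rho>))"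
    by (simp add: image_image placed_def)
  also have "measure lebesgue \<dots> = measure lebesgue (placed p v -` \<Omega> \<inter> cball z \<rho>)"
    using compact_vimage_placed[OF v \<Omega>] v
    by (subst measure_translation, intro measure_complex_rotate) (auto intro: compact_Int)
  finally show ?thesis .
qed

subsection \<open>Derivatives of the area invariant of a polygon\<close>

locale tcgl_polygon = tcgl_curve +
  fixes \<Omega> :: "complex set"
  assumes cpt: "compact \<Omega>" and conn: "connected (interior \<Omega>)" and regular: "\<Omega> = closure (interior \<Omega>)"
    and boundary: "frontier \<Omega> = range \<Gamma>"
    and winding: "z \<in> interior \<Omega> \<Longrightarrow> winding_number (\<lambda>t. \<Gamma> (L * t)) z = 1"
begin

abbreviation loop :: "real \<Rightarrow> complex" where "loop \<equiv> \<lambda>t. \<Gamma> (L * t)"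

lemma loop: "simple_path loop" "pathfinish loop = pathstart loop" "path_image loop = frontier \<Omega>"
proof -
  have "path loop" unfolding path_def
    by (rule continuous_on_compose2[OF cont[of UNIV]]) (auto intro!: continuous_intros)
  moreover have "loop_free loop" unfolding loop_free_def
  proof (intro ballI impI)
    fix x y :: real assume xy: "x \<in> {0..1}" "y \<in> {0..1}" "\<Gamma> (L * x) = \<Gamma> (L * y)"
    have *: "x = 0 \<and> y = 1" if "x < y" "x \<in> {0..1}" "y \<in> {0..1}" "\<Gamma> (L * x) = \<Gamma> (L * y)" for x y :: real
    proof (rule ccontr)
      assume "\<not> (x = 0 \<and> y = 1)"
      then have "y < x + 1" using that by auto
      then have "L * y < L * (x + 1)" using L by (simp only: mult_less_cancel_left_pos)
      then have "L * x < L * y" "L * y < L * x + L" using that L by (auto simp: distrib_left)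
      then show False using simple that(4) by blast
    qed
    show "x = y \<or> x = 0 \<and> y = 1 \<or> x = 1 \<and> y = 0"
      using *[of x y] *[of y x] xy by (cases x y rule: linorder_cases) auto
  qed
  ultimately show "simple_path loop" by (simp add: simple_path_def)
  show "pathfinish loop = pathstart loop"
    using periodic[of 0] by (simp add: pathfinish_def pathstart_def)
  have "range \<Gamma> \<subseteq> path_image loop"
  proof
    fix q assume "q \<in> range \<Gamma>"
    then obtain t where t: "0 \<le> t" "t < 0 + L" "q = \<Gamma> t" using range_period by blast
    then show "q \<in> path_image loop" unfolding path_image_def
      using L by (intro image_eqI[of _ _ "t / L"]) auto
  qed
  then show "path_image loop = frontier \<Omega>" unfolding boundary by (auto simp: path_image_def)
qed

lemma interior_nonempty: "interior \<Omega> \<noteq> {}"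
  using regular boundary by (metis closure_empty frontier_empty image_is_empty UNIV_not_empty)

text \<open>Points off \<Omega> lie in the outside of the loop, since its inside is exactly
  \<open>interior \<Omega>\<close>.\<close>

lemma exterior_winding: "z \<notin> \<Omega> \<Longrightarrow> winding_number loop z = 0"
proof -
  assume z: "z \<notin> \<Omega>"
  have "interior \<Omega> = inside (path_image loop)"
    using loop cpt conn interior_nonempty by (intro interior_eq_inside) auto
  moreover have "z \<notin> path_image loop"
    using z cpt loop(3) frontier_subset_closed compact_imp_closed by blast
  moreover have "z \<notin> interior \<Omega>" using z interior_subset by blast
  ultimately have "z \<in> outside (path_image loop)" using inside_Un_outside[of "path_image loop"] by blast
  then show ?thesis using loop by (intro winding_number_zero_in_outside) (auto simp: simple_path_def)
qed

text \<open>Near a straight point the frontier is just the edge, so each of the two half disks is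
  entirely inside or entirely outside. As the point is on the frontier and \<Omega> is the closure
  of its interior, exactly one is inside, and the winding number tells which. The bounds on
  \<open>s\<close> keep the edge within one pass of the loop.\<close>

lemma interior_on_left:
  assumes s: "0 < s" "s < L" and straight: "dl s = dr s"
  shows "\<exists>d>0. \<forall>t. 0 < t \<and> t < d \<longrightarrow> \<Gamma> s + of_real t * \<i> * dr s \<in> interior \<Omega> \<and> \<Gamma> s - of_real t * \<i> * dr s \<notin> \<Omega>"
proof -
  define p v where "p = \<Gamma> s" and "v = dr s"
  have v: "norm v = 1" by (simp add: v_def)
  obtain e1 where e1: "e1 > 0" "\<And>h. h \<in> {0..e1} \<Longrightarrow> \<Gamma> (s + h) = p + h *\<^sub>R v" using right[of s] by (auto simp: p_def v_def)
  obtain e2 where e2: "e2 > 0" "\<And>h. h \<in> {0..e2} \<Longrightarrow> \<Gamma> (s - h) = p - h *\<^sub>R v" using left[of s] straight by (auto simp: p_def v_def)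
  define e where "e = min (min e1 e2) (min (s / 2) ((L - s) / 2))"
  have e: "e > 0" "e \<le> e1" "e \<le> e2" "e < s" "e < L - s" using e1(1) e2(1) s by (auto simp: e_def min_def field_simps)
  have line: "\<Gamma> (s + h) = p + of_real h * v" if "\<bar>h\<bar> \<le> e" for h
    using e1(2)[of h] e2(2)[of "- h"] that e by (cases "h \<ge> 0") (auto simp: scaleR_conv_of_real)
  define a b where "a = (s - e) / L" and "b = (s + e) / L"
  have ab: "0 < a" "a < b" "b < 1" using e L by (auto simp: a_def b_def field_simps)
  have La: "L * a = s - e" "L * b = s + e" using L by (auto simp: a_def b_def)
  have seg: "loop (a + (b - a) * t) = linepath (p - of_real e * v) (p + of_real e * v) t" if "t \<in> {0..1}" for t
  proof -
    have "L * (a + (b - a) * t) = L * a + (L * b - L * a) * t" by (simp add: algebra_simps)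
    also have "\<dots> = s + (2 * t - 1) * e" unfolding La by (simp add: algebra_simps)
    finally have "L * (a + (b - a) * t) = s + (2 * t - 1) * e" .
    moreover have "\<bar>(2 * t - 1) * e\<bar> \<le> e"
    proof -
      have "\<bar>2 * t - 1\<bar> \<le> 1" using that by (auto simp: abs_le_iff)
      then show ?thesis using e mult_right_mono[of "\<bar>2 * t - 1\<bar>" 1 e] by (simp add: abs_mult)
    qed
    ultimately have "loop (a + (b - a) * t) = p + of_real ((2 * t - 1) * e) * v" using line by simp
    then show ?thesis by (simp add: linepath_def scaleR_conv_of_real algebra_simps)
  qed
  have away: "loop x \<noteq> p" if x: "x \<in> {0..1}" "x \<notin> {a<..<b}" for x
  proof -
    have "0 \<le> L * x" "L * x \<le> L" using x L by (auto simp: mult_le_cancel_left1 intro: mult_nonneg_nonneg)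
    moreover have "L * x \<le> L * a \<or> L * b \<le> L * x" using x L by (auto simp: mult_le_cancel_left_pos)
    ultimately have "0 \<le> L * x \<and> L * x < s \<or> s < L * x \<and> L * x \<le> L" using La e by auto
    then show ?thesis unfolding p_def
      using simple[of "L * x" s] simple[of s "L * x"] s by (elim disjE) auto
  qed
  have path: "path loop" using loop by (simp add: simple_path_def)
  obtain d1 where d1: "d1 > 0" and jump: "\<And>t. 0 < t \<Longrightarrow> t < d1 \<Longrightarrow> p + of_real t * \<i> * v \<notin> path_image loop \<Longrightarrow> p - of_real t * \<i> * v \<notin> path_image loop \<Longrightarrow>
     Re (winding_number loop (p + of_real t * \<i> * v)) > Re (winding_number loop (p - of_real t * \<i> * v)) - 1"
    using winding_number_jump[OF path ab seg away v e(1)] by blast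
  have "closed (loop ` {0..a} \<union> loop ` {b..1})"
  proof -
    have "continuous_on X loop" for X
      by (rule continuous_on_compose2[OF cont[of UNIV]]) (auto intro!: continuous_intros)
    then show ?thesis by (intro closed_Un compact_imp_closed compact_continuous_image) auto
  qed
  moreover have "p \<notin> loop ` {0..a} \<union> loop ` {b..1}"
  proof -
    have "loop x \<noteq> p" if "x \<in> {0..a} \<union> {b..1}" for x using that ab by (intro away) auto
    then show ?thesis by blast
  qed
  ultimately obtain d2 where d2: "d2 > 0" "ball p d2 \<subseteq> - (loop ` {0..a} \<union> loop ` {b..1})"
    using openE[of "- (loop ` {0..a} \<union> loop ` {b..1})" p] unfolding closed_def by blast
  \<comment> \<open>\<open>d1\<close> serves the comparison of winding numbers, \<open>d2\<close>
    keeps the rest of the loop out of the disk, and \<open>e\<close> ensures that the line inside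
    the disk belongs to the boundary.\<close>
  define d where "d = Min {d1, d2, e}"
  have d: "d > 0" "d \<le> d1" "d \<le> d2" "d \<le> e" using d1 d2 e by (auto simp: d_def)
  have on_line: "\<exists>h. q = p + of_real h * v" if q: "q \<in> frontier \<Omega>" "dist p q < d" for q
  proof -
    obtain x where x: "x \<in> {0..1}" "q = loop x" using q(1) unfolding loop(3)[symmetric] path_image_def by blast
    have "q \<in> ball p d2" using q d by simp
    then have "x \<notin> {0..a} \<union> {b..1}" using x d2(2) by blast
    then have "a < x" "x < b" using x by auto
    then have "L * a < L * x" "L * x < L * b" using L by auto
    then have "\<bar>L * x - s\<bar> \<le> e" unfolding La by auto
    then have "q = p + of_real (L * x - s) * v" using line[of "L * x - s"] x(2) by simp
    then show ?thesis by blast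
  qed
  have line_fr: "p + of_real h * v \<in> frontier \<Omega>" if "\<bar>h\<bar> \<le> e" for h
    using line[OF that] boundary by (metis rangeI)
  \<comment> \<open>The half disks on the left (\<sigma> = 1) and on the right (\<sigma> = -1) of
    the edge.\<close>
  define H where "H \<sigma> = placed p v ` (ball 0 d \<inter> {w. \<sigma> * Im w > 0})" for \<sigma> :: real
  have Hfr: "H \<sigma> \<inter> frontier \<Omega> = {}" for \<sigma>
  proof (rule ccontr)
    assume "H \<sigma> \<inter> frontier \<Omega> \<noteq> {}"
    then obtain w where w: "norm w < d" "\<sigma> * Im w > 0" "placed p v w \<in> frontier \<Omega>" by (auto simp: H_def)
    have "dist p (placed p v w) < d" using w v by (simp add: placed_def dist_norm norm_mult)
    then obtain h where "placed p v w = p + of_real h * v" using on_line w by blast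
    then have "v * w = v * of_real h" by (simp add: placed_def mult.commute)
    moreover have "v \<noteq> 0" using v by auto
    ultimately have "w = of_real h" by simp
    then show False using w by simp
  qed
  have Hconn: "connected (H \<sigma>)" for \<sigma>
  proof -
    have "{w. \<sigma> * Im w > 0} = {w. inner (\<i> * of_real \<sigma>) w > 0}" by (simp add: inner_complex_def)
    then have "convex (ball 0 d \<inter> {w. \<sigma> * Im w > 0})" by (simp add: convex_Int convex_halfspace_gt)
    then show ?thesis unfolding H_def placed_def
      by (intro connected_continuous_image convex_connected continuous_intros)
  qed
  have Hcase: "H \<sigma> \<subseteq> \<Omega> \<or> H \<sigma> \<inter> \<Omega> = {}" for \<sigma>
    using connected_Int_frontier[OF Hconn[of \<sigma>], of \<Omega>] Hfr[of \<sigma>] by blast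
  have inH: "z \<in> H 1 \<or> z \<in> H (- 1)" if z: "dist p z < d" "z \<notin> frontier \<Omega>" for z
  proof -
    define w where "w = cnj v * (z - p)"
    have zw: "z = placed p v w" using placed_inverse[OF v] by (simp add: w_def)
    have nw: "norm w < d" using z(1) v by (simp add: w_def norm_mult dist_norm norm_minus_commute)
    have "Im w \<noteq> 0"
    proof
      assume "Im w = 0"
      then have "w = of_real (Re w)" by (simp add: complex_eq_iff)
      moreover have "\<bar>Re w\<bar> \<le> e" using nw abs_Re_le_cmod[of w] d by linarith
      ultimately show False using line_fr[of "Re w"] z(2) zw by (simp add: placed_def mult.commute)
    qed
    then show ?thesis using nw unfolding zw H_def by (cases "Im w > 0") auto
  qed
  have p_fr: "p \<in> frontier \<Omega>" using line_fr[of 0] e by simp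
  have "p \<in> closure (interior \<Omega>)"
    using p_fr regular cpt compact_imp_closed frontier_subset_closed by blast
  then obtain z1 where z1: "z1 \<in> interior \<Omega>" "dist p z1 < d"
    using d(1) by (metis closure_approachable dist_commute)
  obtain z2 where z2: "z2 \<notin> \<Omega>" "dist p z2 < d"
    using p_fr d(1) unfolding frontier_straddle by blast
  have n1: "z1 \<notin> frontier \<Omega>" using z1 by (auto simp: frontier_def)
  have n2: "z2 \<notin> frontier \<Omega>" using z2 cpt compact_imp_closed frontier_subset_closed by blast
  have "z1 \<in> \<Omega>" using z1 interior_subset by blast
  then have alt: "H 1 \<subseteq> \<Omega> \<and> H (- 1) \<inter> \<Omega> = {} \<or> H (- 1) \<subseteq> \<Omega> \<and> H 1 \<inter> \<Omega> = {}"
    using inH[OF z1(2) n1] inH[OF z2(2) n2] z2(1) Hcase[of 1] Hcase[of "- 1"] by blast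
  have mem: "p + of_real t * \<i> * v \<in> H 1" "p - of_real t * \<i> * v \<in> H (- 1)" if "0 < t" "t < d" for t
  proof -
    have "p + of_real t * \<i> * v = placed p v (of_real t * \<i>)" "p - of_real t * \<i> * v = placed p v (- (of_real t * \<i>))"
      by (simp_all add: placed_def)
    then show "p + of_real t * \<i> * v \<in> H 1" "p - of_real t * \<i> * v \<in> H (- 1)"
      unfolding H_def using that by (auto intro!: imageI simp: norm_mult)
  qed
  have int: "z \<in> interior \<Omega>" if "z \<in> H \<sigma>" "H \<sigma> \<subseteq> \<Omega>" for z \<sigma>
  proof -
    have "z \<in> \<Omega>" "z \<notin> frontier \<Omega>" using that Hfr[of \<sigma>] by auto
    then show ?thesis using closure_subset by (auto simp: frontier_def)
  qed
  have "\<not> (H (- 1) \<subseteq> \<Omega> \<and> H 1 \<inter> \<Omega> = {})"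
  proof
    assume H: "H (- 1) \<subseteq> \<Omega> \<and> H 1 \<inter> \<Omega> = {}"
    define t where "t = d / 2"
    have t: "0 < t" "t < d" using d by (auto simp: t_def)
    let ?P = "p + of_real t * \<i> * v" and ?M = "p - of_real t * \<i> * v"
    have "winding_number loop ?M = 1" using mem[OF t] H int by (intro winding) blast
    moreover have "winding_number loop ?P = 0" using mem[OF t] H by (intro exterior_winding) blast
    moreover have "?P \<notin> path_image loop" "?M \<notin> path_image loop"
      unfolding loop(3) using mem[OF t] Hfr[of 1] Hfr[of "- 1"] by blast+
    \<comment> \<open>The jump inequality would read \<open>0 > 1 - 1\<close>.\<close>
    ultimately show False using jump[of t] t d by simp
  qed
  then have "H 1 \<subseteq> \<Omega>" "H (- 1) \<inter> \<Omega> = {}" using alt by blast+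
  then show ?thesis using mem int d(1) unfolding p_def[symmetric] v_def[symmetric] by blast
qed

text \<open>The exit and entry points in the local frame at \<open>\<Gamma> s\<close>; as vectors
  they have length \<open>r\<close>, not 1.\<close>

definition exit_dir :: "real \<Rightarrow> complex" where "exit_dir s = cnj (dr s) * (exit s - \<Gamma> s)"
definition entry_dir :: "real \<Rightarrow> complex" where "entry_dir s = cnj (dr s) * (entry s - \<Gamma> s)"

abbreviation local_region :: "real \<Rightarrow> complex set" where
  "local_region s \<equiv> placed (\<Gamma> s) (dr s) -` \<Omega>"

lemma Re_placed: "Re z = dr s \<bullet> (placed p (dr s) z - p)"
proof -
  have "Re (dr s) * (Re (dr s) * Re z) + Im (dr s) * (Im (dr s) * Re z) = (norm (dr s))\<^sup>2 * Re z"
    by (simp only: cmod_power2) (simp add: power2_eq_square algebra_simps)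
  then show ?thesis by (simp add: placed_def inner_complex_def algebra_simps)
qed

lemma placed_dirs: "placed (\<Gamma> s) (dr s) (exit_dir s) = exit s" "placed (\<Gamma> s) (dr s) (entry_dir s) = entry s"
  by (simp_all add: exit_dir_def entry_dir_def placed_inverse)

lemma dirs:
  "exit_dir s \<in> frontier (local_region s)" "entry_dir s \<in> frontier (local_region s)"
  "norm (exit_dir s) = r" "norm (entry_dir s) = r" "Re (exit_dir s) > 0" "Re (entry_dir s) < 0"
  "\<bar>Im (exit_dir s)\<bar> < r" "\<bar>Im (entry_dir s)\<bar> < r"
proof -
  show "exit_dir s \<in> frontier (local_region s)" "entry_dir s \<in> frontier (local_region s)"
    using exit(1)[of s] entry(1)[of s] by (simp_all add: frontier_vimage_placed placed_dirs boundary)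
  show n: "norm (exit_dir s) = r" "norm (entry_dir s) = r"
    using exit(2)[of s] entry(2)[of s] by (simp_all add: exit_dir_def entry_dir_def norm_mult)
  show R: "Re (exit_dir s) > 0" "Re (entry_dir s) < 0"
    using exit(3)[of s] entry(3)[of s] Re_placed[of "exit_dir s" s "\<Gamma> s"] Re_placed[of "entry_dir s" s "\<Gamma> s"]
    by (simp_all add: placed_dirs)
  have "\<bar>Im z\<bar> < r" if "norm z = r" "Re z \<noteq> 0" for z
  proof -
    have "\<bar>Im z\<bar>\<^sup>2 < (norm z)\<^sup>2" unfolding cmod_power2 using that(2) by simp
    then have "\<bar>Im z\<bar> < norm z" by (rule power_less_imp_less_base) simp
    then show ?thesis using that(1) by simp
  qed
  then show "\<bar>Im (exit_dir s)\<bar> < r" "\<bar>Im (entry_dir s)\<bar> < r" using n R by auto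
qed

lemma frontier_circle:
  assumes "q \<in> frontier (local_region s)" "norm q = r"
  shows "q = exit_dir s \<or> q = entry_dir s"
proof -
  have "placed (\<Gamma> s) (dr s) q \<in> range \<Gamma>" using assms(1) by (simp add: frontier_vimage_placed boundary)
  moreover have "norm (placed (\<Gamma> s) (dr s) q - \<Gamma> s) = r" using assms(2) by (simp add: placed_def norm_mult)
  ultimately have "placed (\<Gamma> s) (dr s) q = placed (\<Gamma> s) (dr s) (exit_dir s) \<or>
      placed (\<Gamma> s) (dr s) q = placed (\<Gamma> s) (dr s) (entry_dir s)"
    using circle_points unfolding placed_dirs by blast
  moreover have "dr s \<noteq> 0" by (metis norm_dr norm_zero zero_neq_one)
  ultimately show ?thesis by (simp add: placed_def)
qed

lemma finite_frontier_circle: "finite (frontier (local_region s) \<inter> sphere 0 r)"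
proof (rule finite_subset)
  show "frontier (local_region s) \<inter> sphere 0 r \<subseteq> {exit_dir s, entry_dir s}"
  proof
    fix q assume "q \<in> frontier (local_region s) \<inter> sphere 0 r"
    then have "q \<in> frontier (local_region s)" "norm q = r" by auto
    from frontier_circle[OF this] show "q \<in> {exit_dir s, entry_dir s}" by blast
  qed
qed simp

text \<open>Within the disk the tangent-cone condition forbids boundary points on the normal line
  other than \<open>\<Gamma> s\<close>. So what \<open>interior_on_left\<close> says near
  \<open>\<Gamma> s\<close> propagates to the poles of the circle, as
  \<open>half_circle_membership\<close> requires.\<close>

lemma circle_membership:
  assumes s: "0 < s" "s < L" and straight: "dl s = dr s" and y: "y \<in> {-r..r}"
  shows "Complex (sqrt (r\<^sup>2 - y\<^sup>2)) y \<in> local_region s \<longleftrightarrow> Im (exit_dir s) \<le> y"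
    and "Complex (- sqrt (r\<^sup>2 - y\<^sup>2)) y \<in> local_region s \<longleftrightarrow> Im (entry_dir s) \<le> y"
proof -
  have compW: "compact (local_region s)" by (simp add: compact_vimage_placed cpt)
  then have clW: "closed (local_region s)" by (rule compact_imp_closed)
  have axis: "Complex 0 y \<notin> frontier (local_region s)" if "\<bar>y\<bar> \<le> r" "y \<noteq> 0" for y
  proof
    assume "Complex 0 y \<in> frontier (local_region s)"
    then obtain t where t: "placed (\<Gamma> s) (dr s) (Complex 0 y) = \<Gamma> t"
      by (auto simp: frontier_vimage_placed boundary)
    have nm: "norm (\<Gamma> t - \<Gamma> s) = \<bar>y\<bar>" 
    proof -
      have "norm (Complex 0 y) = \<bar>y\<bar>" by (simp add: cmod_def)
      then show ?thesis unfolding t[symmetric] by (simp add: placed_def norm_mult)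
    qed
    then have "dr s \<bullet> (\<Gamma> t - \<Gamma> s) \<noteq> 0" using that by (intro cone_nonzero) auto
    then show False using Re_placed[of "Complex 0 y" s "\<Gamma> s"] t by simp
  qed
  obtain d where d: "d > 0" "\<And>t. 0 < t \<Longrightarrow> t < d \<Longrightarrow> \<Gamma> s + of_real t * \<i> * dr s \<in> interior \<Omega>"
    "\<And>t. 0 < t \<Longrightarrow> t < d \<Longrightarrow> \<Gamma> s - of_real t * \<i> * dr s \<notin> \<Omega>"
    using interior_on_left[OF s straight] by blast
  define t where "t = min d r / 2"
  have t: "0 < t" "t < d" "t \<le> r" using d(1) r by (auto simp: t_def min_def)
  have "placed (\<Gamma> s) (dr s) (Complex 0 t) = \<Gamma> s + of_real t * \<i> * dr s"
    "placed (\<Gamma> s) (dr s) (Complex 0 (- t)) = \<Gamma> s - of_real t * \<i> * dr s"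
    by (simp_all add: placed_def Complex_eq mult_ac)
  then have near: "Complex 0 t \<in> local_region s" "Complex 0 (- t) \<notin> local_region s"
    using d(2,3)[OF t(1,2)] interior_subset by auto
  have seg: "Complex 0 ` I \<subseteq> local_region s \<or> Complex 0 ` I \<inter> local_region s = {}"
    if I: "connected I" "I \<subseteq> {-r..r} - {0}" for I
  proof -
    have "connected (Complex 0 ` I)" unfolding Complex_eq
      by (intro connected_continuous_image continuous_intros I)
    moreover have "Complex 0 y \<notin> frontier (local_region s)" if "y \<in> I" for y
    proof -
      have "y \<in> {-r..r} - {0}" using I(2) that by blast
      then show ?thesis by (intro axis) (auto simp: abs_le_iff)
    qed
    then have "Complex 0 ` I \<inter> frontier (local_region s) = {}" by blast
    ultimately show ?thesis using connected_Int_frontier[of "Complex 0 ` I" "local_region s"] by blast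
  qed
  have top: "Complex 0 r \<in> local_region s"
  proof -
    have "Complex 0 ` {t..r} \<subseteq> local_region s \<or> Complex 0 ` {t..r} \<inter> local_region s = {}"
      using t by (intro seg) auto
    moreover have "Complex 0 t \<in> Complex 0 ` {t..r}" "Complex 0 r \<in> Complex 0 ` {t..r}"
      using t(3) by (auto intro!: imageI)
    ultimately show ?thesis using near(1) by blast
  qed
  have bot: "Complex 0 (- r) \<notin> local_region s"
  proof -
    have "Complex 0 ` {-r..-t} \<subseteq> local_region s \<or> Complex 0 ` {-r..-t} \<inter> local_region s = {}"
      using t by (intro seg) auto
    moreover have "Complex 0 (- t) \<in> Complex 0 ` {-r..-t}" "Complex 0 (- r) \<in> Complex 0 ` {-r..-t}"
      using t(3) by (auto intro!: imageI)
    ultimately show ?thesis using near(2) by blast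
  qed
  have only_exit: "q = exit_dir s" if "q \<in> frontier (local_region s)" "norm q = r" "1 * Re q \<ge> 0" for q
    using frontier_circle[OF that(1,2)] that(3) dirs(6)[of s] by (elim disjE) simp_all
  have only_entry: "q = entry_dir s" if "q \<in> frontier (local_region s)" "norm q = r" "- 1 * Re q \<ge> 0" for q
    using frontier_circle[OF that(1,2)] that(3) dirs(5)[of s] by (elim disjE) simp_all
  have pos: "1 * Re (exit_dir s) > 0" "- 1 * Re (entry_dir s) > 0" using dirs(5,6)[of s] by simp_all
  have 1: "\<bar>1 :: real\<bar> = 1" "\<bar>- 1 :: real\<bar> = 1" by simp_all
  have "Complex (1 * sqrt (r\<^sup>2 - y\<^sup>2)) y \<in> local_region s \<longleftrightarrow> Im (exit_dir s) \<le> y"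
    by (rule half_circle_membership[OF clW r 1(1) dirs(1,3) pos(1) _ top bot y], rule only_exit)
  then show "Complex (sqrt (r\<^sup>2 - y\<^sup>2)) y \<in> local_region s \<longleftrightarrow> Im (exit_dir s) \<le> y"
    by (simp only: mult_1)
  have "Complex (- 1 * sqrt (r\<^sup>2 - y\<^sup>2)) y \<in> local_region s \<longleftrightarrow> Im (entry_dir s) \<le> y"
    by (rule half_circle_membership[OF clW r 1(2) dirs(2,4) pos(2) _ top bot y], rule only_entry)
  then show "Complex (- sqrt (r\<^sup>2 - y\<^sup>2)) y \<in> local_region s \<longleftrightarrow> Im (entry_dir s) \<le> y"
    by (simp only: mult_minus1)
qed

text \<open>In the local frame, moving \<open>s\<close> along the edge translates the disk in
  direction 1. The heights from \<open>x\<close> up to \<open>r\<close> have length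
  \<open>r - x\<close>, so the two half circles contribute the entry height minus the exit
  height.\<close>

lemma area_arclength_deriv:
  assumes s: "0 < s" "s < L" and straight: "dl s = dr s"
  shows "((\<lambda>\<sigma>. area_invariant \<Omega> \<Gamma> \<sigma> r) has_real_derivative Im (entry_dir s) - Im (exit_dir s)) (at s)"
proof -
  let ?W = "local_region s"
  have compW: "compact ?W" by (simp add: compact_vimage_placed cpt)
  have m: "measure lborel {y\<in>{-r<..<r}. P y} = r - x" if "\<bar>x\<bar> < r" "\<And>y. y \<in> {-r..r} \<Longrightarrow> P y \<longleftrightarrow> x \<le> y" for x P
  proof -
    have "{y\<in>{-r<..<r}. P y} = {x..<r}" using that by auto
    then show ?thesis using that(1) by simp
  qed
  have "((\<lambda>h. measure lebesgue (?W \<inter> cball (of_real h) r)) has_real_derivative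
          (r - Im (exit_dir s)) - (r - Im (entry_dir s))) (at 0)"
    using area_translation_deriv[OF compW r finite_frontier_circle]
      m[OF dirs(7) circle_membership(1)[OF s straight]] m[OF dirs(8) circle_membership(2)[OF s straight]] by simp
  then have W: "((\<lambda>h. measure lebesgue (?W \<inter> cball (of_real h) r)) has_real_derivative
          Im (entry_dir s) - Im (exit_dir s)) (at (s - s))" by simp
  have "((\<lambda>\<sigma>. measure lebesgue (?W \<inter> cball (of_real (\<sigma> - s)) r)) has_real_derivative
          (Im (entry_dir s) - Im (exit_dir s)) * 1) (at s)"
    by (rule DERIV_chain2[where g="\<lambda>\<sigma>. \<sigma> - s", OF W]) (auto intro!: derivative_eq_intros)
  then have D: "((\<lambda>\<sigma>. measure lebesgue (?W \<inter> cball (of_real (\<sigma> - s)) r)) has_real_derivative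
          Im (entry_dir s) - Im (exit_dir s)) (at s)" by simp
  obtain e1 where e1: "e1 > 0" "\<And>h. h \<in> {0..e1} \<Longrightarrow> \<Gamma> (s + h) = \<Gamma> s + h *\<^sub>R dr s" using right[of s] by blast
  obtain e2 where e2: "e2 > 0" "\<And>h. h \<in> {0..e2} \<Longrightarrow> \<Gamma> (s - h) = \<Gamma> s - h *\<^sub>R dr s" using left[of s] straight by auto
  have "area_invariant \<Omega> \<Gamma> \<sigma> r = measure lebesgue (?W \<inter> cball (of_real (\<sigma> - s)) r)" if "dist \<sigma> s < min e1 e2" for \<sigma>
  proof -
    have "\<Gamma> \<sigma> = placed (\<Gamma> s) (dr s) (of_real (\<sigma> - s))"
      using that e1(2)[of "\<sigma> - s"] e2(2)[of "s - \<sigma>"]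
      by (cases "\<sigma> \<ge> s") (auto simp: dist_real_def placed_def scaleR_conv_of_real algebra_simps)
    then show ?thesis unfolding area_invariant_def by (simp add: measure_placed cpt)
  qed
  then show ?thesis
    using e1(1) e2(1) by (intro has_field_derivative_transform_within[OF D, of "min e1 e2"]) auto
qed

text \<open>Radial projection to the circle keeps the sign of the real part, so the two halves in
  \<open>circle_membership\<close> match the two cases of \<open>sector\<close>.\<close>

lemma local_cone:
  assumes s: "0 < s" "s < L" and straight: "dl s = dr s"
  shows "radial_cone (local_region s) r = sector r (Im (entry_dir s)) (Im (exit_dir s))"
proof (rule set_eqI)
  fix z
  show "z \<in> radial_cone (local_region s) r \<longleftrightarrow> z \<in> sector r (Im (entry_dir s)) (Im (exit_dir s))"
  proof (cases "z = 0")
    case False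
    define q where "q = of_real r * sgn z"
    define y where "y = Im q"
    have nq: "norm q = r" using False r by (simp add: q_def norm_mult norm_sgn)
    have y: "y \<in> {-r..r}" using abs_Im_le_cmod[of q] nq by (auto simp: y_def)
    have yz: "y = r * Im (sgn z)" by (simp add: y_def q_def)
    have "Re q = r * (Re z / norm z)" by (simp add: q_def sgn_div_norm divide_inverse mult.commute)
    then have sg: "Re q \<ge> 0 \<longleftrightarrow> Re z \<ge> 0"
      using r False by (simp add: zero_le_mult_iff zero_le_divide_iff)
    have "(Re q)\<^sup>2 = r\<^sup>2 - y\<^sup>2" using nq by (auto simp: cmod_def y_def)
    then have "\<bar>Re q\<bar> = sqrt (r\<^sup>2 - y\<^sup>2)" by (metis real_sqrt_abs)
    then have q: "q = Complex (if Re z \<ge> 0 then sqrt (r\<^sup>2 - y\<^sup>2) else - sqrt (r\<^sup>2 - y\<^sup>2)) y"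
      using sg by (auto simp: complex_eq_iff y_def abs_if split: if_splits)
    have "q \<in> local_region s \<longleftrightarrow> (if Re z \<ge> 0 then Im (exit_dir s) else Im (entry_dir s)) \<le> y"
      using circle_membership[OF s straight y] unfolding q by simp
    moreover have "z \<in> radial_cone (local_region s) r \<longleftrightarrow> q \<in> local_region s"
      using False by (simp add: radial_cone_def q_def)
    moreover have "z \<in> sector r (Im (entry_dir s)) (Im (exit_dir s)) \<longleftrightarrow>
        (if Re z \<ge> 0 then Im (exit_dir s) else Im (entry_dir s)) \<le> y"
      using False by (simp add: sector_def yz)
    ultimately show ?thesis by blast
  qed (simp add: radial_cone_def sector_def)
qed

lemma sector_borel:
  assumes s: "0 < s" "s < L" and straight: "dl s = dr s"
  shows "sector r (Im (entry_dir s)) (Im (exit_dir s)) \<in> sets borel"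
  unfolding local_cone[OF s straight, symmetric] radial_cone_def
  by (intro borel_sgn_cone compact_imp_closed compact_vimage_placed cpt norm_dr)

lemma area_radius_deriv:
  assumes s: "0 < s" "s < L" and straight: "dl s = dr s"
  shows "((\<lambda>\<rho>. area_invariant \<Omega> \<Gamma> s \<rho>) has_real_derivative
     2 * r * measure lebesgue (sector r (Im (entry_dir s)) (Im (exit_dir s)) \<inter> cball 0 1)) (at r)"
proof -
  have "area_invariant \<Omega> \<Gamma> s \<rho> = measure lebesgue (local_region s \<inter> cball 0 \<rho>)" for \<rho>
    using measure_placed[of "dr s" \<Omega> "\<Gamma> s" 0 \<rho>] cpt by (simp add: area_invariant_def placed_def)
  moreover have "compact (local_region s)" by (simp add: compact_vimage_placed cpt)
  ultimately show ?thesis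
    using area_radial_deriv[OF _ r finite_frontier_circle[of s]] local_cone[OF s straight] by simp
qed

end

subsection \<open>Tangents of a periodic polygonal curve\<close>

lemma consecutive_index:
  fixes n :: nat
  assumes "n > 0" "P 0" "\<not> P (n - 1)"
  shows "\<exists>i. Suc i < n \<and> P i \<and> \<not> P (Suc i)"
proof (rule ccontr)
  assume no: "\<not> ?thesis"
  have "i < n \<Longrightarrow> P i" for i
    by (induction i) (use assms(2) no Suc_lessD in blast)+
  then show False using assms by simp
qed

text \<open>The bounds \<open>s + e \<le> L\<close> and \<open>0 \<le> s - e\<close> keep each germ
  where \<gamma> agrees with its periodic extension.\<close>

lemma arclength_germs:
  assumes pa: "polygonal_arclength L \<gamma>"
  shows "0 \<le> s \<Longrightarrow> s < L \<Longrightarrow> \<exists>v e. norm v = 1 \<and> e > 0 \<and> s + e \<le> L \<and> (\<forall>h\<in>{0..e}. \<gamma> (s + h) = \<gamma> s + h *\<^sub>R v)"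
    and "0 < s \<Longrightarrow> s \<le> L \<Longrightarrow> \<exists>v e. norm v = 1 \<and> e > 0 \<and> 0 \<le> s - e \<and> (\<forall>h\<in>{0..e}. \<gamma> (s - h) = \<gamma> s - h *\<^sub>R v)"
proof -
  obtain ts where ts: "ts \<noteq> []" "hd ts = 0" "last ts = L"
    and piece: "\<And>i. Suc i < length ts \<Longrightarrow> \<exists>v. norm v = 1 \<and>
              (\<forall>t\<in>{ts ! i..ts ! Suc i}. \<gamma> t = \<gamma> (ts ! i) + (t - ts ! i) *\<^sub>R v)"
    using pa unfolding polygonal_arclength_def by blast
  have ends: "ts ! 0 = 0" "ts ! (length ts - 1) = L" "length ts > 0"
    using ts by (simp_all add: hd_conv_nth last_conv_nth)
  show "\<exists>v e. norm v = 1 \<and> e > 0 \<and> s + e \<le> L \<and> (\<forall>h\<in>{0..e}. \<gamma> (s + h) = \<gamma> s + h *\<^sub>R v)"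
    if s: "0 \<le> s" "s < L"
  proof -
    \<comment> \<open>With \<le> a subdivision point gets the piece that begins there; the strict
      inequality used for the left germ picks the piece that ends there.\<close>
    obtain i where i: "Suc i < length ts" "ts ! i \<le> s" "\<not> ts ! Suc i \<le> s"
      using consecutive_index[of "length ts" "\<lambda>i. ts ! i \<le> s"] ends s by auto
    obtain v where v: "norm v = 1" "\<And>t. t \<in> {ts ! i..ts ! Suc i} \<Longrightarrow> \<gamma> t = \<gamma> (ts ! i) + (t - ts ! i) *\<^sub>R v"
      using piece[OF i(1)] by blast
    have "\<gamma> (s + h) = \<gamma> s + h *\<^sub>R v" if "h \<in> {0..min (ts ! Suc i - s) (L - s)}" for h
    proof -
      have "s \<in> {ts ! i..ts ! Suc i}" "s + h \<in> {ts ! i..ts ! Suc i}" using that i by auto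
      note * = this[THEN v(2)]
      show ?thesis unfolding * by (simp add: algebra_simps)
    qed
    moreover have "min (ts ! Suc i - s) (L - s) > 0" "s + min (ts ! Suc i - s) (L - s) \<le> L" using i s by auto
    ultimately show ?thesis using v(1) by blast
  qed
  show "\<exists>v e. norm v = 1 \<and> e > 0 \<and> 0 \<le> s - e \<and> (\<forall>h\<in>{0..e}. \<gamma> (s - h) = \<gamma> s - h *\<^sub>R v)"
    if s: "0 < s" "s \<le> L"
  proof -
    obtain i where i: "Suc i < length ts" "ts ! i < s" "\<not> ts ! Suc i < s"
      using consecutive_index[of "length ts" "\<lambda>i. ts ! i < s"] ends s by auto
    obtain v where v: "norm v = 1" "\<And>t. t \<in> {ts ! i..ts ! Suc i} \<Longrightarrow> \<gamma> t = \<gamma> (ts ! i) + (t - ts ! i) *\<^sub>R v"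
      using piece[OF i(1)] by blast
    have "\<gamma> (s - h) = \<gamma> s - h *\<^sub>R v" if "h \<in> {0..min (s - ts ! i) s}" for h
    proof -
      have "s \<in> {ts ! i..ts ! Suc i}" "s - h \<in> {ts ! i..ts ! Suc i}" using that i by auto
      note * = this[THEN v(2)]
      show ?thesis unfolding * by (simp add: algebra_simps)
    qed
    moreover have "min (s - ts ! i) s > 0" "0 \<le> s - min (s - ts ! i) s" using i s by auto
    ultimately show ?thesis using v(1) by blast
  qed
qed

lemma right_tangent_eq:
  assumes e: "e > 0" and G: "\<And>h. h \<in> {0..e} \<Longrightarrow> G (s + h) = G s + h *\<^sub>R v"
  shows "right_tangent G s = v"
proof -
  have "vector_derivative G (at t) = v" if t: "t \<in> {s<..<s + e}" for t
  proof (rule vector_derivative_at)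
    have "((\<lambda>t. G s + (t - s) *\<^sub>R v) has_vector_derivative v) (at t)"
      unfolding has_vector_derivative_def by (rule derivative_eq_intros refl | simp)+
    then show "(G has_vector_derivative v) (at t)"
    proof (rule has_vector_derivative_transform_within_open)
      show "open {s<..<s + e}" "t \<in> {s<..<s + e}" using t by auto
      show "G s + (y - s) *\<^sub>R v = G y" if "y \<in> {s<..<s + e}" for y
        using G[of "y - s"] that by simp
    qed
  qed
  moreover have "eventually (\<lambda>t. t \<in> {s<..<s + e}) (at_right s)"
    using e by (intro eventually_at_rightI[of s "s + e"]) auto
  ultimately have "eventually (\<lambda>t. vector_derivative G (at t) = v) (at_right s)"
    by (auto elim: eventually_mono)
  then show ?thesis unfolding right_tangent_def
    by (intro tendsto_Lim tendsto_eventually) auto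
qed

lemma left_tangent_eq:
  assumes e: "e > 0" and G: "\<And>h. h \<in> {0..e} \<Longrightarrow> G (s - h) = G s - h *\<^sub>R v"
  shows "left_tangent G s = v"
proof -
  have "vector_derivative G (at t) = v" if t: "t \<in> {s - e<..<s}" for t
  proof (rule vector_derivative_at)
    have "((\<lambda>t. G s - (s - t) *\<^sub>R v) has_vector_derivative v) (at t)"
      unfolding has_vector_derivative_def by (rule derivative_eq_intros refl | simp)+
    then show "(G has_vector_derivative v) (at t)"
    proof (rule has_vector_derivative_transform_within_open)
      show "open {s - e<..<s}" "t \<in> {s - e<..<s}" using t by auto
      show "G s - (s - y) *\<^sub>R v = G y" if "y \<in> {s - e<..<s}" for y
        using G[of "s - y"] that by simp
    qed
  qed
  moreover have "eventually (\<lambda>t. t \<in> {s - e<..<s}) (at_left s)"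
    using e by (intro eventually_at_leftI[of "s - e" s]) auto
  ultimately have "eventually (\<lambda>t. vector_derivative G (at t) = v) (at_left s)"
    by (auto elim: eventually_mono)
  then show ?thesis unfolding left_tangent_def
    by (intro tendsto_Lim tendsto_eventually) auto
qed

section \<open>The periodic extension satisfies the assumptions of
  \<open>tcgl_polygon\<close>\<close>

definition reduce :: "real \<Rightarrow> real \<Rightarrow> real" where
  "reduce L t = t - L * of_int \<lfloor>t / L\<rfloor>"

lemma reduce_bounds: "L > 0 \<Longrightarrow> 0 \<le> reduce L t" "L > 0 \<Longrightarrow> reduce L t < L"
proof -
  assume L: "L > 0"
  show "0 \<le> reduce L t" "reduce L t < L"
    using floor_divide_lower[OF L, of t] floor_divide_upper[OF L, of t] by (simp_all add: reduce_def algebra_simps)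
qed

lemma periodic_ext_reduce: "periodic_ext L \<gamma> t = \<gamma> (reduce L t)"
  by (simp add: periodic_ext_def reduce_def)

lemma periodic_ext_add_int:
  assumes "L > 0" shows "periodic_ext L \<gamma> (t + L * of_int k) = periodic_ext L \<gamma> t"
proof -
  have "(t + L * of_int k) / L = t / L + of_int k" using assms by (simp add: field_simps)
  then show ?thesis by (simp add: periodic_ext_def algebra_simps)
qed

lemma periodic_ext_eq:
  assumes "L > 0" "\<gamma> 0 = \<gamma> L" "0 \<le> t" "t \<le> L"
  shows "periodic_ext L \<gamma> t = \<gamma> t"
proof (cases "t = L")
  case True
  then show ?thesis using assms by (simp add: periodic_ext_def)
next
  case False
  then have "\<lfloor>t / L\<rfloor> = 0" using assms by (simp add: floor_eq_iff)
  then show ?thesis by (simp add: periodic_ext_def)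
qed

lemma tcgl_polygon_of_param:
  assumes pp: "polygon_param \<Omega> L \<gamma>" and r: "r > 0" and tc: "tcgl \<Omega> L \<gamma> r"
  shows "\<exists>dl dr. tcgl_polygon (periodic_ext L \<gamma>) L r dl dr \<Omega>"
proof -
  let ?G = "periodic_ext L \<gamma>"
  have L: "L > 0" and close: "\<gamma> 0 = \<gamma> L" and pa: "polygonal_arclength L \<gamma>" and inj: "inj_on \<gamma> {0..<L}"
    and fr: "frontier \<Omega> = \<gamma> ` {0..L}" and cpt: "compact \<Omega>" and conn: "connected (interior \<Omega>)"
    and reg: "\<Omega> = closure (interior \<Omega>)"
    and wn: "\<And>z. z \<in> interior \<Omega> \<Longrightarrow> winding_number (\<lambda>t. \<gamma> (L * t)) z = 1"
    using pp by (auto simp: polygon_param_def)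
  note eq = periodic_ext_eq[OF L close]
  have shift: "?G (s + x) = ?G (reduce L s + x)" for s x
    using periodic_ext_add_int[OF L, of \<gamma> "reduce L s + x" "\<lfloor>s / L\<rfloor>"] by (simp add: reduce_def algebra_simps)
  have range: "range ?G = \<gamma> ` {0..L}"
  proof (intro equalityI subsetI)
    fix q assume "q \<in> range ?G"
    then obtain t where "q = \<gamma> (reduce L t)" by (auto simp: periodic_ext_reduce)
    then show "q \<in> \<gamma> ` {0..L}" using reduce_bounds[OF L, of t] by auto
  next
    fix q assume "q \<in> \<gamma> ` {0..L}"
    then obtain t where "0 \<le> t" "t \<le> L" "q = \<gamma> t" by auto
    then show "q \<in> range ?G" using eq[of t] by (metis rangeI)
  qed
  have gr: "\<exists>v e. norm v = 1 \<and> e > 0 \<and> (\<forall>h\<in>{0..e}. ?G (s + h) = ?G s + h *\<^sub>R v)" if s: "0 \<le> s" "s < L" for s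
  proof -
    obtain v e where ve: "norm v = 1" "e > 0" "s + e \<le> L" "\<And>h. h \<in> {0..e} \<Longrightarrow> \<gamma> (s + h) = \<gamma> s + h *\<^sub>R v"
      using arclength_germs(1)[OF pa s] by blast
    have "?G (s + h) = ?G s + h *\<^sub>R v" if "h \<in> {0..e}" for h
      using ve(3) ve(4)[OF that] that s eq[of s] eq[of "s + h"] by auto
    then show ?thesis using ve(1,2) by blast
  qed
  have gl: "\<exists>v e. norm v = 1 \<and> e > 0 \<and> (\<forall>h\<in>{0..e}. ?G (s - h) = ?G s - h *\<^sub>R v)" if s: "0 < s" "s \<le> L" for s
  proof -
    obtain v e where ve: "norm v = 1" "e > 0" "0 \<le> s - e" "\<And>h. h \<in> {0..e} \<Longrightarrow> \<gamma> (s - h) = \<gamma> s - h *\<^sub>R v"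
      using arclength_germs(2)[OF pa s] by blast
    have "?G (s - h) = ?G s - h *\<^sub>R v" if "h \<in> {0..e}" for h
      using ve(3) ve(4)[OF that] that s eq[of s] eq[of "s - h"] by auto
    then show ?thesis using ve(1,2) by blast
  qed
  have gl0: "\<exists>v e. norm v = 1 \<and> e > 0 \<and> (\<forall>h\<in>{0..e}. ?G (s - h) = ?G s - h *\<^sub>R v)" if s: "0 \<le> s" "s < L" for s
  proof (cases "s = 0")
    case True
    \<comment> \<open>At the seam the left germ is the one at \<open>L\<close>, carried to 0 by
      periodicity.\<close>
    obtain v e where ve: "norm v = 1" "e > 0" "\<And>h. h \<in> {0..e} \<Longrightarrow> ?G (L - h) = ?G L - h *\<^sub>R v"
      using gl[of L] L by blast
    have "?G (L - h) = ?G (0 - h)" for h using periodic_ext_add_int[OF L, of \<gamma> "- h" 1] by simp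
    then show ?thesis using ve True by (metis diff_zero)
  next
    case False
    then show ?thesis using gl[of s] s by simp
  qed
  \<comment> \<open>Tangents are taken at the representative in [0, L), since \<open>tcgl\<close>
    speaks of those parameters.\<close>
  define dl where "dl s = left_tangent ?G (reduce L s)" for s
  define dr where "dr s = right_tangent ?G (reduce L s)" for s
  have right: "norm (dr s) = 1 \<and> (\<exists>e>0. \<forall>h\<in>{0..e}. ?G (s + h) = ?G s + h *\<^sub>R dr s)" for s
  proof -
    obtain v e where ve: "norm v = 1" "e > 0" "\<And>h. h \<in> {0..e} \<Longrightarrow> ?G (reduce L s + h) = ?G (reduce L s) + h *\<^sub>R v"
      using gr[of "reduce L s"] reduce_bounds[OF L, of s] by blast
    have "dr s = v" unfolding dr_def using ve(2,3) by (rule right_tangent_eq)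
    moreover have "?G (s + h) = ?G (reduce L s + h)" "?G s = ?G (reduce L s)" for h
      using shift[of s h] shift[of s 0] by simp_all
    ultimately show ?thesis using ve by metis
  qed
  have left: "norm (dl s) = 1 \<and> (\<exists>e>0. \<forall>h\<in>{0..e}. ?G (s - h) = ?G s - h *\<^sub>R dl s)" for s
  proof -
    obtain v e where ve: "norm v = 1" "e > 0" "\<And>h. h \<in> {0..e} \<Longrightarrow> ?G (reduce L s - h) = ?G (reduce L s) - h *\<^sub>R v"
      using gl0[of "reduce L s"] reduce_bounds[OF L, of s] by blast
    have "dl s = v" unfolding dl_def using ve(2,3) by (rule left_tangent_eq)
    moreover have "?G (s - h) = ?G (reduce L s - h)" "?G s = ?G (reduce L s)" for h
      using shift[of s "- h"] shift[of s 0] by simp_all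
    ultimately show ?thesis using ve by metis
  qed
  have "tcgl_polygon ?G L r dl dr \<Omega>"
  proof
    show "L > 0" "r > 0" by fact+
    show "?G (s + L) = ?G s" for s using periodic_ext_add_int[OF L, of \<gamma> s 1] by simp
    show "?G s \<noteq> ?G t" if st: "s < t" "t < s + L" for s t
    proof
      assume "?G s = ?G t"
      then have "reduce L s = reduce L t"
        unfolding periodic_ext_reduce
        using inj_onD[OF inj] reduce_bounds[OF L, of s] reduce_bounds[OF L, of t] by auto
      then have "t - s = L * of_int (\<lfloor>t / L\<rfloor> - \<lfloor>s / L\<rfloor>)" by (simp add: reduce_def algebra_simps)
      then have "0 < L * real_of_int (\<lfloor>t / L\<rfloor> - \<lfloor>s / L\<rfloor>)" "L * real_of_int (\<lfloor>t / L\<rfloor> - \<lfloor>s / L\<rfloor>) < L * 1"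
        using st by linarith+
      then have "0 < real_of_int (\<lfloor>t / L\<rfloor> - \<lfloor>s / L\<rfloor>)" "real_of_int (\<lfloor>t / L\<rfloor> - \<lfloor>s / L\<rfloor>) < 1"
        using L by (simp_all only: mult_less_cancel_left_pos zero_less_mult_pos)
      then show False unfolding of_int_0_less_iff of_int_less_1_iff by linarith
    qed
    show "\<exists>e>0. \<forall>h\<in>{0..e}. ?G (s + h) = ?G s + h *\<^sub>R dr s" for s using right by blast
    show "\<exists>e>0. \<forall>h\<in>{0..e}. ?G (s - h) = ?G s - h *\<^sub>R dl s" for s using left by blast
    show "norm (dl s) = 1" "norm (dr s) = 1" for s using left right by blast+
    show "(a *\<^sub>R dl s + b *\<^sub>R dr s) \<bullet> (?G t - ?G s) \<noteq> 0"
      if "?G t \<noteq> ?G s" "norm (?G t - ?G s) \<le> r" "0 \<le> a" "0 \<le> b" "0 < a + b" for s t a b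
    proof -
      let ?s = "reduce L s"
      have Gs: "?G s = ?G ?s" using shift[of s 0] by simp
      have "tcgl_at \<Omega> ?G r ?s" using tc reduce_bounds[OF L, of s] by (simp add: tcgl_def)
      moreover have "a *\<^sub>R dl s + b *\<^sub>R dr s \<in> tangent_cone ?G ?s"
        using that unfolding tangent_cone_def dl_def dr_def by blast
      moreover have "?G t \<in> frontier \<Omega> \<inter> cball (?G ?s) r" "?G ?s \<in> frontier \<Omega> \<inter> cball (?G ?s) r"
        using that r unfolding fr range[symmetric] Gs by (auto simp: dist_norm norm_minus_commute)
      ultimately show ?thesis using that(1) unfolding tcgl_at_def Gs by blast
    qed
    show "compact \<Omega>" "connected (interior \<Omega>)" "\<Omega> = closure (interior \<Omega>)" by fact+
    show "frontier \<Omega> = range ?G" using fr range by simp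
    show "winding_number (\<lambda>t. ?G (L * t)) z = 1" if "z \<in> interior \<Omega>" for z
    proof -
      have "winding_number (\<lambda>t. ?G (L * t)) z = winding_number (\<lambda>t. \<gamma> (L * t)) z"
        using L by (intro winding_number_cong eq) (auto simp: mult_le_cancel_left1)
      then show ?thesis using wn[OF that] by simp
    qed
  qed
  then show ?thesis by blast
qed

subsection \<open>Reconstruction\<close>

lemma exit_dir_determined:
  fixes \<Gamma>1 \<Gamma>2 :: "real \<Rightarrow> complex"
  assumes P1: "tcgl_polygon \<Gamma>1 L r dl1 dr1 \<Omega>1" and P2: "tcgl_polygon \<Gamma>2 L r dl2 dr2 \<Omega>2"
    and s: "0 < s" "s < L" and straight: "dl1 s = dr1 s" "dl2 s = dr2 s"
    and radius: "derivs_agree_at (\<lambda>\<rho>. area_invariant \<Omega>1 \<Gamma>1 s \<rho>) (\<lambda>\<rho>. area_invariant \<Omega>2 \<Gamma>2 s \<rho>) r"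
    and arclength: "derivs_agree_at (\<lambda>\<sigma>. area_invariant \<Omega>1 \<Gamma>1 \<sigma> r) (\<lambda>\<sigma>. area_invariant \<Omega>2 \<Gamma>2 \<sigma> r) s"
  shows "tcgl_polygon.exit_dir \<Gamma>1 r dr1 s = tcgl_polygon.exit_dir \<Gamma>2 r dr2 s"
proof -
  interpret X: tcgl_polygon \<Gamma>1 L r dl1 dr1 \<Omega>1 by fact
  interpret Y: tcgl_polygon \<Gamma>2 L r dl2 dr2 \<Omega>2 by fact
  \<comment> \<open>\<open>derivs_agree_at\<close> is conditional on differentiability, which the
    explicit derivatives supply on both sides.\<close>
  have agree: "a = b" if "derivs_agree_at f h x" "(f has_real_derivative a) (at x)" "(h has_real_derivative b) (at x)"
    for f h a b x
    using that DERIV_imp_deriv[OF that(2)] DERIV_imp_deriv[OF that(3)]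
    by (auto simp: derivs_agree_at_def real_differentiable_def)
  have diff: "Im (X.entry_dir s) - Im (X.exit_dir s) = Im (Y.entry_dir s) - Im (Y.exit_dir s)"
    by (rule agree[OF arclength X.area_arclength_deriv[OF s straight(1)] Y.area_arclength_deriv[OF s straight(2)]])
  have "2 * r * measure lebesgue (sector r (Im (X.entry_dir s)) (Im (X.exit_dir s)) \<inter> cball 0 1) =
        2 * r * measure lebesgue (sector r (Im (Y.entry_dir s)) (Im (Y.exit_dir s)) \<inter> cball 0 1)"
    by (rule agree[OF radius X.area_radius_deriv[OF s straight(1)] Y.area_radius_deriv[OF s straight(2)]])
  then have "Im (X.entry_dir s) = Im (Y.entry_dir s) \<and> Im (X.exit_dir s) = Im (Y.exit_dir s)"
    using X.r by (intro sector_determined[OF X.r diff]) (simp_all add: X.dirs Y.dirs X.sector_borel Y.sector_borel s straight)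
  \<comment> \<open>The area data fix only heights; the real part follows from norm \<open>r\<close>
    and positivity.\<close>
  moreover have "Re (X.exit_dir s) = Re (Y.exit_dir s)"
  proof -
    have "(Re (X.exit_dir s))\<^sup>2 + (Im (X.exit_dir s))\<^sup>2 = (Re (Y.exit_dir s))\<^sup>2 + (Im (Y.exit_dir s))\<^sup>2"
      by (metis X.dirs(3) Y.dirs(3) cmod_power2)
    then have "(Re (X.exit_dir s))\<^sup>2 = (Re (Y.exit_dir s))\<^sup>2" using calculation by simp
    then show ?thesis
      by (rule power2_eq_imp_eq) (fact less_imp_le[OF X.dirs(5)] less_imp_le[OF Y.dirs(5)])+
  qed
  ultimately show ?thesis by (simp add: complex_eq_iff)
qed

lemma curves_congruent:
  fixes \<Gamma>1 \<Gamma>2 :: "real \<Rightarrow> complex"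
  assumes P1: "tcgl_polygon \<Gamma>1 L r dl1 dr1 \<Omega>1" and P2: "tcgl_polygon \<Gamma>2 L r dl2 dr2 \<Omega>2"
    and dir: "\<And>s. 0 < s \<Longrightarrow> s < L \<Longrightarrow> dl1 s = dr1 s \<Longrightarrow> dl2 s = dr2 s \<Longrightarrow>
       tcgl_polygon.exit_dir \<Gamma>1 r dr1 s = tcgl_polygon.exit_dir \<Gamma>2 r dr2 s"
  shows "\<exists>u k. norm u = 1 \<and> (\<forall>t\<in>{0..L}. \<Gamma>2 t = u * \<Gamma>1 t + k)"
proof -
  interpret X: tcgl_polygon \<Gamma>1 L r dl1 dr1 \<Omega>1 by fact
  interpret Y: tcgl_polygon \<Gamma>2 L r dl2 dr2 \<Omega>2 by fact
  \<comment> \<open>Ratios of the right tangents and of the left tangents of the two curves, to be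
    compared through the vectors \<open>V1\<close> and \<open>V2\<close> to the exit points.\<close>
  define \<mu> where "\<mu> s = dr2 s * cnj (dr1 s)" for s
  define \<nu> where "\<nu> s = dl2 s * cnj (dl1 s)" for s
  define V1 where "V1 s = X.exit s - \<Gamma>1 s" for s
  define V2 where "V2 s = Y.exit s - \<Gamma>2 s" for s
  have V: "V2 s = \<mu> s * V1 s" if "0 < s" "s < L" "dl1 s = dr1 s" "dl2 s = dr2 s" for s
  proof -
    have "\<mu> s * V1 s = dr2 s * X.exit_dir s" by (simp add: \<mu>_def V1_def X.exit_dir_def)
    also have "\<dots> = dr2 s * Y.exit_dir s" using dir[OF that] by simp
    also have "\<dots> = V2 s" using unit_mult_cnj[OF Y.norm_dr[of s]] by (simp add: V2_def Y.exit_dir_def flip: mult.assoc)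
    finally show ?thesis by simp
  qed
  have contV: "isCont V1 s" "isCont V2 s" for s
    unfolding V1_def[abs_def] V2_def[abs_def]
    by (intro continuous_intros X.isCont_exit X.isCont_curve Y.isCont_exit Y.isCont_curve)+
  have right: "\<exists>e>0. \<forall>x\<in>{s<..<s + e}. dr1 x = dr1 s \<and> dl1 x = dr1 s \<and> dr2 x = dr2 s \<and> dl2 x = dr2 s" for s
  proof -
    obtain a b where "a > 0" "b > 0" "\<forall>x\<in>{s<..<s + a}. dr1 x = dr1 s \<and> dl1 x = dr1 s"
      "\<forall>x\<in>{s<..<s + b}. dr2 x = dr2 s \<and> dl2 x = dr2 s"
      using X.directions_right[of s] Y.directions_right[of s] by blast
    then show ?thesis by (intro exI[of _ "min a b"]) auto
  qed
  have left: "\<exists>e>0. \<forall>x\<in>{s - e<..<s}. dr1 x = dl1 s \<and> dl1 x = dl1 s \<and> dr2 x = dl2 s \<and> dl2 x = dl2 s" for s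
  proof -
    obtain a b where "a > 0" "b > 0" "\<forall>x\<in>{s - a<..<s}. dr1 x = dl1 s \<and> dl1 x = dl1 s"
      "\<forall>x\<in>{s - b<..<s}. dr2 x = dl2 s \<and> dl2 x = dl2 s"
      using X.directions_left[of s] Y.directions_left[of s] by blast
    then show ?thesis by (intro exI[of _ "min a b"]) auto
  qed
  have \<mu>_eq_\<nu>: "\<mu> s = \<nu> s" if s: "0 < s" "s < L" for s
  proof -
    obtain e where e: "e > 0" "\<And>x. x \<in> {s<..<s + e} \<Longrightarrow> dr1 x = dr1 s \<and> dl1 x = dr1 s \<and> dr2 x = dr2 s \<and> dl2 x = dr2 s"
      using right by blast
    \<comment> \<open>Points just to the right of \<open>s\<close> are straight for both curves, so
      \<open>V\<close> applies to them even if \<open>s\<close> is a corner; the limit then gives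
      the relation at \<open>s\<close>.\<close>
    have "eventually (\<lambda>x. x \<in> {s<..<min (s + e) L}) (at_right s)"
      using e s by (intro eventually_at_rightI[of s "min (s + e) L"]) auto
    then have "eventually (\<lambda>x. V2 x - \<mu> s * V1 x = 0) (at_right s)"
    proof eventually_elim
      case (elim x)
      then have d: "dr1 x = dr1 s" "dl1 x = dr1 s" "dr2 x = dr2 s" "dl2 x = dr2 s" using e(2)[of x] by auto
      then have "V2 x = \<mu> x * V1 x" using elim s by (intro V) auto
      then show ?case using d by (simp add: \<mu>_def)
    qed
    then have "((\<lambda>x. V2 x - \<mu> s * V1 x) \<longlongrightarrow> 0) (at_right s)" by (rule tendsto_eventually)
    moreover have "((\<lambda>x. V2 x - \<mu> s * V1 x) \<longlongrightarrow> V2 s - \<mu> s * V1 s) (at_right s)"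
      using contV[of s] by (intro tendsto_intros) (auto simp: isCont_def intro: tendsto_within_subset)
    ultimately have 1: "V2 s = \<mu> s * V1 s" using tendsto_unique[of "at_right s"] by fastforce
    obtain e where e: "e > 0" "\<And>x. x \<in> {s - e<..<s} \<Longrightarrow> dr1 x = dl1 s \<and> dl1 x = dl1 s \<and> dr2 x = dl2 s \<and> dl2 x = dl2 s"
      using left by blast
    have "eventually (\<lambda>x. x \<in> {max (s - e) 0<..<s}) (at_left s)"
      using e s by (intro eventually_at_leftI[of "max (s - e) 0" s]) auto
    then have "eventually (\<lambda>x. V2 x - \<nu> s * V1 x = 0) (at_left s)"
    proof eventually_elim
      case (elim x)
      then have d: "dr1 x = dl1 s" "dl1 x = dl1 s" "dr2 x = dl2 s" "dl2 x = dl2 s" using e(2)[of x] by auto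
      then have "V2 x = \<mu> x * V1 x" using elim s by (intro V) auto
      then show ?case using d by (simp add: \<mu>_def \<nu>_def)
    qed
    then have "((\<lambda>x. V2 x - \<nu> s * V1 x) \<longlongrightarrow> 0) (at_left s)" by (rule tendsto_eventually)
    moreover have "((\<lambda>x. V2 x - \<nu> s * V1 x) \<longlongrightarrow> V2 s - \<nu> s * V1 s) (at_left s)"
      using contV[of s] by (intro tendsto_intros) (auto simp: isCont_def intro: tendsto_within_subset)
    ultimately have 2: "V2 s = \<nu> s * V1 s" using tendsto_unique[of "at_left s"] by fastforce
    \<comment> \<open>Both one-sided relations express \<open>V2 s\<close> through the same nonzero
      \<open>V1 s\<close>, so their factors coincide.\<close>
    have "norm (V1 s) = r" by (simp add: V1_def X.exit)
    then have "V1 s \<noteq> 0" using X.r by auto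
    then show ?thesis using 1 2 by simp
  qed
  have \<mu>_const: "\<mu> x = \<mu> y" if "x \<in> {0<..<L}" "y \<in> {0<..<L}" for x y
  proof (rule connected_local_const[OF _ that])
    show "\<forall>s\<in>{0<..<L}. eventually (\<lambda>x. \<mu> s = \<mu> x) (at s within {0<..<L})"
    proof
      fix s assume s: "s \<in> {0<..<L}"
      obtain e where e: "e > 0" "\<And>x. x \<in> {s<..<s + e} \<Longrightarrow> dr1 x = dr1 s \<and> dr2 x = dr2 s" using right by blast
      obtain e' where e': "e' > 0" "\<And>x. x \<in> {s - e'<..<s} \<Longrightarrow> dr1 x = dl1 s \<and> dr2 x = dl2 s" using left by blast
      have "\<mu> s = \<mu> x" if "dist x s < min e e'" for x
      proof (cases x s rule: linorder_cases)
        case less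
        then have "\<mu> x = \<nu> s" using e'(2)[of x] that by (auto simp: dist_real_def \<mu>_def \<nu>_def)
        then show ?thesis using \<mu>_eq_\<nu>[of s] s by simp
      next
        case greater
        then show ?thesis using e(2)[of x] that by (auto simp: dist_real_def \<mu>_def)
      qed simp
      then show "eventually (\<lambda>x. \<mu> s = \<mu> x) (at s within {0<..<L})"
        unfolding eventually_at using e(1) e'(1) by (intro exI[of _ "min e e'"]) auto
    qed
  qed simp
  define u where "u = \<mu> (L / 2)"
  have u: "norm u = 1" by (simp add: u_def \<mu>_def norm_mult)
  have \<mu>u: "\<mu> s = u" if "0 < s" "s < L" for s
    unfolding u_def using that X.L by (intro \<mu>_const) auto
  have dr2: "dr2 s = u * dr1 s" and dl2: "dl2 s = u * dl1 s" if s: "0 < s" "s < L" for s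
  proof -
    have "dr2 s = \<mu> s * dr1 s" using unit_mult_cnj[OF X.norm_dr[of s]] by (simp add: \<mu>_def mult.commute mult.left_commute)
    then show "dr2 s = u * dr1 s" using \<mu>u[OF s] by simp
    have "dl2 s = \<nu> s * dl1 s" using unit_mult_cnj[OF X.norm_dl[of s]] by (simp add: \<nu>_def mult.commute mult.left_commute)
    then show "dl2 s = u * dl1 s" using \<mu>u[OF s] \<mu>_eq_\<nu>[OF s] by simp
  qed
  \<comment> \<open>With the tangents related by the constant factor \<open>u\<close>, this
    difference is locally constant on the open interval; continuity extends it to the
    endpoints.\<close>
  define H where "H t = \<Gamma>2 t - u * \<Gamma>1 t" for t
  have H_const: "H x = H y" if "x \<in> {0<..<L}" "y \<in> {0<..<L}" for x y
  proof (rule connected_local_const[OF _ that])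
    show "\<forall>s\<in>{0<..<L}. eventually (\<lambda>x. H s = H x) (at s within {0<..<L})"
    proof
      fix s assume "s \<in> {0<..<L}"
      then have s: "0 < s" "s < L" by auto
      obtain a where a: "a > 0" "\<And>h. h \<in> {0..a} \<Longrightarrow> \<Gamma>1 (s + h) = \<Gamma>1 s + h *\<^sub>R dr1 s" using X.right by blast
      obtain b where b: "b > 0" "\<And>h. h \<in> {0..b} \<Longrightarrow> \<Gamma>2 (s + h) = \<Gamma>2 s + h *\<^sub>R dr2 s" using Y.right by blast
      obtain a' where a': "a' > 0" "\<And>h. h \<in> {0..a'} \<Longrightarrow> \<Gamma>1 (s - h) = \<Gamma>1 s - h *\<^sub>R dl1 s" using X.left by blast
      obtain b' where b': "b' > 0" "\<And>h. h \<in> {0..b'} \<Longrightarrow> \<Gamma>2 (s - h) = \<Gamma>2 s - h *\<^sub>R dl2 s" using Y.left by blast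
      define e where "e = min (min a b) (min a' b')"
      have "H s = H x" if x: "dist x s < e" for x
      proof (cases "x \<ge> s")
        case True
        then have "\<Gamma>1 x = \<Gamma>1 s + (x - s) *\<^sub>R dr1 s" "\<Gamma>2 x = \<Gamma>2 s + (x - s) *\<^sub>R (u * dr1 s)"
          using a(2)[of "x - s"] b(2)[of "x - s"] x dr2[OF s] by (simp_all add: e_def dist_real_def)
        then show ?thesis unfolding H_def by (simp only:) (simp add: algebra_simps)
      next
        case False
        then have "\<Gamma>1 x = \<Gamma>1 s - (s - x) *\<^sub>R dl1 s" "\<Gamma>2 x = \<Gamma>2 s - (s - x) *\<^sub>R (u * dl1 s)"
          using a'(2)[of "s - x"] b'(2)[of "s - x"] x dl2[OF s] by (simp_all add: e_def dist_real_def)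
        then show ?thesis unfolding H_def by (simp only:) (simp add: algebra_simps)
      qed
      then show "eventually (\<lambda>x. H s = H x) (at s within {0<..<L})"
        unfolding eventually_at using a(1) b(1) a'(1) b'(1) by (intro exI[of _ e]) (auto simp: e_def)
    qed
  qed simp
  have "H t = H (L / 2)" if "t \<in> {0..L}" for t
  proof (rule continuous_constant_on_closure[of "{0<..<L}"])
    show "continuous_on (closure {0<..<L}) H"
      unfolding H_def[abs_def] by (intro continuous_intros X.cont Y.cont)
    show "H x = H (L / 2)" if "x \<in> {0<..<L}" for x using that X.L by (intro H_const) auto
    show "t \<in> closure {0<..<L}" using that X.L by (simp add: closure_greaterThanLessThan)
  qed
  then have "\<forall>t\<in>{0..L}. \<Gamma>2 t = u * \<Gamma>1 t + H (L / 2)" by (auto simp: H_def algebra_simps)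
  then show ?thesis using u by blast
qed

theorem theorem4p6p1:
  fixes \<Omega>1 \<Omega>2 :: "complex set" and \<gamma>1 \<gamma>2 :: "real \<Rightarrow> complex" and L r :: real
    and g1 g2 :: "real \<Rightarrow> real \<Rightarrow> real"
  defines "g1 \<equiv> area_invariant \<Omega>1 (periodic_ext L \<gamma>1)"
    and "g2 \<equiv> area_invariant \<Omega>2 (periodic_ext L \<gamma>2)"
  assumes "polygon_param \<Omega>1 L \<gamma>1" and "polygon_param \<Omega>2 L \<gamma>2"
    and "r > 0" and "tcgl \<Omega>1 L \<gamma>1 r" and "tcgl \<Omega>2 L \<gamma>2 r"
    and "\<forall>s\<in>{0..<L}. g1 s r = g2 s r"
    and "\<forall>s\<in>{0..<L}. derivs_agree_at (\<lambda>\<rho>. g1 s \<rho>) (\<lambda>\<rho>. g2 s \<rho>) r"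
    and "\<forall>s\<in>{0..<L}. derivs_agree_at (\<lambda>\<sigma>. g1 \<sigma> r) (\<lambda>\<sigma>. g2 \<sigma> r) s"
  shows "\<exists>\<theta> c. \<Omega>2 = ((\<lambda>z. z + c) \<circ> (\<lambda>z. cis \<theta> * z)) ` \<Omega>1"
proof -
  let ?\<Gamma>1 = "periodic_ext L \<gamma>1" and ?\<Gamma>2 = "periodic_ext L \<gamma>2"
  obtain dl1 dr1 where P1: "tcgl_polygon ?\<Gamma>1 L r dl1 dr1 \<Omega>1" using tcgl_polygon_of_param assms by blast
  obtain dl2 dr2 where P2: "tcgl_polygon ?\<Gamma>2 L r dl2 dr2 \<Omega>2" using tcgl_polygon_of_param assms by blast
  interpret X: tcgl_polygon ?\<Gamma>1 L r dl1 dr1 \<Omega>1 by fact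
  interpret Y: tcgl_polygon ?\<Gamma>2 L r dl2 dr2 \<Omega>2 by fact
  have "tcgl_polygon.exit_dir ?\<Gamma>1 r dr1 s = tcgl_polygon.exit_dir ?\<Gamma>2 r dr2 s"
    if s: "0 < s" "s < L" "dl1 s = dr1 s" "dl2 s = dr2 s" for s
    using assms(9,10) s by (intro exit_dir_determined[OF P1 P2]) (auto simp: g1_def g2_def)
  then obtain u k where u: "norm u = 1" and \<Gamma>: "\<And>t. t \<in> {0..L} \<Longrightarrow> ?\<Gamma>2 t = u * ?\<Gamma>1 t + k"
    using curves_congruent[OF P1 P2] by blast
  define T where "T z = u * z + k" for z
  have u0: "u \<noteq> 0" using u by auto
  \<comment> \<open>A translation after an injective linear map; images under both commute with
    interior and closure.\<close>
  have T: "T ` A = (+) k ` (*) u ` A" for A by (auto simp: T_def image_image add.commute)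
  have lin: "linear ((*) u)" "inj ((*) u)" using u0 by (auto simp: injI intro: bounded_linear.linear bounded_linear_mult_right)
  have int: "interior (T ` A) = T ` interior A" and clo: "closure (T ` A) = T ` closure A" for A
    unfolding T interior_translation closure_translation
    using interior_injective_linear_image[OF lin] closure_injective_linear_image[OF lin] by simp_all
  have "frontier (T ` \<Omega>1) = T ` frontier \<Omega>1"
  proof -
    have "inj T" using u0 by (auto simp: T_def inj_def)
    then show ?thesis unfolding frontier_def int clo by (rule image_set_diff[symmetric])
  qed
  also have "\<dots> = frontier \<Omega>2"
  proof -
    have "range ?\<Gamma>1 = ?\<Gamma>1 ` {0..L}" "range ?\<Gamma>2 = ?\<Gamma>2 ` {0..L}"
      using X.range_period[of _ 0] Y.range_period[of _ 0] by force+
    moreover have "T ` ?\<Gamma>1 ` {0..L} = ?\<Gamma>2 ` {0..L}" unfolding image_image using \<Gamma> by (auto simp: T_def)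
    ultimately show ?thesis unfolding X.boundary Y.boundary by simp
  qed
  finally have fr: "frontier (T ` \<Omega>1) = path_image Y.loop" using Y.loop(3) by simp
  have contT: "continuous_on A T" for A unfolding T_def by (intro continuous_intros)
  \<comment> \<open>\<open>T\<close> has so far been shown only to match the boundaries; the Jordan
    curve theorem makes the regions equal.\<close>
  have "T ` \<Omega>1 = \<Omega>2"
  proof (rule boundary_determines_region[OF Y.loop(1,2)])
    show "compact (T ` \<Omega>1)" by (rule compact_continuous_image[OF contT X.cpt])
    show "connected (interior (T ` \<Omega>1))" unfolding int by (rule connected_continuous_image[OF contT X.conn])
    show "T ` \<Omega>1 = closure (interior (T ` \<Omega>1))" unfolding int clo using X.regular by simp
    show "frontier (T ` \<Omega>1) = path_image Y.loop" by (fact fr)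
    show "compact \<Omega>2" "connected (interior \<Omega>2)" "\<Omega>2 = closure (interior \<Omega>2)" by (fact Y.cpt Y.conn Y.regular)+
    show "frontier \<Omega>2 = path_image Y.loop" using Y.loop(3) by simp
  qed
  moreover have "T = (\<lambda>z. z + k) \<circ> (\<lambda>z. cis (Arg u) * z)"
    using cis_Arg[OF u0] u by (auto simp: T_def sgn_div_norm)
  ultimately show ?thesis by metis
qed

end
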